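(* Let $G$ be a finite simple connected graph with $V\ge 3$ vertices, and consider the infinite-$U$ spin-$\tfrac12$ Hubbard model on $G$ with exactly one hole, i.e. the operator $H_\infty = P\big(\sum_{i,j,\sigma} t_{ij}c^\dagger_{i\sigma}c_{j\sigma}\big)P$ acting on the space $\mathcal H_1$ defined in the context. Then $H_\infty$ satisfies the connectivity condition (in the minimal-$S_z$ sector) if and only if $G$ is non-separable and $G$ is not a polygon (cycle graph) with $V\ge 5$ vertices. Moreover, when these conditions hold, the ground state of $H_\infty$ on $\mathcal H_1$ is fully spin-polarized, i.e. has total spin $S_{\rm tot}=(V-1)/2$, and it is unique up to this spin degeneracy (the ground space is exactly one spin multiplet of dimension $V$).
   Context: Vertices of $G$ are labelled $1,\dots,V$. Hopping amplitudes: $t_{ij}=t_{ji}>0$ if $\{i,j\}$ is an edge of $G$, and $t_{ij}=0$ otherwise (including $i=j$). The spin-$\tfrac12$ Hubbard Hamiltonian is $H=\sum_{i,j,\sigma} t_{ij}c^\dagger_{i\sigma}c_{j\sigma}+U\sum_i n_{i\uparrow}n_{i\downarrow}$ with fermion operators $c_{i\sigma}$, $\sigma\in\{\uparrow,\downarrow\}$, $n_{i\sigma}=c^\dagger_{i\sigma}c_{i\sigma}$. The $U\to\infty$ limit with one hole: $\mathcal H_1$ is the space spanned by states with exactly $V-1$ electrons and no doubly occupied site; $P$ is the orthogonal projection onto $\mathcal H_1$. A basis of $\mathcal H_1$ consists of the states $|h,\sigma\rangle=(-1)^h\prod_{i\ne h} c^\dagger_{i,\sigma_i}|0\rangle$,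 where $h\in\{1,\dots,V\}$ is the hole position, $\sigma$ assigns a spin $\sigma_i\in\{\uparrow,\downarrow\}$ to each $i\neq h$, and the product is taken in a fixed order of increasing $i$. The minimal-$S_z$ sector is the span of basis states with total $S_z=0$ if $V-1$ is even and $S_z=1/2$ if $V-1$ is odd. Connectivity condition: for any two basis states $|h,\sigma\rangle$, $|h',\sigma'\rangle$ in the minimal-$S_z$ sector there exists a positive integer $n$ with $\langle h',\sigma'|H_\infty^n|h,\sigma\rangle\ne 0$ (equivalently, any configuration of spins and hole can be turned into any other with the same spin content by successively exchanging the hole with a spin on an adjacent vertex). A graph is non-separable if it is connected and remains connected after deleting any single vertex together with its incident edges. A polygon with $V$ vertices is the cycle graph $C_V$. *)

theory Defs
  imports Complex_Main "HOL-Library.Function_Algebras"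
begin

section \<open>Graph notions\<close>

text \<open>A simple graph on the vertex set {1..V} is given by a symmetric, irreflexive
  edge relation E whose edges lie inside {1..V}.\<close>

definition simple_graph :: "nat \<Rightarrow> (nat \<Rightarrow> nat \<Rightarrow> bool) \<Rightarrow> bool" where
  "simple_graph V E \<longleftrightarrow> (\<forall>i j. E i j \<longrightarrow> i \<in> {1..V} \<and> j \<in> {1..V})
      \<and> (\<forall>i j. E i j \<longleftrightarrow> E j i) \<and> (\<forall>i. \<not> E i i)"

text \<open>The graph induced on the vertex subset W is connected.\<close>
definition connected_on :: "nat set \<Rightarrow> (nat \<Rightarrow> nat \<Rightarrow> bool) \<Rightarrow> bool" where
  "connected_on W E \<longleftrightarrow>
     (\<forall>x\<in>W. \<forall>y\<in>W. (x, y) \<in> {(a, b). a \<in> W \<and> b \<in> W \<and> E a b}\<^sup>*)"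

definition graph_connected :: "nat \<Rightarrow> (nat \<Rightarrow> nat \<Rightarrow> bool) \<Rightarrow> bool" where
  "graph_connected V E \<longleftrightarrow> connected_on {1..V} E"

text \<open>Non-separable: connected and still connected after deleting any single vertex.\<close>
definition non_separable :: "nat \<Rightarrow> (nat \<Rightarrow> nat \<Rightarrow> bool) \<Rightarrow> bool" where
  "non_separable V E \<longleftrightarrow> graph_connected V E \<and>
     (\<forall>v\<in>{1..V}. connected_on ({1..V} - {v}) E)"

text \<open>The graph is (isomorphic to) the cycle graph C_V.\<close>
definition is_polygon :: "nat \<Rightarrow> (nat \<Rightarrow> nat \<Rightarrow> bool) \<Rightarrow> bool" where
  "is_polygon V E \<longleftrightarrow> (\<exists>f. bij_betw f {1..V} {0..<V} \<and>
     (\<forall>i\<in>{1..V}. \<forall>j\<in>{1..V}. E i j \<longleftrightarrow> (f j = (f i + 1) mod V \<or> f i = (f j + 1) mod V)))"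

section \<open>Fermionic Fock space\<close>

text \<open>Modes are pairs (site, spin), spin True = up, False = down.  The Fock space is
  spanned by occupation-number states |S> with S a finite set of modes; a vector is a
  function from sets of modes to complex coefficients.  Fermion operators are given by
  the standard Jordan-Wigner representation w.r.t. a fixed order on modes (site first).\<close>

type_synonym mode = "nat \<times> bool"
type_synonym fvec = "mode set \<Rightarrow> complex"

definition mode_less :: "mode \<Rightarrow> mode \<Rightarrow> bool" where
  "mode_less m m' \<longleftrightarrow> fst m < fst m' \<or> (fst m = fst m' \<and> snd m < snd m')"

definition jw_sign :: "mode \<Rightarrow> mode set \<Rightarrow> complex" where
  "jw_sign m S = (-1) ^ card {m' \<in> S. mode_less m' m}"

text \<open>creation operator c^dagger_m\<close>
definition cdag :: "mode \<Rightarrow> fvec \<Rightarrow> fvec" where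
  "cdag m \<psi> = (\<lambda>S. if m \<in> S then jw_sign m (S - {m}) * \<psi> (S - {m}) else 0)"

text \<open>annihilation operator c_m (adjoint of cdag m)\<close>
definition cann :: "mode \<Rightarrow> fvec \<Rightarrow> fvec" where
  "cann m \<psi> = (\<lambda>S. if m \<notin> S then jw_sign m S * \<psi> (insert m S) else 0)"

definition num :: "mode \<Rightarrow> fvec \<Rightarrow> fvec" where
  "num m \<psi> = cdag m (cann m \<psi>)"

definition vac :: fvec where
  "vac = (\<lambda>S. if S = {} then 1 else 0)"

definition modes :: "nat \<Rightarrow> mode set" where
  "modes V = {1..V} \<times> (UNIV :: bool set)"

text \<open>inner product on the Fock space of the graph with V vertices\<close>
definition fip :: "nat \<Rightarrow> fvec \<Rightarrow> fvec \<Rightarrow> complex" where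
  "fip V \<phi> \<psi> = (\<Sum>S\<in>Pow (modes V). cnj (\<phi> S) * \<psi> S)"

section \<open>One-hole space and the U = infinity Hamiltonian\<close>

text \<open>configurations with exactly V-1 electrons and no doubly occupied site\<close>
definition configs1 :: "nat \<Rightarrow> mode set set" where
  "configs1 V = {S. S \<subseteq> modes V \<and> card S = V - 1 \<and>
                     (\<forall>i. \<not> ((i, True) \<in> S \<and> (i, False) \<in> S))}"

text \<open>the space H_1 (span of the configuration states in configs1)\<close>
definition H1 :: "nat \<Rightarrow> fvec set" where
  "H1 V = {\<psi>. \<forall>S. S \<notin> configs1 V \<longrightarrow> \<psi> S = 0}"

text \<open>orthogonal projection P onto H_1\<close>
definition Proj1 :: "nat \<Rightarrow> fvec \<Rightarrow> fvec" where
  "Proj1 V \<psi> = (\<lambda>S. if S \<in> configs1 V then \<psi> S else 0)"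

text \<open>hopping operator sum_{i,j,sigma} t_ij c^dagger_{i sigma} c_{j sigma}\<close>
definition hop :: "nat \<Rightarrow> (nat \<Rightarrow> nat \<Rightarrow> real) \<Rightarrow> fvec \<Rightarrow> fvec" where
  "hop V t \<psi> = (\<lambda>S. \<Sum>i\<in>{1..V}. \<Sum>j\<in>{1..V}. \<Sum>s\<in>(UNIV :: bool set).
      complex_of_real (t i j) * cdag (i, s) (cann (j, s) \<psi>) S)"

definition H_inf :: "nat \<Rightarrow> (nat \<Rightarrow> nat \<Rightarrow> real) \<Rightarrow> fvec \<Rightarrow> fvec" where
  "H_inf V t \<psi> = Proj1 V (hop V t (Proj1 V \<psi>))"

text \<open>basis state |h,sigma> = (-1)^h prod_{i ~= h} c^dagger_{i,sigma_i} |0>, product in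
  increasing order of i\<close>
definition basis_state :: "nat \<Rightarrow> nat \<Rightarrow> (nat \<Rightarrow> bool) \<Rightarrow> fvec" where
  "basis_state V h \<sigma> =
     (\<lambda>S. (-1) ^ h * foldr (\<lambda>i \<phi>. cdag (i, \<sigma> i) \<phi>) (filter (\<lambda>i. i \<noteq> h) [1..<V+1]) vac S)"

text \<open>total S_z of the basis state |h,sigma>\<close>
definition Sz_basis :: "nat \<Rightarrow> nat \<Rightarrow> (nat \<Rightarrow> bool) \<Rightarrow> real" where
  "Sz_basis V h \<sigma> = (real (card {i \<in> {1..V} - {h}. \<sigma> i})
                       - real (card {i \<in> {1..V} - {h}. \<not> \<sigma> i})) / 2"

definition min_Sz :: "nat \<Rightarrow> real" where
  "min_Sz V = (if even (V - 1) then 0 else 1/2)"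

definition connectivity :: "nat \<Rightarrow> (nat \<Rightarrow> nat \<Rightarrow> real) \<Rightarrow> bool" where
  "connectivity V t \<longleftrightarrow>
     (\<forall>h \<sigma> h' \<sigma>'. h \<in> {1..V} \<longrightarrow> h' \<in> {1..V} \<longrightarrow>
        Sz_basis V h \<sigma> = min_Sz V \<longrightarrow> Sz_basis V h' \<sigma>' = min_Sz V \<longrightarrow>
        (\<exists>n>0. fip V (basis_state V h' \<sigma>') ((H_inf V t ^^ n) (basis_state V h \<sigma>)) \<noteq> 0))"

section \<open>Spin operators\<close>

definition S_plus :: "nat \<Rightarrow> fvec \<Rightarrow> fvec" where
  "S_plus V \<psi> = (\<lambda>S. \<Sum>i\<in>{1..V}. cdag (i, True) (cann (i, False) \<psi>) S)"

definition S_minus :: "nat \<Rightarrow> fvec \<Rightarrow> fvec" where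
  "S_minus V \<psi> = (\<lambda>S. \<Sum>i\<in>{1..V}. cdag (i, False) (cann (i, True) \<psi>) S)"

definition S_z :: "nat \<Rightarrow> fvec \<Rightarrow> fvec" where
  "S_z V \<psi> = (\<lambda>S. \<Sum>i\<in>{1..V}. (num (i, True) \<psi> S - num (i, False) \<psi> S) / 2)"

text \<open>S_tot^2 = (S^+ S^- + S^- S^+)/2 + (S^z)^2\<close>
definition S_tot_sq :: "nat \<Rightarrow> fvec \<Rightarrow> fvec" where
  "S_tot_sq V \<psi> = (\<lambda>S. (S_plus V (S_minus V \<psi>) S + S_minus V (S_plus V \<psi>) S) / 2
                        + S_z V (S_z V \<psi>) S)"

section \<open>Spectral notions on H_1\<close>

definition cscale :: "complex \<Rightarrow> fvec \<Rightarrow> fvec" where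
  "cscale c \<psi> = (\<lambda>S. c * \<psi> S)"

definition eigvec_H1 :: "nat \<Rightarrow> (nat \<Rightarrow> nat \<Rightarrow> real) \<Rightarrow> real \<Rightarrow> fvec \<Rightarrow> bool" where
  "eigvec_H1 V t E \<psi> \<longleftrightarrow> \<psi> \<in> H1 V \<and> \<psi> \<noteq> 0 \<and> H_inf V t \<psi> = cscale (complex_of_real E) \<psi>"

definition ground_space :: "nat \<Rightarrow> (nat \<Rightarrow> nat \<Rightarrow> real) \<Rightarrow> real \<Rightarrow> fvec set" where
  "ground_space V t E = {\<psi> \<in> H1 V. H_inf V t \<psi> = cscale (complex_of_real E) \<psi>}"

text \<open>complex dimension of a subspace of the Fock space\<close>
definition cdim :: "fvec set \<Rightarrow> nat" where
  "cdim W = vector_space.dim cscale W"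

end

theory Submission
  imports Defs "HOL-Combinatorics.Transposition" "HOL-Analysis.Function_Topology"
begin

text \<open>
  In the basis \<open>|h,\<sigma>\<rangle>\<close> every matrix element of \<open>H\<close> is \<open>-t\<close> or \<open>0\<close>, so connectivity says that the
  hole, exchanging its place with adjacent spins, can turn any two-coloured configuration into any
  other one with the same number of up spins.

  Call two vertices exchangeable for a hole at \<open>h\<close> if their colours can be swapped in every
  configuration, with everything else restored. This is an equivalence relation, and hole walks
  transport it. If all pairs inside a connected set \<open>W\<close> of at least three vertices are exchangeable,
  then a walk of the hole leaving \<open>W\<close> at \<open>a\<close> and returning at \<open>b \<noteq> a\<close> carries the spin of \<open>b\<close> to the last
  vertex of the walk outside \<open>W\<close>, so this vertex can be added to \<open>W\<close>. In a non-separable graph it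
  thus suffices to find one exchangeable pair that forms a connected triple with the hole. A
  non-separable graph with a vertex of degree three contains a theta graph; the commutators of the
  rotations along its cycles are products of two transpositions, and their commutators in turn are
  3-cycles, with shortcuts if some paths are very short. The exception is the theta graph with paths of 1, 2 and 2 inner vertices, in which a
  suitable product has to be chosen depending on the two-colouring.

  Conversely, the number of up spins on one side of a cut vertex and the cyclic order of the spins on
  a polygon are invariant under moves of the hole.

  For the ground state, let \<open>\<phi>\<close> be the Perron vector of the hopping matrix. The state with amplitude
  \<open>\<phi> h\<close> on all configurations of a sector is an eigenvector; comparison with it bounds the spectrum
  from below and, by connectivity of all sectors and the maximum principle, shows that it is the only
  ground state of its sector. These \<open>V\<close> states are symmetric in the spins, hence fully polarized.
\<close>

section \<open>Hole walks\<close>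

text \<open>A state consists of the position \<open>h\<close> of the hole and the colours \<open>f\<close> of all vertices; the value
  \<open>f h\<close> is junk that travels along with the hole.\<close>

inductive slide :: "('v \<Rightarrow> 'v \<Rightarrow> bool) \<Rightarrow> 'v \<Rightarrow> ('v \<Rightarrow> 'a) \<Rightarrow> 'v \<Rightarrow> ('v \<Rightarrow> 'a) \<Rightarrow> bool"
  for E h f where
  slide_refl: "slide E h f h f"
| slide_step: "slide E h f v g \<Longrightarrow> E v w \<Longrightarrow> slide E h f w (g \<circ> transpose v w)"

lemma slide_single: "E v w \<Longrightarrow> slide E v f w (f \<circ> transpose v w)"
  by (rule slide_step[OF slide_refl])

lemma slide_trans:
  assumes "slide E h f v g" "slide E v g w k"
  shows "slide E h f w k"
  using assms(2,1) by (induction rule: slide.induct) (auto intro: slide_step)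

lemma slide_sym:
  assumes "slide E h f v g" and sym: "symp E"
  shows "slide E v g h f"
  using assms(1)
proof (induction rule: slide.induct)
  case (slide_step v g w)
  have "slide E w (g \<circ> transpose v w) v ((g \<circ> transpose v w) \<circ> transpose w v)"
    using slide_step.hyps sym by (intro slide_single) (auto dest: sympD)
  moreover have "(g \<circ> transpose v w) \<circ> transpose w v = g"
    by (auto simp: fun_eq_iff transpose_commute[of w v])
  ultimately show ?case using slide_step.IH slide_trans by metis
qed (rule slide_refl)

text \<open>A walk of the hole only rearranges positions, so it commutes with every map of the
  colours. Started from \<open>id\<close>, it records its own permutation \<open>p\<close>, and any
  colouring \<open>k\<close> then arrives as \<open>k \<circ> p\<close>.\<close>

lemma slide_comp: "slide E h f v g \<Longrightarrow> slide E h (k \<circ> f) v (k \<circ> g)"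
  by (induction rule: slide.induct) (simp_all only: slide_refl slide_step flip: comp_assoc)

lemma slide_id_bij: "slide E h id v p \<Longrightarrow> bij p"
  by (induction rule: slide.induct) (simp_all only: bij_id bij_comp bij_transpose)

lemma slide_id_hole: "slide E h id v p \<Longrightarrow> p v = h"
  by (induction rule: slide.induct) auto

text \<open>Along a path every colour steps back by one vertex towards the start, and the junk value
  of the hole ends on the last vertex. Two such shifts make up the round trip in
  \<open>theta_detour\<close>.\<close>

lemma slide_path:
  assumes "successively E (h # vs)" "distinct (h # vs)"
  shows "\<exists>g. slide E h f (last (h # vs)) g \<and> map g (h # vs) = map f vs @ [f h] \<and>
             (\<forall>v. v \<notin> set (h # vs) \<longrightarrow> g v = f v)"
  using assms
proof (induction vs arbitrary: h f)
  case Nil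
  then show ?case by (auto intro: slide_refl)
next
  case (Cons v vs)
  let ?f = "f \<circ> transpose h v"
  from Cons.prems have "successively E (v # vs)" "distinct (v # vs)" by auto
  from Cons.IH[OF this, of ?f] obtain g where
    g: "slide E v ?f (last (v # vs)) g" "map g (v # vs) = map ?f vs @ [?f v]"
       "\<And>w. w \<notin> set (v # vs) \<Longrightarrow> g w = ?f w" by blast
  have "slide E h f v ?f" using Cons.prems by (intro slide_single) auto
  with g(1) have "slide E h f (last (h # v # vs)) g" by (auto intro: slide_trans)
  moreover have "g h = f v" using g(3)[of h] Cons.prems by auto
  moreover have "map ?f vs = map f vs" using Cons.prems by (auto simp: transpose_def)
  moreover have "g w = f w" if "w \<notin> set (h # v # vs)" for w
    using g(3)[of w] that by auto
  ultimately show ?case using g(2) by (intro exI[of _ g]) auto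
qed

text \<open>The walk may depend on the two-colouring \<open>f\<close>. This is weaker than realizing
  the transposition of labelled spins by a single walk; the freedom is used in
  \<open>square_exchangeable\<close> and \<open>swap_lengths_1_2_2\<close>.\<close>

definition exchangeable :: "('v \<Rightarrow> 'v \<Rightarrow> bool) \<Rightarrow> 'v \<Rightarrow> 'v \<Rightarrow> 'v \<Rightarrow> bool" where
  "exchangeable E h i j \<longleftrightarrow> (\<forall>f :: 'v \<Rightarrow> bool. slide E h f h (f \<circ> transpose i j))"

lemma exchangeable_refl: "exchangeable E h i i"
  by (auto simp: exchangeable_def intro: slide_refl)

lemma exchangeable_sym: "exchangeable E h i j \<Longrightarrow> exchangeable E h j i"
  by (simp add: exchangeable_def transpose_commute)

lemma exchangeable_trans:
  assumes "exchangeable E h i j" "exchangeable E h j k"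
  shows "exchangeable E h i k"
proof (cases "i = j \<or> j = k \<or> i = k")
  case True
  then show ?thesis using assms exchangeable_refl by metis
next
  case False
  then have "transpose i k = transpose i j \<circ> transpose j k \<circ> transpose i j"
    using transpose_comp_triple[of i k j] by auto
  then have eq: "f \<circ> transpose i k = ((f \<circ> transpose i j) \<circ> transpose j k) \<circ> transpose i j"
    for f :: "'a \<Rightarrow> bool" by (simp only: comp_assoc)
  show ?thesis
    unfolding exchangeable_def eq
    using assms[unfolded exchangeable_def] slide_trans by meson
qed

text \<open>Conjugation: walk back from \<open>v\<close> to \<open>h\<close>, exchange there, and
  walk forth again. The colour that the walk brings to \<open>i\<close> comes from
  \<open>p i\<close>, hence the pair \<open>p i\<close>, \<open>p j\<close> at
  \<open>h\<close>.\<close>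

lemma exchangeable_transport:
  assumes "symp E" "slide E h id v p" "exchangeable E h (p i) (p j)"
  shows "exchangeable E v i j"
  unfolding exchangeable_def
proof
  fix f :: "'a \<Rightarrow> bool"
  have bij: "bij p" using assms(2) by (rule slide_id_bij)
  define g where "g = f \<circ> inv p"
  have gp: "g \<circ> p = f" using bij by (simp add: g_def fun_eq_iff bij_is_inj)
  have "slide E h g v f" using slide_comp[OF assms(2), of g] gp by simp
  moreover have "slide E h g h (g \<circ> transpose (p i) (p j))"
    using assms(3) by (simp add: exchangeable_def)
  moreover have "slide E h (g \<circ> transpose (p i) (p j)) v (f \<circ> transpose i j)"
  proof -
    have "g \<circ> transpose (p i) (p j) \<circ> p = f \<circ> transpose i j"
      using bij by (auto simp: fun_eq_iff gp[symmetric] transpose_def bij_def inj_eq)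
    then show ?thesis using slide_comp[OF assms(2), of "g \<circ> transpose (p i) (p j)"] by simp
  qed
  ultimately show "slide E v f v (f \<circ> transpose i j)"
    using slide_sym[OF _ assms(1)] by (blast intro: slide_trans)
qed

section \<open>Growing a set of exchangeable vertices\<close>

definition induced :: "'v set \<Rightarrow> ('v \<Rightarrow> 'v \<Rightarrow> bool) \<Rightarrow> ('v \<times> 'v) set" where
  "induced W E = {(a, b). a \<in> W \<and> b \<in> W \<and> E a b}"

lemma connected_on_induced: "connected_on W E \<longleftrightarrow> (\<forall>x\<in>W. \<forall>y\<in>W. (x, y) \<in> (induced W E)\<^sup>*)"
  by (simp add: connected_on_def induced_def)

lemma sym_induced: "symp E \<Longrightarrow> sym (induced W E)"
  by (auto simp: induced_def sym_def dest: sympD)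

lemma induced_rtrancl_in: "(x, y) \<in> (induced W E)\<^sup>* \<Longrightarrow> x \<in> W \<Longrightarrow> y \<in> W"
  by (induction rule: rtrancl_induct) (auto simp: induced_def)

lemma slide_within:
  assumes "(x, y) \<in> (induced W E)\<^sup>*"
  shows "\<exists>p. slide E x id y p \<and> (\<forall>v. v \<notin> W \<longrightarrow> p v = v)"
  using assms
proof (induction rule: rtrancl_induct)
  case base
  then show ?case by (auto intro: slide_refl)
next
  case (step y z)
  then obtain p where p: "slide E x id y p" "\<And>v. v \<notin> W \<Longrightarrow> p v = v" by blast
  have "y \<in> W" "z \<in> W" "E y z" using step by (auto simp: induced_def)
  then have "(p \<circ> transpose y z) v = v" if "v \<notin> W" for v
    using p(2)[OF that] that by (metis comp_apply transpose_apply_other)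
  then show ?case using slide_step[OF p(1) \<open>E y z\<close>] by blast
qed

definition freely_permutable :: "(nat \<Rightarrow> nat \<Rightarrow> bool) \<Rightarrow> nat set \<Rightarrow> bool" where
  "freely_permutable E W \<longleftrightarrow> connected_on W E \<and>
     (\<forall>h\<in>W. \<forall>i\<in>W - {h}. \<forall>j\<in>W - {h}. exchangeable E h i j)"

text \<open>One position of the hole suffices: a walk inside \<open>W\<close> from \<open>h\<close>
  to \<open>v\<close> fixes everything outside \<open>W\<close> and has \<open>p v = h\<close>, so
  \<open>p\<close> maps \<open>W - {v}\<close> into \<open>W - {h}\<close> and
  \<open>exchangeable_transport\<close> applies.\<close>

lemma freely_permutableI:
  assumes "symp E" "connected_on W E" "h \<in> W"
    and ex: "\<And>i j. i \<in> W - {h} \<Longrightarrow> j \<in> W - {h} \<Longrightarrow> exchangeable E h i j"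
  shows "freely_permutable E W"
  unfolding freely_permutable_def
proof (intro conjI ballI)
  fix v i j assume v: "v \<in> W" and i: "i \<in> W - {v}" and j: "j \<in> W - {v}"
  have hv: "(h, v) \<in> (induced W E)\<^sup>*" using assms(2,3) v by (auto simp: connected_on_induced)
  obtain p where p: "slide E h id v p" "\<And>u. u \<notin> W \<Longrightarrow> p u = u"
    using slide_within[OF hv] by blast
  have bij: "bij p" using p(1) by (rule slide_id_bij)
  have "p u \<in> W - {h}" if "u \<in> W - {v}" for u
  proof -
    have inj: "inj p" using bij by (rule bij_is_inj)
    have "p u \<noteq> h" using slide_id_hole[OF p(1)] that injD[OF inj, of u v] by auto
    moreover have "p u \<in> W" using p(2)[of "p u"] that injD[OF inj, of "p u" u] by (metis DiffD1)
    ultimately show ?thesis by simp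
  qed
  then show "exchangeable E v i j"
    using i j by (intro exchangeable_transport[OF assms(1) p(1)] ex)
qed (fact assms(2))

lemma connected_on_insert:
  assumes "symp E" "connected_on W E" "b \<in> W" "E b u"
  shows "connected_on (insert u W) E"
proof -
  let ?R = "induced (insert u W) E"
  have mono: "(induced W E)\<^sup>* \<subseteq> ?R\<^sup>*" by (rule rtrancl_mono) (auto simp: induced_def)
  have sym: "sym (?R\<^sup>*)" using assms(1) by (intro sym_rtrancl sym_induced)
  have b: "(b, v) \<in> ?R\<^sup>*" if "v \<in> insert u W" for v
  proof (cases "v = u")
    case True
    then show ?thesis using assms(3,4) by (auto simp: induced_def)
  next
    case False
    then show ?thesis using that assms(2,3) mono by (auto simp: connected_on_induced)
  qed
  show ?thesis unfolding connected_on_induced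
    using b sym by (meson rtrancl_trans symD)
qed

text \<open>Let \<open>K\<close> be a component of the complement of \<open>W\<close>. If at most
  one vertex \<open>c\<close> of \<open>W\<close> had neighbours in \<open>K\<close>, deleting
  \<open>c\<close> would separate \<open>K\<close> from the rest of \<open>W\<close>. Hence
  \<open>K\<close> is attached to \<open>W\<close> at two different vertices.\<close>

lemma exists_outside_ear:
  assumes ns: "non_separable V E" and "symp E" and W: "W \<subset> {1..V}" "a0 \<in> W" "b0 \<in> W" "a0 \<noteq> b0"
  shows "\<exists>a u w b. a \<in> W \<and> b \<in> W \<and> a \<noteq> b \<and> E a u \<and> E w b \<and> u \<in> {1..V} - W \<and>
           (u, w) \<in> (induced ({1..V} - W) E)\<^sup>*"
proof -
  let ?C = "{1..V} - W"
  let ?R = "induced ?C E"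
  obtain v where v: "v \<in> ?C" using W(1) by blast
  define K where "K = {u. (v, u) \<in> ?R\<^sup>*}"
  have KC: "K \<subseteq> ?C" using v by (auto simp: K_def dest: induced_rtrancl_in)
  have escape: "\<exists>u a. u \<in> K \<and> a \<in> W \<and> a \<noteq> c \<and> E u a" if c: "c \<in> W" "d \<in> W" "d \<noteq> c"
    for c d
  proof (rule ccontr)
    assume no: "\<not> (\<exists>u a. u \<in> K \<and> a \<in> W \<and> a \<noteq> c \<and> E u a)"
    have "(v, d) \<in> (induced ({1..V} - {c}) E)\<^sup>*"
    proof -
      have "c \<in> {1..V}" "d \<in> {1..V} - {c}" "v \<in> {1..V} - {c}" using c W(1) v by blast+
      then show ?thesis using ns unfolding non_separable_def connected_on_induced by blast
    qed
    then have "d \<in> K"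
    proof (induction rule: rtrancl_induct)
      case base
      then show ?case by (simp add: K_def)
    next
      case (step y z)
      then have "z \<in> ?C" using no by (auto simp: induced_def)
      then have "(y, z) \<in> ?R" using step KC by (auto simp: induced_def)
      then show ?case using step by (auto simp: K_def intro: rtrancl_into_rtrancl)
    qed
    then show False using c KC by auto
  qed
  obtain w b where b: "w \<in> K" "b \<in> W" "E w b" using escape[of a0 b0] W by auto
  obtain d where "d \<in> W" "d \<noteq> b" using W by metis
  then obtain u a where a: "u \<in> K" "a \<in> W" "a \<noteq> b" "E u a" using escape[of b d] b by auto
  have "(u, w) \<in> ?R\<^sup>*"
  proof -
    have "(u, v) \<in> ?R\<^sup>*" using a(1) sym_rtrancl[OF sym_induced[OF assms(2)]]
      by (auto simp: K_def dest: symD)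
    then show ?thesis using b by (auto simp: K_def)
  qed
  then show ?thesis using a b KC assms(2) by (meson subsetD sympD)
qed

lemma freely_permutable_grow:
  assumes ns: "non_separable V E" and sym: "symp E" and good: "freely_permutable E W"
    and W: "W \<subset> {1..V}" "card W \<ge> 3"
  shows "\<exists>u. u \<in> {1..V} - W \<and> freely_permutable E (insert u W)"
proof -
  have fin: "finite W" using W by (meson finite_atLeastAtMost finite_subset psubsetE)
  obtain a0 b0 where "a0 \<in> W" "b0 \<in> W" "a0 \<noteq> b0"
  proof -
    have "\<not> card W \<le> Suc 0" using W by simp
    then show ?thesis using that fin by (auto simp: card_le_Suc0_iff_eq)
  qed
  from exists_outside_ear[OF ns sym W(1) this] obtain a u w b where
    ab: "a \<in> W" "b \<in> W" "a \<noteq> b" "E a u" "E w b" and u: "u \<in> {1..V} - W" and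
    uw: "(u, w) \<in> (induced ({1..V} - W) E)\<^sup>*" by blast
  have w: "w \<in> {1..V} - W" using induced_rtrancl_in[OF uw u] .
  obtain p where p: "slide E u id w p" "\<And>v. v \<notin> {1..V} - W \<Longrightarrow> p v = v"
    using slide_within[OF uw] by blast
  define q where "q = transpose a u \<circ> p \<circ> transpose w b"
  have "slide E a id u (transpose a u)" using slide_single[of E a u id] ab by simp
  moreover have "slide E u (transpose a u) w (transpose a u \<circ> p)"
    using slide_comp[OF p(1), of "transpose a u"] by simp
  ultimately have q: "slide E a id b q"
    unfolding q_def using ab(5) by (meson slide_step slide_trans)
  have "\<not> W \<subseteq> {a, b}" using W(2) card_mono[of "{a,b}" W] by (auto split: if_splits simp: card_insert_if)
  then obtain c where c: "c \<in> W" "c \<noteq> a" "c \<noteq> b" by blast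
  \<comment> \<open>The third vertex \<open>c\<close> keeps its spin, while that of \<open>b\<close>
    moves to \<open>w\<close> when the hole arrives at \<open>b\<close>. So the exchange of
    \<open>c\<close> and \<open>b\<close> with the hole at \<open>a\<close> is transported to an
    exchange of \<open>c\<close> and \<open>w\<close> with the hole at \<open>b\<close>.\<close>
  have "q c = c" using c p(2)[of c] u w by (auto simp: q_def transpose_def)
  moreover have "q w = b" using p(2)[of b] ab u by (auto simp: q_def transpose_def)
  ultimately have "exchangeable E b c w"
    using exchangeable_transport[OF sym q, of c w] good ab c by (auto simp: freely_permutable_def)
  then have "exchangeable E b i w" if "i \<in> W - {b}" for i
    using that good ab c by (auto simp: freely_permutable_def intro: exchangeable_trans)
  moreover have "connected_on (insert w W) E"
    using good ab sym by (intro connected_on_insert[of E W b]) (auto simp: freely_permutable_def dest: sympD)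
  ultimately have "freely_permutable E (insert w W)"
    using good ab w by (intro freely_permutableI[OF sym, of _ b])
      (auto simp: freely_permutable_def intro: exchangeable_refl exchangeable_sym)
  then show ?thesis using w by blast
qed

lemma freely_permutable_extend:
  assumes "non_separable V E" "symp E" "freely_permutable E W" "W \<subseteq> {1..V}" "card W \<ge> 3"
  shows "freely_permutable E {1..V}"
  using assms(3-5)
proof (induction "card ({1..V} - W)" arbitrary: W rule: less_induct)
  case less
  show ?case
  proof (cases "W = {1..V}")
    case True
    then show ?thesis using less.prems by simp
  next
    case False
    then have "W \<subset> {1..V}" using less.prems by blast
    then obtain u where u: "u \<in> {1..V} - W" "freely_permutable E (insert u W)"
      using freely_permutable_grow[OF assms(1,2) less.prems(1) _ less.prems(3)] by blast
    have "card ({1..V} - insert u W) < card ({1..V} - W)"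
      using u by (intro psubset_card_mono) blast+
    moreover have "card (insert u W) \<ge> 3" using less.prems(3) card_insert_le[of W u] by linarith
    moreover have "insert u W \<subseteq> {1..V}" using less.prems u by blast
    ultimately show ?thesis using less.hyps u by blast
  qed
qed

text \<open>As the numbers of \<open>True\<close> agree, a vertex that is wrongly
  \<open>True\<close> comes with one that is wrongly \<open>False\<close>. Exchanging the two lowers
  the number of wrongly \<open>True\<close> vertices.\<close>

lemma freely_permutable_slide:
  assumes good: "freely_permutable E W" and "finite W" "h \<in> W"
    and "card {i \<in> W - {h}. f i} = card {i \<in> W - {h}. g i}"
    and "\<And>i. i \<notin> W - {h} \<Longrightarrow> f i = g i"
  shows "slide E h f h g"
  using assms(4,5)
proof (induction "card {i. f i \<and> \<not> g i}" arbitrary: f rule: less_induct)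
  case less
  let ?A = "\<lambda>f. {i \<in> W - {h}. f i}"
  have fin: "finite (?A f)" "finite (?A g)" using assms(2) by auto
  show ?case
  proof (cases "?A f \<subseteq> ?A g")
    case True
    then have "?A f = ?A g" using less.prems fin by (intro card_subset_eq) auto
    then have "f = g" using less.prems(2) by (auto simp: fun_eq_iff set_eq_iff)
    then show ?thesis by (auto intro: slide_refl)
  next
    case False
    then have "\<not> ?A g \<subseteq> ?A f" using less.prems fin card_subset_eq[of "?A f" "?A g"] by auto
    with False obtain i j where ij: "i \<in> W - {h}" "f i" "\<not> g i" "j \<in> W - {h}" "g j" "\<not> f j"
      by blast
    let ?f = "f \<circ> transpose i j"
    have "slide E h f h ?f"
      using good ij assms(3) by (auto simp: freely_permutable_def exchangeable_def)
    moreover have "slide E h ?f h g"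
    proof (rule less.hyps)
      have "{i. f i \<and> \<not> g i} \<subseteq> W" using less.prems(2) by auto
      then have "finite {i. f i \<and> \<not> g i}" using assms(2) by (rule finite_subset)
      moreover have "{i. ?f i \<and> \<not> g i} \<subseteq> {i. f i \<and> \<not> g i} - {i}"
        using ij by (auto simp: transpose_def split: if_splits)
      ultimately show "card {i. ?f i \<and> \<not> g i} < card {i. f i \<and> \<not> g i}"
        using ij by (intro psubset_card_mono) auto
      have "?A ?f = transpose i j ` ?A f"
        using ij by (auto simp: image_iff transpose_def split: if_splits) 
      then show "card (?A ?f) = card (?A g)"
        using less.prems by (simp add: card_image)
      show "?f v = g v" if "v \<notin> W - {h}" for v
        using that ij less.prems(2)[OF that] by (auto simp: transpose_def)
    qed
    ultimately show ?thesis by (rule slide_trans)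
  qed
qed

lemma freely_permutable_triple:
  assumes "symp E" "exchangeable E h i j" "E h i" "E h j \<or> E i j"
  shows "freely_permutable E {h, i, j}"
proof (rule freely_permutableI[of _ _ h])
  have "connected_on {h} E" by (auto simp: connected_on_induced)
  then have *: "connected_on {i, h} E" using assms by (intro connected_on_insert[of E "{h}" h]) auto
  then show "connected_on {h, i, j} E"
    using assms connected_on_insert[OF _ *, of _ j] by (auto simp: insert_commute)
qed (use assms exchangeable_refl exchangeable_sym in auto)

section \<open>Theta graphs\<close>

text \<open>A theta graph consists of three paths \<open>P\<close>, \<open>Q\<close>, \<open>R\<close> from \<open>x\<close> to \<open>y\<close>. With the hole at \<open>x\<close>, a triple
  \<open>(M, q, r)\<close> lists the colours along \<open>P @ [y]\<close>, \<open>Q\<close> and \<open>R\<close>. The rule \<open>wm_PQ\<close> sends the hole to \<open>y\<close>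
  along \<open>P\<close> and back along \<open>Q\<close>.\<close>

inductive word_move :: "'a list \<times> 'a list \<times> 'a list \<Rightarrow> 'a list \<times> 'a list \<times> 'a list \<Rightarrow> bool" where
  wm_refl: "word_move w w"
| wm_PQ: "word_move w (m # M, q @ [z], r) \<Longrightarrow> word_move w (M @ [z], m # q, r)"
| wm_QP: "word_move w (M @ [z], m # q, r) \<Longrightarrow> word_move w (m # M, q @ [z], r)"
| wm_PR: "word_move w (m # M, q, r @ [z]) \<Longrightarrow> word_move w (M @ [z], q, m # r)"
| wm_RP: "word_move w (M @ [z], q, m # r) \<Longrightarrow> word_move w (m # M, q, r @ [z])"

lemma word_move_trans: "word_move u v \<Longrightarrow> word_move v w \<Longrightarrow> word_move u w"
  by (rotate_tac, induction rule: word_move.induct) (auto intro: word_move.intros)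

text \<open>The rules undo the rotation along \<open>P\<close> and \<open>Q\<close>, undo the one
  along \<open>P\<close> and \<open>R\<close>, and then perform both in the same order. This
  commutator of rotations is a product of two disjoint transpositions.\<close>

lemma double_swap_last: "word_move (p @ [u, s], v # q, w # r) (p @ [s, u], w # q, v # r)"
proof -
  note wm_refl[of "(p @ [u, s], v # q, w # r)"]
  from wm_QP[of _ "p @ [u]", simplified, OF this] have "word_move (p @ [u, s], v # q, w # r) (v # p @ [u], q @ [s], w # r)" .
  from wm_RP[of _ "v # p", simplified, OF this] have "word_move (p @ [u, s], v # q, w # r) (w # v # p, q @ [s], r @ [u])" .
  from wm_PQ[OF this] have "word_move (p @ [u, s], v # q, w # r) (v # p @ [s], w # q, r @ [u])" by simp
  from wm_PR[OF this] show ?thesis by simp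
qed

text \<open>The commutator in which both rotations are first performed and then undone. It acts at
  the opposite ends of the words.\<close>

lemma double_swap_first: "word_move (a # b # p, q @ [u], r @ [w]) (b # a # p, q @ [w], r @ [u])"
proof -
  note wm_refl[of "(a # b # p, q @ [u], r @ [w])"]
  from wm_PQ[OF this] have "word_move (a # b # p, q @ [u], r @ [w]) (b # p @ [u], a # q, r @ [w])" by simp
  from wm_PR[OF this] have "word_move (a # b # p, q @ [u], r @ [w]) ((p @ [u]) @ [w], a # q, b # r)" by simp
  from wm_QP[OF this] have "word_move (a # b # p, q @ [u], r @ [w]) ((a # p) @ [u], q @ [w], b # r)" by simp
  from wm_RP[OF this] show ?thesis .
qed

lemma word_move_swap_last: "word_move x (p @ [u, s], v # q, w # r) \<Longrightarrow> word_move x (p @ [s, u], w # q, v # r)"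
  by (rule word_move_trans[OF _ double_swap_last])

lemma word_move_swap_first: "word_move x (a # b # p, q @ [u], r @ [w]) \<Longrightarrow> word_move x (b # a # p, q @ [w], r @ [u])"
  by (rule word_move_trans[OF _ double_swap_first])

text \<open>With only two colours, a 3-cycle of positions generates all their rearrangements.\<close>

lemma two_colour_3cycle:
  fixes F :: "bool \<Rightarrow> bool \<Rightarrow> bool \<Rightarrow> 'a list \<times> 'a list \<times> 'a list"
  assumes "\<And>a b c. word_move (F a b c) (F b c a)"
  shows "word_move (F a b c) (F b a c)"
proof -
  have "word_move (F a b c) (F c a b)" using word_move_trans[OF assms assms] .
  \<comment> \<open>Of three Booleans two agree, so swapping the first two equals no rotation, one,
    or two.\<close>
  then show ?thesis using assms[of a b c] wm_refl[of "F a b c"]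
    by (cases a; cases b; cases c) auto
qed

section \<open>Colour swaps in theta graphs, by the lengths of the paths\<close>

lemma swap_lengths_0: "word_move ([s :: bool], q @ [u], r @ [w]) ([u], q @ [s], r @ [w])"
proof (rule two_colour_3cycle[of "\<lambda>s u w. ([s], q @ [u], r @ [w])"])
  fix s u w :: bool
  let ?x = "([s], q @ [u], r @ [w])"
  \<comment> \<open>The commutator of \<open>double_swap_first\<close> degenerates to a 3-cycle when
    \<open>P\<close> is empty, since \<open>M\<close> then has a single letter.\<close>
  note wm_refl[of ?x]
  from wm_PQ[OF this] have "word_move ?x ([u], s # q, r @ [w])" by simp
  from wm_PR[OF this] have "word_move ?x ([] @ [w], s # q, u # r)" by simp
  from wm_QP[OF this] have "word_move ?x ([] @ [s], q @ [w], u # r)" by simp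
  from wm_RP[OF this] show "word_move ?x ([u], q @ [w], r @ [s])" by simp
qed

text \<open>Here \<open>P\<close> and \<open>Q\<close> close up to a square, and a single turn
  around it is already a 3-cycle of \<open>p\<close>, \<open>s\<close>, \<open>q\<close>.\<close>

lemma swap_lengths_1_1: "word_move ([p :: bool, s], [q], r) ([s, p], [q], r)"
proof (rule two_colour_3cycle[of "\<lambda>p s q. ([p, s], [q], r)"])
  fix p s q :: bool
  show "word_move ([p, s], [q], r) ([s, q], [p], r)"
    using wm_PQ[of _ p "[s]" "[]" q r] wm_refl by fastforce
qed

text \<open>The two double swaps alternate, each being applied twice. Their transpositions on
  \<open>Q\<close> and \<open>R\<close> cancel, while those on \<open>M\<close> overlap in the
  middle letter and leave a 3-cycle of \<open>p1\<close>, \<open>p2\<close>,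
  \<open>s\<close>.\<close>

lemma swap_lengths_2: "word_move ([p1 :: bool, p2, s], q1 # q @ [q9], r1 # r @ [r9]) ([p2, p1, s], q1 # q @ [q9], r1 # r @ [r9])"
proof (rule two_colour_3cycle[of "\<lambda>p1 p2 s. ([p1, p2, s], q1 # q @ [q9], r1 # r @ [r9])"])
  fix p1 p2 s :: bool
  let ?x = "([p1, p2, s], q1 # q @ [q9], r1 # r @ [r9])"
  note wm_refl[of ?x]
  from word_move_swap_last[of _ "[p1]", simplified, OF this] have "word_move ?x ([p1, s, p2], (r1 # q) @ [q9], (q1 # r) @ [r9])" by simp
  from word_move_swap_first[OF this] have "word_move ?x ([s, p1, p2], r1 # q @ [r9], q1 # r @ [q9])" by simp
  from word_move_swap_last[of _ "[s]", simplified, OF this] have "word_move ?x ([s, p2, p1], (q1 # q) @ [r9], (r1 # r) @ [q9])" by simp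
  from word_move_swap_first[OF this] show "word_move ?x ([p2, s, p1], q1 # q @ [q9], r1 # r @ [r9])" by simp
qed

text \<open>\<open>A\<close> and \<open>B\<close> are double swaps conjugated by rotations along
  \<open>P\<close> and \<open>Q\<close>. \<open>A\<close> transposes the places of \<open>p\<close>,
  \<open>r9\<close> and of \<open>q1\<close>, \<open>q2\<close>; \<open>B\<close> those of
  \<open>p\<close>, \<open>r1\<close> and of \<open>s\<close>, \<open>q9\<close>. Only the place of
  \<open>p\<close> is common, so the sequence \<open>B\<close>, \<open>A\<close>, \<open>B\<close>,
  \<open>A\<close> is a 3-cycle.\<close>

lemma swap_lengths_1_3:
  "word_move ([p :: bool, s], q1 # q2 # q @ [q9], r1 # r @ [r9]) ([r1, s], q1 # q2 # q @ [q9], p # r @ [r9])"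
proof (rule two_colour_3cycle[of "\<lambda>p r1 r9. ([p, s], q1 # q2 # q @ [q9], r1 # r @ [r9])"])
  have A: "word_move ([p, s], q1 # q2 # q @ [q9], r1 # r @ [r9]) ([r9, s], q2 # q1 # q @ [q9], r1 # r @ [p])"
    for p s q1 q2 q q9 r1 r r9
  proof -
    let ?x = "([p, s], q1 # q2 # q @ [q9], r1 # r @ [r9])"
    note wm_refl[of ?x]
    from wm_QP[of _ "[p]", simplified, OF this] have "word_move ?x ([q1] @ [p], q2 # q @ [q9, s], r1 # r @ [r9])" by simp
    from wm_QP[OF this] have "word_move ?x ([q2, q1], (q @ [q9, s]) @ [p], (r1 # r) @ [r9])" by simp
    from word_move_swap_first[OF this] have "word_move ?x ([q1, q2], (q @ [q9, s]) @ [r9], r1 # r @ [p])" by simp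
    from wm_PQ[OF this] have "word_move ?x ([q2, r9], (q1 # q @ [q9]) @ [s], r1 # r @ [p])" by simp
    from wm_PQ[OF this] show ?thesis by simp
  qed
  have B: "word_move ([p, s], q @ [q9], r1 # r) ([r1, q9], q @ [s], p # r)" for p s q q9 r1 r
  proof -
    let ?x = "([p, s], q @ [q9], r1 # r)"
    note wm_refl[of ?x]
    from wm_PQ[OF this] have "word_move ?x ([] @ [s, q9], p # q, r1 # r)" by simp
    from word_move_swap_last[OF this] have "word_move ?x ([q9] @ [s], r1 # q, p # r)" by simp
    from wm_QP[OF this] show ?thesis by simp
  qed
  fix p r1 r9 :: bool
  let ?x = "([p, s], q1 # q2 # q @ [q9], r1 # r @ [r9])"
  have "word_move ?x ([r1, q9], q1 # q2 # q @ [s], p # r @ [r9])"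
    using B[of p s "q1 # q2 # q"] by simp
  from word_move_trans[OF this A] have "word_move ?x ([r9, q9], (q2 # q1 # q) @ [s], p # r @ [r1])" by simp
  from word_move_trans[OF this B] have "word_move ?x ([p, s], q2 # q1 # q @ [q9], r9 # r @ [r1])" by simp
  from word_move_trans[OF this A] show "word_move ?x ([r1, s], q1 # q2 # q @ [q9], r9 # r @ [p])" .
qed

text \<open>\<open>X\<close> is a double swap conjugated by two rotations and transposes the places
  of \<open>p2\<close>, \<open>r1\<close> and of \<open>q8\<close>, \<open>q9\<close>;
  \<open>Y\<close> transposes those of \<open>p9\<close>, \<open>s\<close> and of \<open>q1\<close>,
  \<open>r1\<close>. Only the place of \<open>r1\<close> is common, so \<open>Y\<close>,
  \<open>X\<close>, \<open>Y\<close>, \<open>X\<close> is a 3-cycle.\<close>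

lemma swap_lengths_3_3:
  "word_move (p1 # p2 # p @ [p9, s], q1 # q @ [q8, q9], (r1 :: bool) # r)
             (p1 # p2 # p @ [p9, s], r1 # q @ [q8, q9], q1 # r)"
proof (rule two_colour_3cycle[of "\<lambda>r1 q1 p2. (p1 # p2 # p @ [p9, s], q1 # q @ [q8, q9], r1 # r)"])
  have X: "word_move (p1 # p2 # p @ [p9, s], q1 # q @ [q8, q9], r1 # r)
             (p1 # r1 # p @ [p9, s], q1 # q @ [q9, q8], p2 # r)" for p9 s q1 r1 p2 q8 q9
  proof -
    let ?x = "(p1 # p2 # p @ [p9, s], q1 # q @ [q8, q9], r1 # r)"
    have "word_move ?x (p1 # p2 # p @ [p9, s], (q1 # q @ [q8]) @ [q9], r1 # r)" by (simp add: wm_refl)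
    from wm_PQ[OF this] have "word_move ?x (p2 # p @ [p9, s, q9], (p1 # q1 # q) @ [q8], r1 # r)" by simp
    from wm_PQ[OF this] have "word_move ?x ((p @ [p9, s]) @ [q9, q8], p2 # p1 # q1 # q, r1 # r)" by simp
    from word_move_swap_last[OF this] have "word_move ?x ((p @ [p9, s, q8]) @ [q9], r1 # p1 # q1 # q, p2 # r)" by simp
    from wm_QP[OF this] have "word_move ?x ((r1 # p @ [p9, s]) @ [q8], p1 # q1 # q @ [q9], p2 # r)" by simp
    from wm_QP[OF this] show ?thesis by simp
  qed
  have Y: "word_move (p1 # p2 # p @ [p9, s], q1 # q @ [q8, q9], r1 # r)
             (p1 # p2 # p @ [s, p9], r1 # q @ [q8, q9], q1 # r)" for p9 s q1 r1 p2 q8 q9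
    using double_swap_last[of "p1 # p2 # p"] by simp
  fix r1 q1 p2 :: bool
  show "word_move (p1 # p2 # p @ [p9, s], q1 # q @ [q8, q9], r1 # r)
     (p1 # r1 # p @ [p9, s], p2 # q @ [q8, q9], q1 # r)"
    using word_move_trans[OF word_move_trans[OF word_move_trans[OF Y X] Y] X] .
qed

text \<open>\<open>T1\<close> and \<open>T2\<close> swap \<open>p\<close>, \<open>s\<close> together
  with one pair of letters of \<open>Q\<close> and \<open>R\<close>, which does the job if that pair
  has equal colours. If \<open>Q\<close> has a single colour, at most one turn along
  \<open>P\<close> and \<open>Q\<close> in a suitable direction suffices.\<close>

lemma swap_lengths_1_2_2: "word_move ([p :: bool, s], [q1, q2], [r1, r2]) ([s, p], [q1, q2], [r1, r2])"
proof -
  have T2: "word_move ([p, s], [q1, q2], [r1, r2]) ([s, p], [r1, q2], [q1, r2])" for p s q1 q2 r1 r2 :: bool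
    using double_swap_last[of "[]" p s q1 "[q2]" r1 "[r2]"] by simp
  have T1: "word_move ([p, s], [q1, q2], [r1, r2]) ([s, p], [q1, r2], [r1, q2])" for p s q1 q2 r1 r2 :: bool
    using double_swap_first[of p s "[]" "[q1]" q2 "[r1]" r2] by simp
  have a: "word_move ([p, s], [q1, q2], r) ([s, q2], [p, q1], r)" for p s q1 q2 r
    using wm_PQ[OF wm_refl, of p "[s]" "[q1]" q2 r] by simp
  have a': "word_move ([p, s], [q1, q2], r) ([q1, p], [q2, s], r)" for p s q1 q2 r
    using wm_QP[of "([p, s], [q1, q2], r)" "[p]" s q1 "[q2]" r] wm_refl[of "([p, s], [q1, q2], r)"] by simp
  have eq: "word_move ([p, s], [q, q], r) ([s, p], [q, q], r)" for p s q :: bool and r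
    using a[of p s q q r] a'[of p s q q r] wm_refl[of "([p, s], [q, q], r)"]
    by (cases p; cases s; cases q) simp_all
  consider "q1 = r1" | "q2 = r2" | "q1 = q2" | "q1 \<noteq> r1" "q2 \<noteq> r2" "q1 \<noteq> q2" by blast
  then show ?thesis
  proof cases
    case 4
    \<comment> \<open>\<open>T2\<close> makes \<open>Q\<close> monochromatic, \<open>eq\<close>
      swaps \<open>p\<close> and \<open>s\<close> back, and a second \<open>T2\<close> restores
      \<open>Q\<close> and \<open>R\<close> with a third swap of \<open>p\<close> and
      \<open>s\<close>.\<close>
    then have "r1 = q2" "r2 = q1" by auto
    then show ?thesis
      using word_move_trans[OF word_move_trans[OF T2[of p s q1 q2 q2 q1] eq[of s p q2]] T2[of p s q2 q2 q1 q1]]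
      by simp
  qed (use T1[of p s q1 q2 r1 r2] T2[of p s q1 q2 r1 r2] eq in auto)
qed

section \<open>Theta subgraphs: from words to walks of the hole\<close>

definition theta_graph :: "('v \<Rightarrow> 'v \<Rightarrow> bool) \<Rightarrow> 'v \<Rightarrow> 'v \<Rightarrow> 'v list \<Rightarrow> 'v list \<Rightarrow> 'v list \<Rightarrow> bool" where
  "theta_graph E x y P Q R \<longleftrightarrow> symp E \<and> distinct (x # y # P @ Q @ R) \<and>
     successively E (x # P @ [y]) \<and> successively E (x # Q @ [y]) \<and> successively E (x # R @ [y]) \<and>
     (P \<noteq> [] \<or> Q \<noteq> []) \<and> (P \<noteq> [] \<or> R \<noteq> []) \<and> (Q \<noteq> [] \<or> R \<noteq> [])"

lemma theta_swap12: "theta_graph E x y P Q R \<Longrightarrow> theta_graph E x y Q P R"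
  by (auto simp: theta_graph_def)

lemma theta_swap23: "theta_graph E x y P Q R \<Longrightarrow> theta_graph E x y P R Q"
  by (auto simp: theta_graph_def)

text \<open>Two applications of \<open>slide_path\<close>: out along \<open>P\<close>, back along
  \<open>rev Q\<close>. The letter \<open>m\<close> waits on \<open>x\<close> and enters
  \<open>Q\<close> at the front, pushing \<open>z\<close> onto \<open>y\<close>; the form
  \<open>m # map f Q = q @ [z]\<close> also covers an empty \<open>Q\<close>, where
  \<open>z = m\<close>.\<close>

lemma theta_detour:
  assumes "theta_graph E x y P Q R" "map f (P @ [y]) = m # M" "m # map f Q = q @ [z]"
  shows "\<exists>g. slide E x f x g \<and> map g (P @ [y]) = M @ [z] \<and> map g Q = q \<and>
             (\<forall>v. v \<notin> set (y # P @ Q) \<longrightarrow> g v = f v)"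
proof -
  have d: "distinct (x # P @ [y])" "distinct (y # rev Q @ [x])" "successively E (x # P @ [y])"
    and disj: "set Q \<inter> set (x # P @ [y]) = {}" "x \<notin> set P" "x \<noteq> y" "y \<notin> set P" "y \<notin> set Q" "set P \<inter> set Q = {}"
    using assms(1) by (auto simp: theta_graph_def)
  have "symp E" "successively E (x # Q @ [y])" using assms(1) by (auto simp only: theta_graph_def)
  then have "successively E (rev (x # Q @ [y]))"
    unfolding successively_rev by (elim successively_mono) (auto dest: sympD)
  then have s: "successively E (y # rev Q @ [x])" by simp
  obtain g where g: "slide E x f y g" "map g (x # P @ [y]) = map f (P @ [y]) @ [f x]"
      "\<And>v. v \<notin> set (x # P @ [y]) \<Longrightarrow> g v = f v"
    using slide_path[OF d(3,1), of f] by auto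
  have gQ: "map g Q = map f Q" using disj(1) by (intro map_cong refl g(3)) blast
  have gx: "g x = m" "map g P = M" "g y = f x" using g(2) assms(2) by auto
  obtain k where k: "slide E y g x k" "map k (y # rev Q @ [x]) = map g (rev Q @ [x]) @ [g y]"
      "\<And>v. v \<notin> set (y # rev Q @ [x]) \<Longrightarrow> k v = g v"
    using slide_path[OF s d(2), of g] by auto
  have "rev (map k (y # rev Q)) = rev (map g (rev Q @ [x]))" using k(2) by simp
  then have "map k Q @ [k y] = m # map f Q" using gx gQ by (simp add: rev_map[symmetric])
  then have kQ: "map k Q = q" "k y = z" using assms(3) by auto
  have "map k P = map g P"
  proof (intro map_cong refl k(3))
    fix v assume "v \<in> set P"
    then show "v \<notin> set (y # rev Q @ [x])" using disj by auto
  qed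
  then have "map k (P @ [y]) = M @ [z]" using gx kQ by simp
  moreover have "k x = f x" using k(2) gx by simp
  then have "k v = f v" if "v \<notin> set (y # P @ Q)" for v
    using k(3)[of v] g(3)[of v] that by (cases "v = x") auto
  ultimately show ?thesis using kQ slide_trans[OF g(1) k(1)] by blast
qed

text \<open>Each of the four detour rules is \<open>theta_detour\<close> with two of the three paths
  in the roles of \<open>P\<close> and \<open>Q\<close>; the third path is untouched.\<close>

lemma word_move_sound:
  assumes "word_move w w'" "theta_graph E x y P Q R" "w = (map f (P @ [y]), map f Q, map f R)"
  shows "\<exists>g. slide E x f x g \<and> w' = (map g (P @ [y]), map g Q, map g R) \<and>
             (\<forall>v. v \<notin> set (y # P @ Q @ R) \<longrightarrow> g v = f v)"
  using assms(1,3)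
proof (induction rule: word_move.induct)
  case (wm_refl w)
  then show ?case by (auto intro: slide_refl)
next
  have dis: "distinct (x # y # P @ Q @ R)" using assms(2) by (simp add: theta_graph_def)
  have step: "\<exists>g. slide E x f x g \<and> (M', q', r') = (map g (P @ [y]), map g Q, map g R) \<and>
             (\<forall>v. v \<notin> set (y # P @ Q @ R) \<longrightarrow> g v = f v)"
    if g: "slide E x f x g" "\<forall>v. v \<notin> set (y # P @ Q @ R) \<longrightarrow> g v = f v"
    and k: "slide E x g x k" "(M', q', r') = (map k (P @ [y]), map k Q, map k R)"
      "\<forall>v. v \<notin> set (y # P @ Q @ R) \<longrightarrow> k v = g v" for g k M' q' r'
    using that slide_trans[OF g(1) k(1)] by (intro exI[of _ k]) simp
  {
    case (wm_PQ w m M q z r)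
    from this(2)[OF this(3)] obtain g where g: "slide E x f x g" "(m # M, q @ [z], r) = (map g (P @ [y]), map g Q, map g R)"
      "\<forall>v. v \<notin> set (y # P @ Q @ R) \<longrightarrow> g v = f v" by (elim exE conjE) (rule that)
    obtain k where k: "slide E x g x k" "map k (P @ [y]) = M @ [z]" "map k Q = m # q"
      "\<forall>v. v \<notin> set (y # P @ Q) \<longrightarrow> k v = g v"
      using theta_detour[OF assms(2), of g m M "m # q" z] g(2) by auto
    moreover have "map k R = map g R" using k(4) dis by auto
    ultimately show ?case using g by (intro step[OF g(1,3) k(1)]) auto
  next
    case (wm_QP w M z m q r)
    from this(2)[OF this(3)] obtain g where g: "slide E x f x g" "(M @ [z], m # q, r) = (map g (P @ [y]), map g Q, map g R)"
      "\<forall>v. v \<notin> set (y # P @ Q @ R) \<longrightarrow> g v = f v" by (elim exE conjE) (rule that)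
    have gP: "map g P = M" "g y = z" "map g Q = m # q" using g(2) by auto
    \<comment> \<open>Now \<open>Q\<close> is the way out and \<open>P\<close> the way back:
      \<open>m\<close> enters \<open>P\<close> at the front, and the last letter \<open>e\<close> is
      left on \<open>y\<close>.\<close>
    obtain N e where N: "m # M = N @ [e]" by (metis list.discI rev_exhaust)
    obtain k where k: "slide E x g x k" "map k (Q @ [y]) = (q @ [z]) @ [e]" "map k P = N"
      "\<forall>v. v \<notin> set (y # Q @ P) \<longrightarrow> k v = g v"
      using theta_detour[OF theta_swap12[OF assms(2)], of g m "q @ [z]" N e] gP N by auto
    moreover have "map k R = map g R" using k(4) dis by auto
    moreover have "map k (P @ [y]) = m # M" using k(2,3) N by simp
    ultimately show ?case using g by (intro step[OF g(1,3) k(1)]) auto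
  next
    case (wm_PR w m M q r z)
    from this(2)[OF this(3)] obtain g where g: "slide E x f x g" "(m # M, q, r @ [z]) = (map g (P @ [y]), map g Q, map g R)"
      "\<forall>v. v \<notin> set (y # P @ Q @ R) \<longrightarrow> g v = f v" by (elim exE conjE) (rule that)
    obtain k where k: "slide E x g x k" "map k (P @ [y]) = M @ [z]" "map k R = m # r"
      "\<forall>v. v \<notin> set (y # P @ R) \<longrightarrow> k v = g v"
      using theta_detour[OF theta_swap23[OF assms(2)], of g m M "m # r" z] g(2) by auto
    moreover have "map k Q = map g Q" using k(4) dis by auto
    ultimately show ?case using g by (intro step[OF g(1,3) k(1)]) auto
  next
    case (wm_RP w M z q m r)
    from this(2)[OF this(3)] obtain g where g: "slide E x f x g" "(M @ [z], q, m # r) = (map g (P @ [y]), map g Q, map g R)"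
      "\<forall>v. v \<notin> set (y # P @ Q @ R) \<longrightarrow> g v = f v" by (elim exE conjE) (rule that)
    have gP: "map g P = M" "g y = z" "map g R = m # r" using g(2) by auto
    obtain N e where N: "m # M = N @ [e]" by (metis list.discI rev_exhaust)
    obtain k where k: "slide E x g x k" "map k (R @ [y]) = (r @ [z]) @ [e]" "map k P = N"
      "\<forall>v. v \<notin> set (y # R @ P) \<longrightarrow> k v = g v"
      using theta_detour[OF theta_swap12[OF theta_swap23[OF assms(2)]], of g m "r @ [z]" N e] gP N by auto
    moreover have "map k Q = map g Q" using k(4) dis by auto
    moreover have "map k (P @ [y]) = m # M" using k(2,3) N by simp
    ultimately show ?case using g by (intro step[OF g(1,3) k(1)]) auto
  }
qed

lemma theta_exchangeable:
  assumes "theta_graph E x y P Q R" "i \<in> set (y # P @ Q @ R)" "j \<in> set (y # P @ Q @ R)"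
    and "\<And>f :: 'v \<Rightarrow> bool. word_move (map f (P @ [y]), map f Q, map f R)
           (map (f \<circ> transpose i j) (P @ [y]), map (f \<circ> transpose i j) Q, map (f \<circ> transpose i j) R)"
  shows "exchangeable E x i j"
  unfolding exchangeable_def
proof
  fix f :: "'v \<Rightarrow> bool"
  obtain g where g: "slide E x f x g"
     "map (f \<circ> transpose i j) (P @ [y]) = map g (P @ [y])" "map (f \<circ> transpose i j) Q = map g Q"
     "map (f \<circ> transpose i j) R = map g R"
     "\<And>v. v \<notin> set (y # P @ Q @ R) \<Longrightarrow> g v = f v"
    using word_move_sound[OF assms(4,1) refl, of f] by auto
  have "g v = (f \<circ> transpose i j) v" for v
  proof (cases "v \<in> set (y # P @ Q @ R)")
    case True
    then show ?thesis using g(2-4) by (auto simp: map_eq_conv simp del: comp_apply)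
  next
    case False
    then show ?thesis using g(5)[OF False] assms(2,3) by (auto simp: transpose_def)
  qed
  then have "g = f \<circ> transpose i j" by blast
  then show "slide E x f x (f \<circ> transpose i j)" using g(1) by simp
qed

text \<open>The data that \<open>freely_permutable_triple\<close> asks for. Being monotone in
  \<open>W\<close>, a seed found in a subgraph serves the whole graph.\<close>

definition seed :: "('v \<Rightarrow> 'v \<Rightarrow> bool) \<Rightarrow> 'v set \<Rightarrow> bool" where
  "seed E W \<longleftrightarrow> (\<exists>h\<in>W. \<exists>i\<in>W. \<exists>j\<in>W. distinct [h, i, j] \<and> exchangeable E h i j \<and> E h i \<and> (E h j \<or> E i j))"

lemma seedI:
  "distinct [h, i, j] \<Longrightarrow> {h, i, j} \<subseteq> W \<Longrightarrow> exchangeable E h i j \<Longrightarrow> E h i \<Longrightarrow> E h j \<or> E i j \<Longrightarrow> seed E W"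
  unfolding seed_def by blast

lemma map_comp_transpose:
  "i \<notin> set L \<Longrightarrow> j \<notin> set L \<Longrightarrow> map (f \<circ> transpose i j) L = map f L"
  by (auto simp: transpose_def)

lemma length_ge_2E:
  assumes "length L \<ge> 2"
  obtains a M b where "L = a # M @ [b]"
proof -
  obtain a L' where L': "L = a # L'" "length L' \<ge> 1" using assms by (cases L) auto
  then obtain M b where "L' = M @ [b]" by (cases L' rule: rev_cases) auto
  then show thesis using that L' by blast
qed

lemma length_ge_3E:
  assumes "length L \<ge> 3"
  obtains a b M c where "L = a # b # M @ [c]"
proof -
  obtain a L' where L': "L = a # L'" "length L' \<ge> 2" using assms by (cases L) auto
  then show thesis using length_ge_2E[OF L'(2)] that by metis
qed

section \<open>Seeds in theta graphs\<close>

lemma theta_seed_lengths_0: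
  assumes "theta_graph E x y [] Q R"
  shows "seed E (set (x # y # Q @ R))"
proof -
  from assms have "Q \<noteq> []" "R \<noteq> []" by (auto simp: theta_graph_def)
  then obtain Q0 u R0 w where QR: "Q = Q0 @ [u]" "R = R0 @ [w]"
    by (cases Q rule: rev_cases; cases R rule: rev_cases) auto
  have d: "distinct (x # y # Q @ R)" and e: "E x y" "E y u"
    using assms QR by (auto simp: theta_graph_def successively_append_iff successively_Cons dest: sympD split: if_splits)
  have "exchangeable E x y u"
  proof (rule theta_exchangeable[OF assms])
    fix f :: "'a \<Rightarrow> bool"
    show "word_move (map f ([] @ [y]), map f Q, map f R)
      (map (f \<circ> transpose y u) ([] @ [y]), map (f \<circ> transpose y u) Q, map (f \<circ> transpose y u) R)"
      using d swap_lengths_0[of "f y" "map f Q0" "f u" "map f R0" "f w"]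
      by (auto simp: QR map_comp_transpose transpose_def del: map_map)
  qed (auto simp: QR)
  then show ?thesis using d e QR by (intro seedI[of x y u]) auto
qed

lemma theta_seed_lengths_1_1:
  assumes "theta_graph E x y [p] [q] R"
  shows "seed E (set (x # y # [p] @ [q] @ R))"
proof -
  have d: "distinct (x # y # [p] @ [q] @ R)" and e: "E x p" "E p y"
    using assms by (auto simp: theta_graph_def)
  have "exchangeable E x p y"
  proof (rule theta_exchangeable[OF assms])
    fix f :: "'a \<Rightarrow> bool"
    show "word_move (map f ([p] @ [y]), map f [q], map f R)
      (map (f \<circ> transpose p y) ([p] @ [y]), map (f \<circ> transpose p y) [q], map (f \<circ> transpose p y) R)"
      using d swap_lengths_1_1[of "f p" "f y" "f q" "map f R"] by (auto simp: map_comp_transpose transpose_def del: map_map)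
  qed auto
  then show ?thesis using d e by (intro seedI[of x p y]) auto
qed

lemma theta_seed_lengths_1_3:
  assumes th: "theta_graph E x y [p] Q R" and "length Q \<ge> 3" "length R \<ge> 2"
  shows "seed E (set (x # y # [p] @ Q @ R))"
proof -
  obtain q1 q2 Q0 q9 where Q: "Q = q1 # q2 # Q0 @ [q9]"
    using assms(2) by (rule length_ge_3E)
  obtain r1 R0 r9 where R: "R = r1 # R0 @ [r9]"
    using assms(3) by (rule length_ge_2E)
  have d: "distinct (x # y # [p] @ Q @ R)" and e: "E x p" "E x r1"
    using th by (auto simp: theta_graph_def R)
  have "exchangeable E x p r1"
  proof (rule theta_exchangeable[OF th])
    fix f :: "'a \<Rightarrow> bool"
    show "word_move (map f ([p] @ [y]), map f Q, map f R)
      (map (f \<circ> transpose p r1) ([p] @ [y]), map (f \<circ> transpose p r1) Q, map (f \<circ> transpose p r1) R)"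
      using d swap_lengths_1_3[of "f p" "f y" "f q1" "f q2" "map f Q0" "f q9" "f r1" "map f R0" "f r9"]
      by (auto simp: Q R map_comp_transpose transpose_def del: map_map)
  qed (auto simp: R)
  then show ?thesis using d e by (intro seedI[of x p r1]) (auto simp: R)
qed

lemma theta_seed_lengths_2:
  assumes th: "theta_graph E x y [p1, p2] Q R" and "length Q \<ge> 2" "length R \<ge> 2"
  shows "seed E (set (x # y # [p1, p2] @ Q @ R))"
proof -
  obtain q1 Q0 q9 where Q: "Q = q1 # Q0 @ [q9]"
    using assms(2) by (rule length_ge_2E)
  obtain r1 R0 r9 where R: "R = r1 # R0 @ [r9]"
    using assms(3) by (rule length_ge_2E)
  have d: "distinct (x # y # [p1, p2] @ Q @ R)" and e: "E x p1" "E p1 p2"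
    using th by (auto simp: theta_graph_def R)
  have "exchangeable E x p1 p2"
  proof (rule theta_exchangeable[OF th])
    fix f :: "'a \<Rightarrow> bool"
    show "word_move (map f ([p1, p2] @ [y]), map f Q, map f R)
      (map (f \<circ> transpose p1 p2) ([p1, p2] @ [y]), map (f \<circ> transpose p1 p2) Q, map (f \<circ> transpose p1 p2) R)"
      using d swap_lengths_2[of "f p1" "f p2" "f y" "f q1" "map f Q0" "f q9" "f r1" "map f R0" "f r9"]
      by (auto simp: Q R map_comp_transpose transpose_def del: map_map)
  qed auto
  then show ?thesis using d e by (intro seedI[of x p1 p2]) auto
qed

lemma theta_seed_lengths_3_3:
  assumes th: "theta_graph E x y P Q R" and "length P \<ge> 3" "length Q \<ge> 3" "R \<noteq> []"
  shows "seed E (set (x # y # P @ Q @ R))"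
proof -
  obtain p1 p2 P0 p9 where P: "P = p1 # p2 # P0 @ [p9]"
    using assms(2) by (rule length_ge_3E)
  obtain q1 Q' where "Q = q1 # Q'" "length Q' \<ge> 2" using assms(3) by (cases Q) auto
  moreover obtain Q'' q9 where "Q' = Q'' @ [q9]" "length Q'' \<ge> 1"
    using calculation by (cases Q' rule: rev_cases) auto
  moreover obtain Q0 q8 where "Q'' = Q0 @ [q8]"
    using calculation by (cases Q'' rule: rev_cases) auto
  ultimately have Q: "Q = q1 # Q0 @ [q8, q9]" by simp
  obtain r1 R0 where R: "R = r1 # R0" using assms(4) by (cases R) auto
  have d: "distinct (x # y # P @ Q @ R)" and e: "E x q1" "E x r1"
    using th by (auto simp: theta_graph_def Q R)
  have "exchangeable E x q1 r1"
  proof (rule theta_exchangeable[OF th])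
    fix f :: "'a \<Rightarrow> bool"
    show "word_move (map f (P @ [y]), map f Q, map f R)
      (map (f \<circ> transpose q1 r1) (P @ [y]), map (f \<circ> transpose q1 r1) Q, map (f \<circ> transpose q1 r1) R)"
      using d swap_lengths_3_3[of "f p1" "f p2" "map f P0" "f p9" "f y" "f q1" "map f Q0" "f q8" "f q9" "f r1" "map f R0"]
      by (auto simp: P Q R map_comp_transpose transpose_def del: map_map)
  qed (auto simp: Q R)
  then show ?thesis using d e by (intro seedI[of x q1 r1]) (auto simp: Q R)
qed

lemma theta_seed_lengths_1_2_2:
  assumes th: "theta_graph E x y [p] [q1, q2] [r1, r2]"
  shows "seed E (set (x # y # [p] @ [q1, q2] @ [r1, r2]))"
proof -
  have d: "distinct (x # y # [p] @ [q1, q2] @ [r1, r2])" and e: "E x p" "E p y"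
    using th by (auto simp: theta_graph_def)
  have "exchangeable E x p y"
  proof (rule theta_exchangeable[OF th])
    fix f :: "'a \<Rightarrow> bool"
    show "word_move (map f ([p] @ [y]), map f [q1, q2], map f [r1, r2])
      (map (f \<circ> transpose p y) ([p] @ [y]), map (f \<circ> transpose p y) [q1, q2], map (f \<circ> transpose p y) [r1, r2])"
      using d swap_lengths_1_2_2[of "f p" "f y" "f q1" "f q2" "f r1" "f r2"] by (auto simp: transpose_def)
  qed auto
  then show ?thesis using d e by (intro seedI[of x p y]) auto
qed

lemma theta_seed_sorted:
  assumes th: "theta_graph E x y P Q R" and le: "length P \<le> length Q" "length Q \<le> length R"
  shows "seed E (set (x # y # P @ Q @ R))"
proof -
  have Q0: "Q \<noteq> []" using th le by (auto simp: theta_graph_def)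
  \<comment> \<open>As the lengths increase, these cases are exhaustive: if \<open>P\<close> has one
    inner vertex, \<open>Q\<close> has one, at least three, or exactly two, and the last case is
    split by the length of \<open>R\<close>.\<close>
  consider "P = []" | p q where "P = [p]" "Q = [q]" | p where "P = [p]" "length Q \<ge> 3"
    | p where "P = [p]" "length Q = 2" "length R \<ge> 3" | p q1 q2 r1 r2 where "P = [p]" "Q = [q1, q2]" "R = [r1, r2]"
    | p1 p2 where "P = [p1, p2]" | "length P \<ge> 3"
  proof -
    consider "length P = 0" | "length P = 1" | "length P = 2" | "length P \<ge> 3" by linarith
    then show ?thesis
    proof cases
      case 2
      then obtain p where p: "P = [p]" by (auto simp: length_Suc_conv)
      consider "length Q = 1" | "length Q \<ge> 3" | "length Q = 2" "length R \<ge> 3" | "length Q = 2" "length R = 2"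
        using le Q0 by (cases "length Q") (auto, linarith)
      then show ?thesis
        by cases (use p that in \<open>auto simp: length_Suc_conv numeral_2_eq_2\<close>)
    qed (use that in \<open>auto simp: length_Suc_conv numeral_2_eq_2\<close>)
  qed
  then show ?thesis
  proof cases
    case 1
    then show ?thesis using theta_seed_lengths_0[of E x y Q R] th by simp
  next
    case 2
    then show ?thesis using theta_seed_lengths_1_1 th by metis
  next
    case 3
    then show ?thesis using theta_seed_lengths_1_3[of E x y p Q R] th le by simp
  next
    case 4
    \<comment> \<open>\<open>theta_seed_lengths_1_3\<close> expects a path of length at least three
      in second place, so \<open>Q\<close> and \<open>R\<close> change roles.\<close>
    then have "seed E (set (x # y # [p] @ R @ Q))"
      using theta_seed_lengths_1_3[of E x y p R Q] theta_swap23[OF th] by simp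
    moreover have "set (x # y # [p] @ R @ Q) = set (x # y # P @ Q @ R)" using 4 by auto
    ultimately show ?thesis by simp
  next
    case 5
    then show ?thesis using theta_seed_lengths_1_2_2 th by metis
  next
    case 6
    then show ?thesis using theta_seed_lengths_2[of E x y p1 p2 Q R] th le by simp
  next
    case 7
    then show ?thesis using theta_seed_lengths_3_3[OF th] le by fastforce
  qed
qed

lemma theta_seed:
  assumes th: "theta_graph E x y P Q R"
  shows "seed E (set (x # y # P @ Q @ R))"
proof -
  have s: "seed E (set (x # y # A @ B @ C))"
    if "theta_graph E x y A B C" "length A \<le> length B" "length B \<le> length C" for A B C
    using theta_seed_sorted that by metis
  note th2 = theta_swap12[OF th] theta_swap23[OF th] theta_swap23[OF theta_swap12[OF th]]
    theta_swap12[OF theta_swap23[OF th]] theta_swap12[OF theta_swap23[OF theta_swap12[OF th]]]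
  have eqs: "set (x # y # Q @ P @ R) = set (x # y # P @ Q @ R)" "set (x # y # P @ R @ Q) = set (x # y # P @ Q @ R)"
    "set (x # y # Q @ R @ P) = set (x # y # P @ Q @ R)" "set (x # y # R @ P @ Q) = set (x # y # P @ Q @ R)"
    "set (x # y # R @ Q @ P) = set (x # y # P @ Q @ R)" by auto
  show ?thesis
    using s[OF th] s[OF th2(1)] s[OF th2(2)] s[OF th2(3)] s[OF th2(4)] s[OF th2(5)] unfolding eqs by linarith
qed

section \<open>Non-separable graphs\<close>

lemma induced_path:
  assumes "(x, y) \<in> (induced W E)\<^sup>*" "x \<in> W"
  shows "\<exists>xs. xs \<noteq> [] \<and> hd xs = x \<and> last xs = y \<and> distinct xs \<and> successively E xs \<and> set xs \<subseteq> W"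
  using assms(1)
proof (induction rule: rtrancl_induct)
  case base
  then show ?case using assms(2) by (intro exI[of _ "[x]"]) auto
next
  case (step y z)
  then obtain xs where xs: "xs \<noteq> []" "hd xs = x" "last xs = y" "distinct xs" "successively E xs" "set xs \<subseteq> W"
    by blast
  have z: "z \<in> W" "E y z" using step by (auto simp: induced_def)
  show ?case
  proof (cases "z \<in> set xs")
    case True
    \<comment> \<open>The path already visits \<open>z\<close>, so it is cut there instead of being
      extended.\<close>
    then obtain us vs where us: "xs = us @ z # vs" by (auto simp: in_set_conv_decomp)
    then have "successively E ((us @ [z]) @ vs)" using xs by simp
    then have "successively E (us @ [z])" unfolding successively_append_iff by blast
    moreover have "hd (us @ [z]) = x" using xs us by (cases us) auto
    ultimately show ?thesis using xs us by (intro exI[of _ "us @ [z]"]) auto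
  next
    case False
    then show ?thesis using xs z
      by (intro exI[of _ "xs @ [z]"]) (auto simp: successively_append_iff)
  qed
qed

lemma induced_first_step:
  assumes "(x, y) \<in> (induced W E)\<^sup>*" "x \<noteq> y"
  shows "\<exists>z\<in>W. E x z"
  using assms by (cases rule: converse_rtranclE) (auto simp: induced_def)

lemma non_separable_conn:
  assumes "non_separable V E" "v \<in> {1..V}" "x \<in> {1..V} - {v}" "y \<in> {1..V} - {v}"
  shows "(x, y) \<in> (induced ({1..V} - {v}) E)\<^sup>*"
  using assms unfolding non_separable_def connected_on_induced by blast

lemma exists_third:
  assumes "V \<ge> 3"
  shows "\<exists>z\<in>{1..V}. z \<noteq> a \<and> z \<noteq> (b :: nat)"
proof (rule ccontr)
  assume "\<not> ?thesis"
  then have "{1..V} \<subseteq> {a, b}" by blast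
  then have "card {1..V} \<le> card {a, b}" by (rule card_mono[rotated]) simp
  then show False using assms by (simp add: card_insert_if split: if_splits)
qed

text \<open>Deleting some \<open>a\<close> leaves \<open>x\<close> with a neighbour
  \<open>p\<close>; deleting \<open>p\<close> leaves it with a second one.\<close>

lemma non_separable_degree:
  assumes ns: "non_separable V E" and g: "simple_graph V E" and V: "V \<ge> 3" and x: "x \<in> {1..V}"
  shows "\<exists>p q. p \<noteq> q \<and> E x p \<and> E x q"
proof -
  obtain a where a: "a \<in> {1..V}" "a \<noteq> x" using exists_third[OF V] by blast
  obtain z where z: "z \<in> {1..V}" "z \<noteq> x" "z \<noteq> a" using exists_third[OF V] by blast
  have "x \<in> {1..V} - {a}" "z \<in> {1..V} - {a}" using a x z by blast+
  from induced_first_step[OF non_separable_conn[OF ns a(1) this] z(2)[symmetric]]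
  obtain p where p: "p \<in> {1..V} - {a}" "E x p" by blast
  have px: "p \<in> {1..V}" "p \<noteq> x" using p g by (auto simp: simple_graph_def)
  have "x \<in> {1..V} - {p}" "a \<in> {1..V} - {p}" using a x p px by blast+
  from induced_first_step[OF non_separable_conn[OF ns px(1) this] a(2)[symmetric]]
  obtain q where q: "q \<in> {1..V} - {p}" "E x q" by blast
  then show ?thesis using p by blast
qed

lemma simple_graphD:
  assumes "simple_graph V E"
  shows "symp E" "E i j \<Longrightarrow> i \<in> {1..V}" "E i j \<Longrightarrow> j \<in> {1..V}" "E i j \<Longrightarrow> i \<noteq> j"
  using assms unfolding simple_graph_def by (auto intro: sympI)

lemma non_separable_cycle:
  assumes ns: "non_separable V E" and g: "simple_graph V E" and "E x p" "E x q" "p \<noteq> q"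
  obtains m where "distinct (x # p # m @ [q])" "successively E (p # m @ [q])" "set (p # m @ [q]) \<subseteq> {1..V} - {x}"
proof -
  have "x \<in> {1..V}" "p \<in> {1..V} - {x}" "q \<in> {1..V} - {x}"
    using assms simple_graphD[OF g] by blast+
  from induced_path[OF non_separable_conn[OF ns this] this(2)]
  obtain xs where xs: "xs \<noteq> []" "hd xs = p" "last xs = q" "distinct xs" "successively E xs" "set xs \<subseteq> {1..V} - {x}" by blast
  then obtain ys where ys: "xs = p # ys" by (cases xs) auto
  then obtain m where "ys = m @ [q]" using xs assms(5) by (cases ys rule: rev_cases) auto
  then show thesis using xs ys that[of m] by auto
qed

text \<open>With \<open>x\<close> deleted, a path \<open>A\<close> joins \<open>p\<close> to
  \<open>q\<close>, and a path \<open>B\<close> from \<open>r\<close> meets \<open>A\<close> first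
  at \<open>y\<close>. The parts of \<open>A\<close> on either side of \<open>y\<close> and the
  initial part of \<open>B\<close> are the three paths; since \<open>p\<close>, \<open>q\<close>,
  \<open>r\<close> differ, at most one of them is empty.\<close>

lemma exists_theta:
  assumes ns: "non_separable V E" and g: "simple_graph V E"
    and nb: "E x p" "E x q" "E x r" "distinct [p, q, r]"
  shows "\<exists>y P Q R. theta_graph E x y P Q R \<and> set (x # y # P @ Q @ R) \<subseteq> {1..V}"
proof -
  have sym: "symp E" using simple_graphD[OF g] by blast
  have in_V: "x \<in> {1..V}" "p \<in> {1..V} - {x}" "q \<in> {1..V} - {x}" "r \<in> {1..V} - {x}"
    using nb simple_graphD[OF g] by blast+
  obtain A where A: "A \<noteq> []" "hd A = p" "last A = q" "distinct A" "successively E A" "set A \<subseteq> {1..V} - {x}"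
    using induced_path[OF non_separable_conn[OF ns in_V(1-3)] in_V(2)] by blast
  obtain B where B: "B \<noteq> []" "hd B = r" "last B = p" "distinct B" "successively E B" "set B \<subseteq> {1..V} - {x}"
    using induced_path[OF non_separable_conn[OF ns in_V(1,4,2)] in_V(4)] by blast
  have "\<exists>b\<in>set B. b \<in> set A" using A B by (metis last_in_set list.set_sel(1))
  then obtain B1 y B2 where B1: "B = B1 @ y # B2" "y \<in> set A" "\<forall>b\<in>set B1. b \<notin> set A"
    by (rule split_list_first_propE)
  obtain A1 A2 where A1: "A = A1 @ y # A2" using B1(2) by (auto simp: in_set_conv_decomp)
  have prefix: "successively E (x # C @ [y])" if "successively E (C @ y # D)" "E x (hd (C @ y # D))" for C D
  proof -
    have "successively E ((C @ [y]) @ D)" using that by simp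
    then have "successively E (C @ [y])" unfolding successively_append_iff by blast
    then show ?thesis using that(2) by (cases C) auto
  qed
  have "successively E (x # A1 @ [y])" using prefix[of A1 A2] A A1 nb by metis
  moreover have "successively E (x # B1 @ [y])" using prefix[of B1 B2] B B1 nb by metis
  moreover have "successively E (x # rev A2 @ [y])"
  proof -
    have "successively E (y # A2)" using A(5) A1 by (simp add: successively_append_iff)
    then have "successively E (rev (y # A2))"
      unfolding successively_rev by (elim successively_mono) (use sym in \<open>auto dest: sympD\<close>)
    then have "successively E (rev A2 @ [y])" by simp
    moreover have "hd (rev A2 @ [y]) = q" using A(3) A1 by (cases A2 rule: rev_cases) auto
    ultimately show ?thesis using nb(2) by (cases "rev A2 @ [y]") auto
  qed
  moreover have "distinct (x # y # A1 @ rev A2 @ B1)" using A B A1 B1 by auto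
  moreover have "A1 \<noteq> [] \<or> A2 \<noteq> []" "A1 \<noteq> [] \<or> B1 \<noteq> []" "A2 \<noteq> [] \<or> B1 \<noteq> []"
    using A B A1 B1 nb(4) by auto
  ultimately have "theta_graph E x y A1 (rev A2) B1" using sym by (simp add: theta_graph_def)
  moreover have "set (x # y # A1 @ rev A2 @ B1) \<subseteq> {1..V}" using A B A1 B1 in_V by auto
  ultimately show ?thesis by blast
qed

section \<open>Small graphs and graphs of maximal degree two\<close>

lemma triangle_exchangeable:
  assumes "E x p" "E p q" "E q x" "distinct [x, p, q]"
  shows "exchangeable E x p q"
  unfolding exchangeable_def
proof
  fix f :: "'a \<Rightarrow> bool"
  have "slide E x f x (f \<circ> transpose x p \<circ> transpose p q \<circ> transpose q x)"
    using assms by (intro slide_step slide_single)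
  moreover have "f \<circ> transpose x p \<circ> transpose p q \<circ> transpose q x = f \<circ> transpose p q"
    using assms(4) by (auto simp: fun_eq_iff transpose_def)
  ultimately show "slide E x f x (f \<circ> transpose p q)" by simp
qed

text \<open>A turn around the square is a 3-cycle of the colours of \<open>p\<close>,
  \<open>m\<close>, \<open>q\<close>. Two of them agree, so the swap amounts to no turn, one turn or
  two.\<close>

lemma square_exchangeable:
  assumes "E x p" "E p m" "E m q" "E q x" "distinct [x, p, m, q]"
  shows "exchangeable E x p m"
  unfolding exchangeable_def
proof
  fix f :: "'a \<Rightarrow> bool"
  define rot where "rot f = f(p := f m, m := f q, q := f p)" for f :: "'a \<Rightarrow> bool"
  have rot: "slide E x f x (rot f)" for f
  proof -
    have "slide E x f x (f \<circ> transpose x p \<circ> transpose p m \<circ> transpose m q \<circ> transpose q x)"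
      using assms by (intro slide_step slide_single)
    moreover have "f \<circ> transpose x p \<circ> transpose p m \<circ> transpose m q \<circ> transpose q x = rot f"
      using assms(5) by (auto simp: fun_eq_iff transpose_def rot_def)
    ultimately show ?thesis by simp
  qed
  consider "f p = f m" | "f p \<noteq> f m" "f q = f p" | "f p \<noteq> f m" "f q = f m" by blast
  then show "slide E x f x (f \<circ> transpose p m)"
  proof cases
    case 1
    then have "f \<circ> transpose p m = f" by (auto simp: fun_eq_iff transpose_def)
    then show ?thesis by (simp add: slide_refl)
  next
    case 2
    then have "(f \<circ> transpose p m) v = rot f v" for v
      using assms(5) by (cases "v = p"; cases "v = m"; cases "v = q") (simp_all add: rot_def)
    then have "f \<circ> transpose p m = rot f" by blast
    then show ?thesis by (simp add: rot)
  next
    case 3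
    then have "(f \<circ> transpose p m) v = rot (rot f) v" for v
      using assms(5) by (cases "v = p"; cases "v = m"; cases "v = q") (simp_all add: rot_def)
    then have "f \<circ> transpose p m = rot (rot f)" by blast
    then show ?thesis using slide_trans[OF rot rot] by simp
  qed
qed

text \<open>A graph this small need not contain a theta graph, but a cycle through vertex 1 is then
  a triangle or a square.\<close>

lemma small_seed:
  assumes ns: "non_separable V E" and g: "simple_graph V E" and V: "V = 3 \<or> V = 4"
  shows "seed E {1..V}"
proof -
  note sym = simple_graphD(1)[OF g]
  obtain p q where pq: "p \<noteq> q" "E 1 p" "E 1 q"
    using non_separable_degree[OF ns g, of 1] V by auto
  obtain m where m: "distinct (1 # p # m @ [q])" "successively E (p # m @ [q])" "set (p # m @ [q]) \<subseteq> {1..V} - {1}"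
    using non_separable_cycle[OF ns g pq(2,3,1)] by blast
  have "card (set (p # m @ [q])) \<le> card ({1..V} - {1})" by (rule card_mono[OF _ m(3)]) simp
  moreover have "distinct (p # m @ [q])" using m(1) by simp
  ultimately have "length m \<le> 1" using V by (auto dest!: distinct_card)
  then consider "m = []" | z where "m = [z]" by (cases m) auto
  then show ?thesis
  proof cases
    case 1
    then have "exchangeable E 1 p q"
      using m pq sym by (intro triangle_exchangeable) (auto dest: sympD)
    then show ?thesis using pq m 1 V by (intro seedI[of 1 p q]) auto
  next
    case 2
    then have "exchangeable E 1 p z"
      using m pq sym by (intro square_exchangeable[of E 1 p z q]) (auto dest: sympD)
    then show ?thesis using pq m 2 V by (intro seedI[of 1 p z]) auto
  qed
qed

text \<open>A cycle \<open>c\<close> through vertex 1 gives each of its vertices two neighbours on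
  \<open>c\<close>, hence by \<open>deg\<close> no others. By connectedness nothing lies outside
  \<open>c\<close>, and the position on \<open>c\<close> is the required numbering.\<close>

lemma degree_2_polygon:
  assumes ns: "non_separable V E" and g: "simple_graph V E" and V: "V \<ge> 3"
    and deg: "\<And>x p q r. E x p \<Longrightarrow> E x q \<Longrightarrow> E x r \<Longrightarrow> \<not> distinct [p, q, r]"
  shows "is_polygon V E"
proof -
  note sym = simple_graphD(1)[OF g]
  obtain p q where pq: "p \<noteq> q" "E 1 p" "E 1 q"
    using non_separable_degree[OF ns g V, of 1] V by auto
  obtain m where m: "distinct (1 # p # m @ [q])" "successively E (p # m @ [q])" "set (p # m @ [q]) \<subseteq> {1..V} - {1}"
    using non_separable_cycle[OF ns g pq(2,3,1)] by blast
  define c where "c = 1 # p # m @ [q]"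
  define N where "N = length c"
  have N: "N \<ge> 3" and dc: "distinct c" and c_ne: "c \<noteq> []" using m by (auto simp: c_def N_def)
  have cV: "set c \<subseteq> {1..V}" using m(3) V by (auto simp: c_def)
  have "successively E c" using m(2) pq by (simp add: c_def)
  then have succ: "E (c ! i) (c ! Suc i)" if "Suc i < N" for i
    using that by (simp add: successively_conv_nth N_def)
  have next_edge: "E (c ! i) (c ! ((i + 1) mod N))" if "i < N" for i
  proof (cases "Suc i < N")
    case False
    then have "i = N - 1" using that by simp
    then have "c ! i = q" "c ! ((i + 1) mod N) = 1" using N by (auto simp: N_def c_def nth_append)
    then show ?thesis using pq sym by (auto dest: sympD)
  qed (use succ in simp)
  have nbrs: "\<exists>j<N. v = c ! j \<and> (j = (i + 1) mod N \<or> i = (j + 1) mod N)" if i: "i < N" and e: "E (c ! i) v" for i v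
  proof -
    \<comment> \<open>The indices of the successor and of the predecessor; the latter avoids
      \<open>i - 1\<close>, which is truncated at \<open>i = 0\<close>. They differ because
      \<open>N \<ge> 3\<close>.\<close>
    let ?a = "(i + 1) mod N" and ?b = "(i + (N - 1)) mod N"
    have lt: "?a < N" "?b < N" using N by auto
    have b: "(?b + 1) mod N = i" using i N by (simp add: mod_simps)
    have "?a \<noteq> ?b" using i N by (auto simp: mod_if split: if_splits)
    then have "c ! ?a \<noteq> c ! ?b" using dc lt by (simp add: nth_eq_iff_index_eq N_def)
    moreover have "E (c ! i) (c ! ?a)" using next_edge i .
    moreover have "E (c ! i) (c ! ?b)" using next_edge[OF lt(2)] b sym by (metis sympD)
    ultimately have "v = c ! ?a \<or> v = c ! ?b" using deg[OF _ _ e, of "c ! ?a" "c ! ?b"] by auto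
    then show ?thesis using b lt by metis
  qed
  have "set c = {1..V}"
  proof (intro equalityI cV subsetI)
    fix v assume v: "v \<in> {1..V}"
    have "(1, v) \<in> (induced {1..V} E)\<^sup>*"
      using ns v V unfolding non_separable_def graph_connected_def connected_on_induced by auto
    then show "v \<in> set c"
    proof (induction rule: rtrancl_induct)
      case base
      show ?case by (simp add: c_def)
    next
      case (step y z)
      obtain i where "i < N" "y = c ! i" using step.IH by (auto simp: in_set_conv_nth N_def)
      moreover have "E y z" using step.hyps by (auto simp: induced_def)
      ultimately obtain j where "j < N" "z = c ! j" using nbrs by blast
      then show ?case by (simp add: N_def)
    qed
  qed
  then have NV: "N = V" using distinct_card[OF dc] by (simp add: N_def)
  have bij: "bij_betw ((!) c) {0..<V} {1..V}"
    using bij_betw_nth[OF dc, of "{0..<V}" "{1..V}"] \<open>set c = {1..V}\<close> NV by (auto simp: N_def lessThan_atLeast0)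
  define f where "f = inv_into {0..<V} ((!) c)"
  have f: "bij_betw f {1..V} {0..<V}" unfolding f_def by (rule bij_betw_inv_into[OF bij])
  have cf: "c ! f v = v" "f v < N" if "v \<in> {1..V}" for v
    using bij_betw_inv_into_right[OF bij that] bij_betwE[OF f] that NV by (auto simp: f_def)
  have fc: "f (c ! i) = i" if "i < N" for i
    using bij_betw_inv_into_left[OF bij] that NV by (auto simp: f_def)
  have "E i j \<longleftrightarrow> f j = (f i + 1) mod V \<or> f i = (f j + 1) mod V" if i: "i \<in> {1..V}" and j: "j \<in> {1..V}" for i j
  proof
    assume "E i j"
    then obtain k where "k < N" "j = c ! k" "k = (f i + 1) mod N \<or> f i = (k + 1) mod N"
      using nbrs[of "f i" j] cf[OF i] by auto
    then show "f j = (f i + 1) mod V \<or> f i = (f j + 1) mod V" using fc NV by simp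
  next
    assume "f j = (f i + 1) mod V \<or> f i = (f j + 1) mod V"
    then show "E i j"
      using next_edge[of "f i"] next_edge[of "f j"] cf[OF i] cf[OF j] NV sym by (metis sympD)
  qed
  then show ?thesis using f unfolding is_polygon_def by blast
qed

lemma seed_freely_permutable:
  assumes "non_separable V E" "symp E" "seed E {1..V}"
  shows "freely_permutable E {1..V}"
proof -
  obtain h i j where hij: "{h, i, j} \<subseteq> {1..V}" "distinct [h, i, j]" "exchangeable E h i j" "E h i" "E h j \<or> E i j"
    using assms(3) unfolding seed_def by blast
  then have "freely_permutable E {h, i, j}" using assms(2) by (intro freely_permutable_triple)
  then show ?thesis using hij by (intro freely_permutable_extend[OF assms(1,2)]) auto
qed

lemma seed_mono: "seed E A \<Longrightarrow> A \<subseteq> B \<Longrightarrow> seed E B"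
  unfolding seed_def by blast

theorem non_separable_freely_permutable:
  assumes ns: "non_separable V E" and g: "simple_graph V E" and V: "V \<ge> 3"
    and np: "\<not> (is_polygon V E \<and> V \<ge> 5)"
  shows "freely_permutable E {1..V}"
proof (cases "V \<ge> 5")
  case True
  then obtain x p q r where "E x p" "E x q" "E x r" "distinct [p, q, r]"
    using degree_2_polygon[OF ns g V] np by blast
  from exists_theta[OF ns g this] obtain y P Q R where
    "theta_graph E x y P Q R" "set (x # y # P @ Q @ R) \<subseteq> {1..V}" by blast
  then have "seed E {1..V}" using theta_seed seed_mono by metis
  then show ?thesis by (rule seed_freely_permutable[OF ns simple_graphD(1)[OF g]])
next
  case False
  then have "seed E {1..V}" using small_seed[OF ns g] V by linarith
  then show ?thesis by (rule seed_freely_permutable[OF ns simple_graphD(1)[OF g]])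
qed

section \<open>Connectivity of the two-coloured hole puzzle\<close>

definition ups :: "nat \<Rightarrow> nat \<Rightarrow> (nat \<Rightarrow> bool) \<Rightarrow> nat" where
  "ups V h f = card {i \<in> {1..V} - {h}. f i}"

text \<open>The junk colour at the final position \<open>h'\<close> stays free. The number
  \<open>k\<close> is a parameter because the connectivity condition concerns only
  \<open>V div 2\<close> up spins, while uniqueness of the ground states uses every sector.\<close>

definition puzzle_connected :: "nat \<Rightarrow> (nat \<Rightarrow> nat \<Rightarrow> bool) \<Rightarrow> nat \<Rightarrow> bool" where
  "puzzle_connected V E k \<longleftrightarrow> (\<forall>h\<in>{1..V}. \<forall>h'\<in>{1..V}. \<forall>f f'. ups V h f = k \<longrightarrow> ups V h' f' = k \<longrightarrow>
     (\<exists>g. slide E h f h' g \<and> (\<forall>i\<in>{1..V} - {h'}. g i = f' i)))"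

lemma ups_cong: "(\<And>i. i \<in> {1..V} - {h} \<Longrightarrow> f i = g i) \<Longrightarrow> ups V h f = ups V h g"
  unfolding ups_def by (intro arg_cong[where f = card]) blast

lemma ups_transpose:
  assumes "h \<in> {1..V}" "w \<in> {1..V}"
  shows "ups V w (f \<circ> transpose h w) = ups V h f"
proof -
  have "{i \<in> {1..V} - {w}. (f \<circ> transpose h w) i} = transpose h w ` {i \<in> {1..V} - {h}. f i}"
  proof (intro equalityI subsetI)
    fix i assume "i \<in> {i \<in> {1..V} - {w}. (f \<circ> transpose h w) i}"
    then have "transpose h w i \<in> {i \<in> {1..V} - {h}. f i}"
      using assms by (auto simp: transpose_def)
    then show "i \<in> transpose h w ` {i \<in> {1..V} - {h}. f i}"
      by (metis imageI transpose_involutory)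
  qed (use assms in \<open>auto simp: transpose_def\<close>)
  then show ?thesis unfolding ups_def by (simp add: card_image)
qed

lemma slide_ups:
  assumes "slide E h f v g" "simple_graph V E" "h \<in> {1..V}"
  shows "v \<in> {1..V} \<and> ups V v g = ups V h f"
  using assms(1)
proof (induction rule: slide.induct)
  case (slide_step v g w)
  moreover have "w \<in> {1..V}" using simple_graphD(3)[OF assms(2) \<open>E v w\<close>] .
  ultimately show ?case using ups_transpose by metis
qed (use assms in simp)

lemma freely_permutable_puzzle_connected:
  assumes good: "freely_permutable E {1..V}" and g: "simple_graph V E"
  shows "puzzle_connected V E k"
  unfolding puzzle_connected_def
proof (intro ballI allI impI)
  fix h h' f f' assume h: "h \<in> {1..V}" "h' \<in> {1..V}" and k: "ups V h f = k" "ups V h' f' = k"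
  have "(h, h') \<in> (induced {1..V} E)\<^sup>*"
    using good h unfolding freely_permutable_def connected_on_induced by blast
  then obtain p where p: "slide E h id h' p" using slide_within by metis
  then have s: "slide E h f h' (f \<circ> p)" using slide_comp[OF p, of f] by simp
  define f1 where "f1 = f \<circ> p"
  have k1: "ups V h' f1 = k" using slide_ups[OF s g h(1)] k by (simp add: f1_def)
  \<comment> \<open>\<open>freely_permutable_slide\<close> preserves the junk at the hole, so the
    target \<open>f'\<close> is given the junk of \<open>f1\<close>.\<close>
  define f2 where "f2 = (\<lambda>i. if i \<in> {1..V} - {h'} then f' i else f1 i)"
  have "ups V h' f2 = k" using k(2) ups_cong[of V h' f2 f'] by (simp add: f2_def)
  then have "slide E h' f1 h' f2"
    using good h k1 by (intro freely_permutable_slide[of E "{1..V}"]) (auto simp: ups_def f2_def)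
  then have "slide E h f h' f2" using s slide_trans unfolding f1_def by metis
  then show "\<exists>g. slide E h f h' g \<and> (\<forall>i\<in>{1..V} - {h'}. g i = f' i)"
    by (intro exI[of _ f2]) (simp add: f2_def)
qed

section \<open>Invariants that obstruct connectivity: cut vertices and polygons\<close>

lemma puzzle_connected_non_separable:
  assumes pc: "puzzle_connected V E k" and g: "simple_graph V E" and conn: "graph_connected V E"
    and k: "1 \<le> k" "k + 2 \<le> V"
  shows "non_separable V E"
proof (rule ccontr)
  assume "\<not> non_separable V E"
  then obtain v where v: "v \<in> {1..V}" and nc: "\<not> connected_on ({1..V} - {v}) E"
    using conn unfolding non_separable_def by blast
  obtain x y where xy: "x \<in> {1..V} - {v}" "y \<in> {1..V} - {v}"
    "(x, y) \<notin> (induced ({1..V} - {v}) E)\<^sup>*"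
    using nc unfolding connected_on_induced Ball_def not_all not_imp
    by (elim exE conjE) (rule that)
  define A where "A = {u. (x, u) \<in> (induced ({1..V} - {v}) E)\<^sup>*}"
  have A: "A \<subseteq> {1..V} - {v}"
  proof
    fix u assume "u \<in> A"
    then have "(x, u) \<in> (induced ({1..V} - {v}) E)\<^sup>*" by (simp add: A_def)
    then show "u \<in> {1..V} - {v}" using xy(1) by (rule induced_rtrancl_in)
  qed
  have "x \<in> A" "y \<notin> A" using xy(3) by (simp_all add: A_def)
  have "v \<notin> A" using A by blast
  have fin: "finite A" using A finite_subset by blast
  have closed: "w \<in> A" if "u \<in> A" "E u w" "w \<noteq> v" for u w
  proof -
    have "(u, w) \<in> induced ({1..V} - {v}) E"
      using that A simple_graphD(3)[OF g that(2)] unfolding induced_def by blast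
    then show ?thesis using that(1) by (auto simp: A_def intro: rtrancl_into_rtrancl)
  qed
  \<comment> \<open>While the hole is inside \<open>A\<close>, the spin sitting on the cut vertex counts as belonging to \<open>A\<close>.\<close>
  define S where "S h = (if h \<in> A then insert v A else A) - {h}" for h
  \<comment> \<open>The hole enters or leaves \<open>A\<close> only through \<open>v\<close>, so
    \<open>S\<close> is carried along by each move, and with it the number of up spins on
    \<open>S\<close>.\<close>
  have S_step: "S w = transpose h w ` S h" if "E h w" for h w
  proof -
    have "E w h" "h \<noteq> w" using simple_graphD[OF g] that by (auto dest: sympD)
    then have "h \<in> A \<Longrightarrow> w \<in> A \<or> w = v" "w \<in> A \<Longrightarrow> h \<in> A \<or> h = v" using closed that by blast+
    then consider "h \<in> A" "w \<in> A" | "h \<notin> A" "w \<notin> A" | "h = v" "w \<in> A" | "h \<in> A" "w = v" by blast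
    then have "transpose h w i \<in> S h \<longleftrightarrow> i \<in> S w" for i
      using \<open>v \<notin> A\<close> \<open>h \<noteq> w\<close> by cases (auto simp: S_def transpose_def)
    then show ?thesis by (metis (no_types, opaque_lifting) image_iff subsetI subset_antisym transpose_involutory)
  qed
  have inv: "card {i \<in> S w. g i} = card {i \<in> S h. f i}" if "slide E h f w g" for h f w g
    using that
  proof (induction rule: slide.induct)
    case (slide_step u g w)
    have "{i \<in> S w. (g \<circ> transpose u w) i} = transpose u w ` {i \<in> S u. g i}"
      unfolding S_step[OF \<open>E u w\<close>] by auto
    then show ?case using slide_step.IH by (simp add: card_image)
  qed simp
  \<comment> \<open>With the hole at \<open>v\<close>, the two configurations share the up spins on
    \<open>K\<close> and differ in one more, at \<open>x\<close> inside \<open>A\<close> or at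
    \<open>y\<close> outside. The bounds on \<open>k\<close> allow this one spin and
    \<open>k - 1\<close> others on the remaining \<open>V - 3\<close> vertices.\<close>
  obtain K where K: "K \<subseteq> {1..V} - {v, x, y}" "card K = k - 1" "finite K"
  proof -
    have "x \<noteq> y" using \<open>x \<in> A\<close> \<open>y \<notin> A\<close> by blast
    then have "card {v, x, y} = 3" using xy by auto
    moreover have "{v, x, y} \<subseteq> {1..V}" using v xy by blast
    ultimately have "card ({1..V} - {v, x, y}) = V - 3" by (subst card_Diff_subset) auto
    then have "k - 1 \<le> card ({1..V} - {v, x, y})" using k by simp
    then show ?thesis using that by (rule obtain_subset_with_card_n)
  qed
  define f where "f i \<longleftrightarrow> i \<in> insert x K" for i
  define f' where "f' i \<longleftrightarrow> i \<in> insert y K" for i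
  have "{i \<in> {1..V} - {v}. f i} = insert x K" "{i \<in> {1..V} - {v}. f' i} = insert y K"
    using K xy by (auto simp: f_def f'_def)
  moreover have "x \<notin> K" "y \<notin> K" using K by auto
  ultimately have "ups V v f = k" "ups V v f' = k" using K k by (auto simp: ups_def)
  then obtain h where h: "slide E v f v h" "\<And>i. i \<in> {1..V} - {v} \<Longrightarrow> h i = f' i"
    using pc v unfolding puzzle_connected_def by blast
  have Sv: "S v = A" using \<open>v \<notin> A\<close> by (simp add: S_def)
  have "{i \<in> A. f i} = insert x (A \<inter> K)" using \<open>x \<in> A\<close> by (auto simp: f_def)
  moreover have "{i \<in> A. h i} = A \<inter> K" using A h(2) \<open>y \<notin> A\<close> by (auto simp: f'_def subset_iff)
  ultimately have "card (insert x (A \<inter> K)) = card (A \<inter> K)" using inv[OF h(1)] by (simp add: Sv)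
  then show False using \<open>x \<notin> K\<close> fin by simp
qed

text \<open>Moves of the hole preserve the cyclic word of spins. A block of at least two up spins
  contains no isolated one, whereas two down spins suffice to isolate an up spin.\<close>

lemma puzzle_connected_not_polygon:
  assumes pc: "puzzle_connected V E k" and g: "simple_graph V E" and k: "2 \<le> k" "k + 3 \<le> V"
  shows "\<not> is_polygon V E"
proof
  assume "is_polygon V E"
  then obtain pos where bij: "bij_betw pos {1..V} {0..<V}"
    and E: "\<And>i j. i \<in> {1..V} \<Longrightarrow> j \<in> {1..V} \<Longrightarrow> E i j \<longleftrightarrow> pos j = (pos i + 1) mod V \<or> pos i = (pos j + 1) mod V"
    unfolding is_polygon_def by blast
  define n where "n = V - 1"
  have V: "V > 0" "n > 0" "V = n + 1" using k by (auto simp: n_def)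
  define site where "site = inv_into {1..V} pos"
  have site: "site p \<in> {1..V}" "pos (site p) = p" if "p < V" for p
    using bij_betw_inv_into_right[OF bij, of p] bij_betw_apply[OF bij_betw_inv_into[OF bij], of p] that
    unfolding site_def by simp_all
  have pos: "pos v < V" "site (pos v) = v" if "v \<in> {1..V}" for v
    using bij that bij_betwE[OF bij] unfolding site_def by (auto simp: bij_betw_inv_into_left)
  \<comment> \<open>The colours read around the polygon starting behind the hole, continued periodically.\<close>
  define w where "w h f j = f (site ((pos h + 1 + j mod n) mod V))" for h j and f :: "nat \<Rightarrow> bool"
  \<comment> \<open>The pattern down, up, down occurs in the periodic word. Unlike the word itself,
    this does not depend on where the reading starts.\<close>
  define Q where "Q h f \<longleftrightarrow> (\<exists>j. \<not> w h f j \<and> w h f (Suc j) \<and> \<not> w h f (Suc (Suc j)))" for h f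
  \<comment> \<open>The spin that changes places with the hole passes from the beginning of the word
    to its end.\<close>
  have shift: "w h' (f \<circ> transpose h h') j = w h f (Suc j)"
    if h: "h \<in> {1..V}" "h' \<in> {1..V}" "pos h' = (pos h + 1) mod V" for h h' f j
  proof -
    define r where "r = j mod n"
    have r: "r < n" using V by (simp add: r_def)
    have eq: "(pos h' + 1 + r) mod V = (pos h + 2 + r) mod V" 
      using h(3) mod_add_left_eq[of "pos h + 1" V "1 + r"] by (simp add: ac_simps)
    show ?thesis
    proof (cases "Suc r < n")
      case True
      let ?p = "(pos h + 2 + r) mod V"
      have "Suc j mod n = Suc r" using True by (simp add: r_def mod_Suc)
      moreover have "?p \<noteq> pos h" "?p \<noteq> pos h'"
        using True V pos[OF h(1)] h(3) by (auto simp: mod_if split: if_splits)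
      moreover have "site ?p \<noteq> h" "site ?p \<noteq> h'"
        using calculation(2,3) site(2)[of ?p] V by auto
      ultimately show ?thesis unfolding w_def r_def[symmetric] eq by simp
    next
      case False
      then have r1: "Suc r = n" using r by simp
      then have "Suc j mod n = 0" by (simp add: r_def mod_Suc)
      moreover have "(pos h + 2 + r) mod V = pos h"
      proof -
        have "pos h + 2 + r = pos h + V" using r1 V by simp
        then show ?thesis using pos[OF h(1)] by (simp only: mod_add_self2 mod_less)
      qed
      ultimately show ?thesis unfolding w_def r_def[symmetric] eq
        using h(3) pos[OF h(1)] pos[OF h(2)] by simp
    qed
  qed
  have periodic: "w h f (j + n) = w h f j" for h f j by (simp add: w_def)
  have Q_step: "Q h' (f \<circ> transpose h h') = Q h f"
    if h: "h \<in> {1..V}" "h' \<in> {1..V}" "pos h' = (pos h + 1) mod V" for h h' f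
  proof
    assume "Q h' (f \<circ> transpose h h')"
    then show "Q h f" unfolding Q_def shift[OF h] by blast
  next
    assume "Q h f"
    then obtain j where "\<not> w h f j" "w h f (Suc j)" "\<not> w h f (Suc (Suc j))" unfolding Q_def by blast
    \<comment> \<open>Because of the period \<open>n\<close>, a shift by \<open>n - 1\<close> undoes
      the shift by one.\<close>
    moreover have "Suc (j + (n - 1)) = j + n" using V by simp
    ultimately have "\<not> w h f (Suc (j + (n - 1))) \<and> w h f (Suc (Suc (j + (n - 1)))) \<and> \<not> w h f (Suc (Suc (Suc (j + (n - 1)))))"
      using periodic[of h f j] periodic[of h f "Suc j"] periodic[of h f "Suc (Suc j)"] by simp
    then show "Q h' (f \<circ> transpose h h')" unfolding Q_def shift[OF h] by blast
  qed
  have inv: "Q h' f' = Q h f" if "slide E h f h' f'" for h f h' f'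
    using that
  proof (induction rule: slide.induct)
    case (slide_step u g v)
    then have uv: "u \<in> {1..V}" "v \<in> {1..V}" "E u v" using simple_graphD[OF g] by blast+
    have "Q v (g \<circ> transpose u v) = Q u g"
    proof (cases "pos v = (pos u + 1) mod V")
      case True
      then show ?thesis using Q_step uv by blast
    next
      case False
      then have "pos u = (pos v + 1) mod V" using E uv by blast
      then have "Q u ((g \<circ> transpose u v) \<circ> transpose v u) = Q v (g \<circ> transpose u v)"
        using Q_step uv by blast
      moreover have "(g \<circ> transpose u v) \<circ> transpose v u = g"
        by (simp add: comp_assoc transpose_commute[of v u])
      ultimately show ?thesis by simp
    qed
    then show ?case using slide_step.IH by (rule trans)
  qed simp
  define h where "h = site 0"
  have h: "h \<in> {1..V}" "pos h = 0" using site[of 0] V by (auto simp: h_def)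
  have inj: "inj_on site {0..<V}" using site(2) by (intro inj_on_inverseI[of _ pos]) auto
  have w: "w h f j = f (site (Suc (j mod n)))" for f j
  proof -
    have "Suc (j mod n) < V" using V by (simp add: mod_less_divisor)
    then show ?thesis by (simp add: w_def h)
  qed
  have cnt: "ups V h (\<lambda>v. pos v \<in> S) = card S" if "S \<subseteq> {1..<V}" for S
  proof -
    have "{v \<in> {1..V} - {h}. pos v \<in> S} = site ` S"
    proof (intro equalityI subsetI)
      fix v assume "v \<in> {v \<in> {1..V} - {h}. pos v \<in> S}"
      then show "v \<in> site ` S" using pos by (metis (no_types, lifting) DiffD1 imageI mem_Collect_eq)
    next
      fix v assume "v \<in> site ` S"
      then obtain p where p: "p \<in> S" "v = site p" by blast
      moreover have "p \<in> {1..<V}" using that p(1) by blast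
      ultimately have p: "p \<in> S" "v = site p" "0 < p" "p < V" by auto
      then show "v \<in> {v \<in> {1..V} - {h}. pos v \<in> S}" using site[of p] h by auto
    qed
    moreover have "inj_on site S" using inj that by (elim inj_on_subset) auto
    ultimately show ?thesis by (simp add: ups_def card_image)
  qed
  \<comment> \<open>\<open>f\<close> is one block of up spins; \<open>f'\<close> detaches its first
    spin by a down spin at position 2. Position \<open>V - 1\<close> is down as well since
    \<open>k + 3 \<le> V\<close>.\<close>
  define f where "f v \<longleftrightarrow> pos v \<in> {1..k}" for v
  define f' where "f' v \<longleftrightarrow> pos v \<in> insert 1 {3..k + 1}" for v
  have sub: "{1..k} \<subseteq> {1..<V}" "insert 1 {3..k + 1} \<subseteq> {1..<V}" using k by auto
  have "ups V h f = k" "ups V h f' = k"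
    using cnt[OF sub(1)] cnt[OF sub(2)] k by (simp_all add: f_def[abs_def] f'_def[abs_def])
  then obtain f'' where f'': "slide E h f h f''" "\<And>i. i \<in> {1..V} - {h} \<Longrightarrow> f'' i = f' i"
    using pc h(1) unfolding puzzle_connected_def by blast
  have pos_site: "pos (site (Suc (j mod n))) = Suc (j mod n)" for j
    using site(2)[of "Suc (j mod n)"] V by simp
  have "\<not> Q h f"
  proof
    assume "Q h f"
    then obtain j where j: "\<not> j mod n < k" "Suc j mod n < k" "\<not> Suc (Suc j) mod n < k"
      unfolding Q_def w f_def pos_site by (auto simp: Suc_le_eq)
    \<comment> \<open>An up letter preceded by a down letter can only be letter 0, but letter 1 is
      up too.\<close>
    then have "Suc j mod n = 0" by (auto simp: mod_Suc split: if_splits)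
    then have "Suc (Suc j) mod n = 1" using k V by (simp add: mod_Suc)
    then show False using j k by simp
  qed
  moreover have "Q h f''"
  proof -
    have off: "w h f'' j = f' (site (Suc (j mod n)))" for j
    proof -
      have "Suc (j mod n) < V" using V by simp
      then have "site (Suc (j mod n)) \<in> {1..V} - {h}" using site(1) pos_site[of j] h(2) by auto
      then show ?thesis unfolding w by (rule f'')
    qed
    \<comment> \<open>Across the end of a period: the letters \<open>n - 1\<close>, 0 and 1 stand at
      the positions \<open>V - 1\<close>, 1 and 2.\<close>
    have "\<not> w h f'' (n - 1)" "w h f'' (Suc (n - 1))" "\<not> w h f'' (Suc (Suc (n - 1)))"
      unfolding off f'_def pos_site using V k by (auto simp: mod_Suc)
    then show ?thesis unfolding Q_def by blast
  qed
  ultimately show False using inv[OF f''(1)] by simp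
qed

section \<open>The one-hole space in coordinates\<close>

lemma sum_single:
  assumes "finite A" "h \<in> A" "\<And>j. j \<in> A \<Longrightarrow> j \<noteq> h \<Longrightarrow> g j = 0"
  shows "sum g A = (g h :: 'b :: comm_monoid_add)"
proof -
  have "sum g A = g h + sum g (A - {h})" using assms(1,2) by (rule sum.remove)
  also have "sum g (A - {h}) = 0" using assms(3) by (intro sum.neutral) auto
  finally show ?thesis by simp
qed

definition conf :: "nat \<Rightarrow> nat \<Rightarrow> (nat \<Rightarrow> bool) \<Rightarrow> mode set" where
  "conf V h f = (\<lambda>i. (i, f i)) ` ({1..V} - {h})"

lemma mem_conf: "(i, s) \<in> conf V h f \<longleftrightarrow> i \<in> {1..V} - {h} \<and> s = f i"
  by (auto simp: conf_def)

lemma fst_conf: "fst ` conf V h f = {1..V} - {h}"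
  by (simp add: conf_def image_image)

lemma conf_in_configs1:
  assumes "h \<in> {1..V}"
  shows "conf V h f \<in> configs1 V"
proof -
  have "card (conf V h f) = card ({1..V} - {h})"
    unfolding conf_def by (rule card_image) (auto simp: inj_on_def)
  then have "card (conf V h f) = V - 1" using assms by simp
  then show ?thesis by (auto simp: configs1_def modes_def mem_conf)
qed

lemma conf_cong: "(\<And>i. i \<in> {1..V} - {h} \<Longrightarrow> f i = g i) \<Longrightarrow> conf V h f = conf V h g"
  unfolding conf_def by (rule image_cong) auto

lemma conf_eq_iff:
  assumes "h \<in> {1..V}" "h' \<in> {1..V}"
  shows "conf V h f = conf V h' g \<longleftrightarrow> h = h' \<and> (\<forall>i\<in>{1..V} - {h}. f i = g i)"
proof
  assume eq: "conf V h f = conf V h' g"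
  then have "{1..V} - {h} = {1..V} - {h'}" using fst_conf by metis
  then have "h = h'" using assms by blast
  moreover have "f i = g i" if "i \<in> {1..V} - {h}" for i
  proof -
    have "(i, f i) \<in> conf V h' g" using that eq[symmetric] by (simp add: mem_conf)
    then show ?thesis by (simp add: mem_conf)
  qed
  ultimately show "h = h' \<and> (\<forall>i\<in>{1..V} - {h}. f i = g i)" by blast
next
  assume "h = h' \<and> (\<forall>i\<in>{1..V} - {h}. f i = g i)"
  then show "conf V h f = conf V h' g" using conf_cong[of V h f g] by blast
qed

text \<open>Without double occupancy the electrons sit on distinct sites, so \<open>V - 1\<close> of
  them leave exactly one site empty.\<close>

lemma configs1_conf:
  assumes "S \<in> configs1 V" "V \<ge> 1"
  shows "\<exists>h\<in>{1..V}. \<exists>f. S = conf V h f"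
proof -
  have S: "S \<subseteq> modes V" "card S = V - 1" "\<And>i. \<not> ((i, True) \<in> S \<and> (i, False) \<in> S)"
    using assms(1) by (auto simp: configs1_def)
  have inj: "inj_on fst S"
  proof (rule inj_onI)
    fix a b assume "a \<in> S" "b \<in> S" "fst a = fst b"
    then show "a = b" using S(3)[of "fst a"] by (cases a; cases b; cases "snd a"; cases "snd b") auto
  qed
  have sub: "fst ` S \<subseteq> {1..V}" using S(1) by (auto simp: modes_def)
  have "card ({1..V} - fst ` S) = V - (V - 1)"
    using sub card_image[OF inj] S(2) by (subst card_Diff_subset) (auto intro: finite_subset)
  then have "card ({1..V} - fst ` S) = 1" using assms(2) by simp
  then obtain h where h: "{1..V} - fst ` S = {h}" by (rule card_1_singletonE)
  then have hV: "h \<in> {1..V}" and fS: "fst ` S = {1..V} - {h}" using sub by blast+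
  have "S = conf V h (\<lambda>i. (i, True) \<in> S)"
  proof (intro equalityI subsetI)
    fix m assume m: "m \<in> S"
    obtain i s where m_eq: "m = (i, s)" by (cases m)
    have "i \<in> fst ` S" using m m_eq image_iff by fastforce
    then have "i \<in> {1..V} - {h}" using fS by simp
    moreover have "s = ((i, True) \<in> S)" using m m_eq S(3)[of i] by (cases s) auto
    ultimately show "m \<in> conf V h (\<lambda>i. (i, True) \<in> S)" by (simp add: m_eq mem_conf)
  next
    fix m assume "m \<in> conf V h (\<lambda>i. (i, True) \<in> S)"
    then obtain i where i: "i \<in> {1..V} - {h}" "m = (i, (i, True) \<in> S)" unfolding conf_def by blast
    then have "i \<in> fst ` S" using fS by simp
    then obtain s where "(i, s) \<in> S" by auto
    then show "m \<in> S" using i(2) S(3)[of i] by (cases s) auto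
  qed
  then show ?thesis using hV by blast
qed

section \<open>Jordan-Wigner signs and the matrix elements of the Hamiltonian\<close>

lemma jw_sign_sites:
  assumes "i \<notin> I" "finite I"
  shows "jw_sign (i, s) ((\<lambda>j. (j, f j)) ` I) = (-1) ^ card {j \<in> I. j < i}"
proof -
  have "{m' \<in> (\<lambda>j. (j, f j)) ` I. mode_less m' (i, s)} = (\<lambda>j. (j, f j)) ` {j \<in> I. j < i}"
    using assms(1) by (auto simp: mode_less_def)
  moreover have "inj_on (\<lambda>j. (j, f j)) {j \<in> I. j < i}" by (auto simp: inj_on_def)
  ultimately show ?thesis by (simp add: jw_sign_def card_image)
qed

text \<open>The creation operator of the smallest site acts last, on a state with only larger sites
  occupied, so no sign ever arises.\<close>

lemma foldr_cdag:
  assumes "sorted_wrt (<) L"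
  shows "foldr (\<lambda>i \<phi>. cdag (i, \<sigma> i) \<phi>) L vac = (\<lambda>S. if S = (\<lambda>i. (i, \<sigma> i)) ` set L then 1 else 0)"
  using assms
proof (induction L)
  case Nil
  then show ?case by (simp add: vac_def)
next
  case (Cons i L)
  let ?T = "(\<lambda>i. (i, \<sigma> i)) ` set L"
  have i: "i \<notin> set L" "\<And>j. j \<in> set L \<Longrightarrow> i < j" using Cons.prems by auto
  have sign: "jw_sign (i, \<sigma> i) ?T = 1"
  proof -
    have none: "{j \<in> set L. j < i} = {}" using i(2) by force
    show ?thesis unfolding jw_sign_sites[OF i(1) finite_set] none by simp
  qed
  have "foldr (\<lambda>i \<phi>. cdag (i, \<sigma> i) \<phi>) (i # L) vac S = (if S = (\<lambda>i. (i, \<sigma> i)) ` set (i # L) then 1 else 0)" for S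
  proof -
    have IH: "foldr (\<lambda>i \<phi>. cdag (i, \<sigma> i) \<phi>) L vac = (\<lambda>S. if S = ?T then 1 else 0)" using Cons by simp
    have *: "foldr (\<lambda>i \<phi>. cdag (i, \<sigma> i) \<phi>) (i # L) vac S =
        (if (i, \<sigma> i) \<in> S then jw_sign (i, \<sigma> i) (S - {(i, \<sigma> i)}) * (if S - {(i, \<sigma> i)} = ?T then 1 else 0) else 0)"
      unfolding foldr_Cons comp_apply IH by (simp add: cdag_def)
    show ?thesis
    proof (cases "S = insert (i, \<sigma> i) ?T")
      case True
      moreover have "(i, \<sigma> i) \<notin> ?T" using i(1) by auto
      ultimately have "(i, \<sigma> i) \<in> S" "S - {(i, \<sigma> i)} = ?T" by blast+
      then show ?thesis unfolding * using sign True by simp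
    next
      case False
      then have "(i, \<sigma> i) \<notin> S \<or> S - {(i, \<sigma> i)} \<noteq> ?T" by blast
      then show ?thesis unfolding * using False by auto
    qed
  qed
  then show ?case by blast
qed

lemma basis_state_conf:
  "basis_state V h \<sigma> = (\<lambda>S. (-1) ^ h * (if S = conf V h \<sigma> then 1 else 0))"
proof -
  have "sorted_wrt (<) (filter (\<lambda>i. i \<noteq> h) [1..<V+1])"
    by (rule sorted_wrt_filter) (rule sorted_wrt_upt)
  moreover have "set (filter (\<lambda>i. i \<noteq> h) [1..<V+1]) = {1..V} - {h}" by auto
  ultimately show ?thesis unfolding basis_state_def by (simp only: foldr_cdag conf_def)
qed

text \<open>Sites below both \<open>i\<close> and \<open>h\<close> count twice, which leaves the
  parity of the number of sites strictly between them. Combined with the factors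
  \<open>(-1) ^ h\<close> of the basis states, this sign makes all hopping matrix elements equal to
  \<open>- t\<close>.\<close>

lemma hop_sign:
  assumes "h \<in> {1..V}" "i \<in> {1..V}" "i \<noteq> h"
  shows "(-1 :: complex) ^ card {j \<in> {1..V} - {h, i}. j < i} * (-1) ^ card {j \<in> {1..V} - {h, i}. j < h} = (-1) ^ (i + h + 1)"
proof -
  have *: "(-1 :: complex) ^ card {j \<in> {1..V} - {a, b}. j < b} * (-1) ^ card {j \<in> {1..V} - {a, b}. j < a} = (-1) ^ (b + a + 1)"
    if "a < b" "1 \<le> a" "b \<le> V" for a b
  proof -
    have "{j \<in> {1..V} - {a, b}. j < b} = {1..<b} - {a}" "{j \<in> {1..V} - {a, b}. j < a} = {1..<a}"
      using that by auto
    moreover have "card ({1..<b} - {a}) = b - 2" using that by simp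
    \<comment> \<open>The even number 4 brings the exponent \<open>a + b - 3\<close> to the required
      form.\<close>
    moreover have "(b - 2) + (a - 1) + 4 = b + a + 1" using that by simp
    then have "(-1 :: complex) ^ (b + a + 1) = (-1) ^ (b - 2) * (-1) ^ (a - 1) * (-1) ^ 4"
      by (metis power_add)
    ultimately show ?thesis by simp
  qed
  show ?thesis
  proof (cases "h < i")
    case True
    then show ?thesis using *[of h i] assms by simp
  next
    case False
    then show ?thesis using *[of i h] assms by (simp add: insert_commute mult.commute add.commute)
  qed
qed

text \<open>In the coefficient at a configuration with hole \<open>h\<close>, only the terms that
  move an electron from \<open>h\<close> to an occupied site \<open>i\<close> survive, so the hole
  was at \<open>i\<close> before.\<close>

lemma H_inf_conf:
  assumes h: "h \<in> {1..V}" and t0: "\<And>i. t i i = 0"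
  shows "H_inf V t \<psi> (conf V h f) =
    (\<Sum>i\<in>{1..V}. complex_of_real (t i h) * (-1) ^ (i + h + 1) * \<psi> (conf V i (f \<circ> transpose h i)))"
proof -
  let ?S = "conf V h f"
  let ?P = "Proj1 V \<psi>"
  have "H_inf V t \<psi> ?S = hop V t ?P ?S"
    using conf_in_configs1[OF h] by (simp add: H_inf_def Proj1_def)
  also have "\<dots> = (\<Sum>i\<in>{1..V}. complex_of_real (t i h) * (-1) ^ (i + h + 1) * \<psi> (conf V i (f \<circ> transpose h i)))"
    unfolding hop_def
  proof (rule sum.cong[OF refl])
    fix i assume i: "i \<in> {1..V}"
    let ?g = "\<lambda>j s. complex_of_real (t i j) * cdag (i, s) (cann (j, s) ?P) ?S"
    show "(\<Sum>j\<in>{1..V}. \<Sum>s\<in>UNIV. ?g j s) = complex_of_real (t i h) * (-1) ^ (i + h + 1) * \<psi> (conf V i (f \<circ> transpose h i))"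
    proof (cases "i = h")
      case True
      have "(\<Sum>j\<in>{1..V}. \<Sum>s\<in>UNIV. ?g j s) = 0"
        by (intro sum.neutral ballI) (simp add: True cdag_def mem_conf)
      then show ?thesis using True t0 by simp
    next
      case False
      let ?s = "f i"
      define I where "I = {1..V} - {h, i}"
      define T where "T = (\<lambda>j. (j, f j)) ` I"
      have T: "?S - {(i, ?s)} = T" using i False by (auto simp: T_def I_def conf_def)
      have zero_s: "?g j s = 0" if "s \<noteq> ?s" for j s using that by (simp add: cdag_def mem_conf)
      have in_S: "(i, ?s) \<in> ?S" using i False by (simp add: mem_conf)
      \<comment> \<open>The hop would start from a site \<open>j\<close> that is occupied afterwards
        too: equal spins are excluded by the Pauli principle, opposite ones mean a double occupancy
        removed by \<open>Proj1\<close>.\<close>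
      have zero_j: "?g j ?s = 0" if j: "j \<in> {1..V}" "j \<noteq> h" for j
      proof (cases "j = i")
        case True
        then show ?thesis using t0 by simp
      next
        case False
        then have jT: "(j, f j) \<in> T" using j by (simp add: T_def I_def)
        show ?thesis
        proof (cases "(j, ?s) \<in> T")
          case True
          then show ?thesis by (simp add: cdag_def cann_def T)
        next
          case no: False
          then have "?s \<noteq> f j" using jT by (cases "f i"; cases "f j") simp_all
          then have "insert (j, ?s) T \<notin> configs1 V"
            using jT unfolding configs1_def by (cases "f j"; cases "f i") auto
          then show ?thesis by (simp add: cdag_def cann_def T Proj1_def)
        qed
      qed
      have g_h: "?g h ?s = complex_of_real (t i h) * (-1) ^ (i + h + 1) * \<psi> (conf V i (f \<circ> transpose h i))"
      proof -
        have I: "i \<notin> I" "h \<notin> I" "finite I" by (auto simp: I_def)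
        have ins: "insert (h, ?s) T = conf V i (f \<circ> transpose h i)"
        proof -
          have "{1..V} - {i} = insert h I" using h False by (auto simp: I_def)
          then have "conf V i (f \<circ> transpose h i) = insert (h, ?s) ((\<lambda>j. (j, (f \<circ> transpose h i) j)) ` I)"
            by (simp add: conf_def)
          also have "(\<lambda>j. (j, (f \<circ> transpose h i) j)) ` I = T"
            unfolding T_def using I by (intro image_cong) (auto simp: transpose_def)
          finally show ?thesis by (rule sym)
        qed
        have "(h, ?s) \<notin> T" using I by (auto simp: T_def)
        then have "?g h ?s = complex_of_real (t i h) * (jw_sign (i, ?s) T * (jw_sign (h, ?s) T * \<psi> (insert (h, ?s) T)))"
          using in_S conf_in_configs1[OF i] ins by (simp add: cdag_def cann_def T Proj1_def)
        also have "\<dots> = complex_of_real (t i h) * ((-1) ^ card {j \<in> I. j < i} * (-1) ^ card {j \<in> I. j < h}) * \<psi> (insert (h, ?s) T)"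
          using I by (simp add: T_def jw_sign_sites)
        finally show ?thesis using hop_sign[OF h i False] by (simp only: I_def[symmetric] ins)
      qed
      have "(\<Sum>j\<in>{1..V}. \<Sum>s\<in>UNIV. ?g j s) = (\<Sum>j\<in>{1..V}. ?g j ?s)"
        by (intro sum.cong refl sum_single zero_s) auto
      also have "\<dots> = ?g h ?s" using h zero_j by (intro sum_single) auto
      finally show ?thesis using g_h by simp
    qed
  qed
  finally show ?thesis .
qed

lemma H_inf_outside: "S \<notin> configs1 V \<Longrightarrow> H_inf V t \<psi> S = 0"
  by (simp add: H_inf_def Proj1_def)

text \<open>The coefficient of the basis state with hole \<open>h\<close> and spins
  \<open>f\<close>, including its sign, as \<open>fip_basis_state\<close> confirms. In these
  coordinates all entries of \<open>H_inf\<close> are \<open>- t\<close> or 0.\<close>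

definition amp :: "nat \<Rightarrow> fvec \<Rightarrow> nat \<Rightarrow> (nat \<Rightarrow> bool) \<Rightarrow> complex" where
  "amp V \<psi> h f = (-1) ^ h * \<psi> (conf V h f)"

lemma amp_H_inf:
  assumes h: "h \<in> {1..V}" and t0: "\<And>i. t i i = 0"
  shows "amp V (H_inf V t \<psi>) h f = - (\<Sum>i\<in>{1..V}. complex_of_real (t i h) * amp V \<psi> i (f \<circ> transpose h i))"
proof -
  have *: "(-1) ^ h * (complex_of_real (t i h) * (-1) ^ (i + h + 1) * \<psi> (conf V i (f \<circ> transpose h i)))
      = - (complex_of_real (t i h) * amp V \<psi> i (f \<circ> transpose h i))" for i
  proof -
    have "(-1 :: complex) ^ h * (-1) ^ (i + h + 1) = - ((-1) ^ i)"
      by (cases "even h"; cases "even i") auto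
    then show ?thesis unfolding amp_def by (simp add: mult.assoc mult.left_commute)
  qed
  show ?thesis
    unfolding amp_def[of V "H_inf V t \<psi>"] H_inf_conf[OF h t0] sum_distrib_left sum_negf[symmetric]
    by (rule sum.cong[OF refl *])
qed

lemma amp_cong: "(\<And>i. i \<in> {1..V} - {h} \<Longrightarrow> f i = g i) \<Longrightarrow> amp V \<psi> h f = amp V \<psi> h g"
  unfolding amp_def by (intro arg_cong[where f = "\<lambda>S. _ * \<psi> S"] conf_cong)

lemma H1_eqI:
  assumes "\<psi> \<in> H1 V" "\<phi> \<in> H1 V" "V \<ge> 1" "\<And>h f. h \<in> {1..V} \<Longrightarrow> amp V \<psi> h f = amp V \<phi> h f"
  shows "\<psi> = \<phi>"
proof
  fix S
  show "\<psi> S = \<phi> S"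
  proof (cases "S \<in> configs1 V")
    case True
    then obtain h f where "h \<in> {1..V}" "S = conf V h f" using configs1_conf assms(3) by blast
    then show ?thesis using assms(4)[of h f] by (simp add: amp_def)
  next
    case False
    then show ?thesis using assms(1,2) by (simp add: H1_def)
  qed
qed

lemma fip_basis_state:
  assumes "h \<in> {1..V}"
  shows "fip V (basis_state V h \<sigma>) \<psi> = amp V \<psi> h \<sigma>"
proof -
  have "conf V h \<sigma> \<in> Pow (modes V)" using conf_in_configs1[OF assms] by (auto simp: configs1_def)
  moreover have "finite (Pow (modes V))" by (simp add: modes_def)
  ultimately have "fip V (basis_state V h \<sigma>) \<psi> = cnj (basis_state V h \<sigma> (conf V h \<sigma>)) * \<psi> (conf V h \<sigma>)"
    unfolding fip_def by (intro sum_single) (auto simp: basis_state_conf)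
  then show ?thesis by (simp add: basis_state_conf amp_def)
qed

lemma amp_basis_state:
  assumes "h \<in> {1..V}" "h' \<in> {1..V}"
  shows "amp V (basis_state V h \<sigma>) h' f = (if h' = h \<and> (\<forall>i\<in>{1..V} - {h}. f i = \<sigma> i) then 1 else 0)"
proof -
  have "conf V h' f = conf V h \<sigma> \<longleftrightarrow> h' = h \<and> (\<forall>i\<in>{1..V} - {h}. f i = \<sigma> i)"
    using conf_eq_iff[OF assms(2,1), of f \<sigma>] by blast
  then show ?thesis by (simp add: amp_def basis_state_conf)
qed

lemma ups_complement: "h \<in> {1..V} \<Longrightarrow> card {i \<in> {1..V} - {h}. \<not> f i} = V - 1 - ups V h f \<and> ups V h f \<le> V - 1"
proof -
  assume h: "h \<in> {1..V}"
  have "card ({i \<in> {1..V} - {h}. f i} \<union> {i \<in> {1..V} - {h}. \<not> f i}) = ups V h f + card {i \<in> {1..V} - {h}. \<not> f i}"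
    unfolding ups_def by (rule card_Un_disjoint) auto
  moreover have "{i \<in> {1..V} - {h}. f i} \<union> {i \<in> {1..V} - {h}. \<not> f i} = {1..V} - {h}" by blast
  ultimately show ?thesis using h by simp
qed

section \<open>Connectivity of the Hamiltonian and of the puzzle\<close>

locale hubbard =
  fixes V :: nat and E :: "nat \<Rightarrow> nat \<Rightarrow> bool" and t :: "nat \<Rightarrow> nat \<Rightarrow> real"
  assumes V3: "V \<ge> 3" and graph: "simple_graph V E" and conn: "graph_connected V E"
    and t_sym: "\<And>i j. t i j = t j i" and t_pos: "\<And>i j. E i j \<Longrightarrow> t i j > 0"
    and t_zero: "\<And>i j. \<not> E i j \<Longrightarrow> t i j = 0"
begin

lemma t_nonneg: "t i j \<ge> 0"
  using t_pos[of i j] t_zero[of i j] by (cases "E i j") auto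

lemma t_diag: "t i i = 0"
  using graph t_zero by (auto simp: simple_graph_def)

lemma symE: "symp E"
  using simple_graphD(1)[OF graph] .

lemma t_pos_iff: "t i j > 0 \<longleftrightarrow> E i j"
  using t_pos[of i j] t_zero[of i j] by (cases "E i j") auto

lemma exists_neighbour: "h \<in> {1..V} \<Longrightarrow> \<exists>i. E i h"
proof -
  assume h: "h \<in> {1..V}"
  obtain z where z: "z \<in> {1..V}" "z \<noteq> h" using exists_third[OF V3] by blast
  have "(h, z) \<in> (induced {1..V} E)\<^sup>*"
    using conn h z unfolding graph_connected_def connected_on_induced by blast
  then show ?thesis using induced_first_step[of h z "{1..V}" E] z symE by (metis sympD)
qed

text \<open>The matrix element of \<open>(-H)\<close> to the power \<open>n\<close> from \<open>|h0,f0\<rangle>\<close> to \<open>|h,f\<rangle>\<close>.\<close>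

fun weight :: "nat \<Rightarrow> (nat \<Rightarrow> bool) \<Rightarrow> nat \<Rightarrow> nat \<Rightarrow> (nat \<Rightarrow> bool) \<Rightarrow> real" where
  "weight h0 f0 0 h f = (if h = h0 \<and> (\<forall>i\<in>{1..V} - {h0}. f i = f0 i) then 1 else 0)"
| "weight h0 f0 (Suc n) h f = (\<Sum>i\<in>{1..V}. t i h * weight h0 f0 n i (f \<circ> transpose h i))"

lemma weight_nonneg: "weight h0 f0 n h f \<ge> 0"
proof (induction n arbitrary: h f)
  case (Suc n)
  then show ?case unfolding weight.simps by (intro sum_nonneg mult_nonneg_nonneg t_nonneg)
qed simp

text \<open>All summands are nonnegative, so nothing cancels, and positivity amounts to the
  existence of a walk of the hole.\<close>

lemma weight_Suc_pos:
  "weight h0 f0 (Suc n) h f > 0 \<longleftrightarrow> (\<exists>i. E i h \<and> weight h0 f0 n i (f \<circ> transpose h i) > 0)"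
proof -
  have "weight h0 f0 (Suc n) h f > 0 \<longleftrightarrow> (\<exists>i\<in>{1..V}. t i h * weight h0 f0 n i (f \<circ> transpose h i) > 0)"
  proof -
    have "weight h0 f0 (Suc n) h f \<noteq> 0 \<longleftrightarrow> (\<exists>i\<in>{1..V}. t i h * weight h0 f0 n i (f \<circ> transpose h i) \<noteq> 0)"
      by (simp add: sum_nonneg_eq_0_iff weight_nonneg t_nonneg)
    moreover have "t i h * weight h0 f0 n i (f \<circ> transpose h i) \<ge> 0" for i
      by (simp add: weight_nonneg t_nonneg)
    ultimately show ?thesis using weight_nonneg[of h0 f0 "Suc n" h f] by (metis less_eq_real_def less_irrefl)
  qed
  also have "\<dots> \<longleftrightarrow> (\<exists>i. E i h \<and> weight h0 f0 n i (f \<circ> transpose h i) > 0)"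
  proof -
    have "t i h * weight h0 f0 n i (f \<circ> transpose h i) > 0 \<longleftrightarrow> E i h \<and> weight h0 f0 n i (f \<circ> transpose h i) > 0" for i
      using t_nonneg[of i h] by (auto simp: zero_less_mult_iff t_pos_iff)
    then show ?thesis using simple_graphD(2)[OF graph] by blast
  qed
  finally show ?thesis .
qed

lemma amp_power:
  assumes "h0 \<in> {1..V}" "h \<in> {1..V}"
  shows "amp V ((H_inf V t ^^ n) (basis_state V h0 f0)) h f = (-1) ^ n * complex_of_real (weight h0 f0 n h f)"
  using assms(2)
proof (induction n arbitrary: h f)
  case 0
  then show ?case using amp_basis_state[OF assms(1)] by simp
next
  case (Suc n)
  have "amp V ((H_inf V t ^^ Suc n) (basis_state V h0 f0)) h f =
      - (\<Sum>i\<in>{1..V}. complex_of_real (t i h) * amp V ((H_inf V t ^^ n) (basis_state V h0 f0)) i (f \<circ> transpose h i))"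
    using amp_H_inf[where t = t, OF Suc.prems t_diag] by simp
  also have "\<dots> = - (\<Sum>i\<in>{1..V}. complex_of_real (t i h) * ((-1) ^ n * complex_of_real (weight h0 f0 n i (f \<circ> transpose h i))))"
    by (intro arg_cong[where f = uminus] sum.cong refl) (simp only: Suc.IH)
  also have "\<dots> = (-1) ^ Suc n * complex_of_real (weight h0 f0 (Suc n) h f)"
    by (simp add: sum_distrib_left sum_negf mult.left_commute del: comp_apply)
  finally show ?case .
qed

lemma weight_pos_slide:
  "weight h0 f0 n h f > 0 \<Longrightarrow> \<exists>g. slide E h f h0 g \<and> (\<forall>i\<in>{1..V} - {h0}. g i = f0 i)"
proof (induction n arbitrary: h f)
  case 0
  then show ?case by (auto intro!: exI[of _ f] slide_refl split: if_splits)
next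
  case (Suc n)
  then obtain i where i: "E i h" "weight h0 f0 n i (f \<circ> transpose h i) > 0"
    using weight_Suc_pos by blast
  from Suc.IH[OF i(2)] obtain g where
    g: "slide E i (f \<circ> transpose h i) h0 g" "\<forall>i\<in>{1..V} - {h0}. g i = f0 i" by blast
  have "E h i" using i(1) symE by (auto dest: sympD)
  then show ?case using slide_trans[OF slide_single g(1)] g(2) by blast
qed

lemma slide_weight_pos:
  assumes "slide E h0 f0 h f"
  shows "\<exists>n. weight h0 f0 n h f > 0"
  using assms
proof (induction rule: slide.induct)
  case slide_refl
  show ?case by (intro exI[of _ 0]) simp
next
  case (slide_step v g w)
  then obtain n where n: "weight h0 f0 n v g > 0" by blast
  have "(g \<circ> transpose v w) \<circ> transpose w v = g"
    by (simp add: comp_assoc transpose_commute[of w v])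
  then have "weight h0 f0 (Suc n) w (g \<circ> transpose v w) > 0"
    unfolding weight_Suc_pos using n \<open>E v w\<close> by (intro exI[of _ v]) simp
  then show ?case by blast
qed

text \<open>By \<open>amp_power\<close> the weight is an amplitude up to sign, and amplitudes do not
  see the junk colour at the hole.\<close>

lemma weight_cong:
  assumes "\<And>i. i \<in> {1..V} - {h} \<Longrightarrow> f i = g i" "h \<in> {1..V}" "h0 \<in> {1..V}"
  shows "weight h0 f0 n h f = weight h0 f0 n h g"
proof -
  have "amp V \<psi> h f = amp V \<psi> h g" for \<psi> using assms(1) by (rule amp_cong)
  then have "(-1 :: complex) ^ n * complex_of_real (weight h0 f0 n h f) = (-1) ^ n * complex_of_real (weight h0 f0 n h g)"
    unfolding amp_power[OF assms(3,2), symmetric] .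
  then show ?thesis by simp
qed

text \<open>The connectivity condition demands a positive power, while the trivial walk has length
  0. A step to a neighbour and back adds two.\<close>

lemma weight_pos_later:
  assumes "weight h0 f0 n h f > 0" "h \<in> {1..V}"
  shows "\<exists>m>0. weight h0 f0 m h f > 0"
proof -
  obtain i where i: "E i h" using exists_neighbour[OF assms(2)] by blast
  then have "E h i" using symE by (auto dest: sympD)
  have eq: "(f \<circ> transpose h i) \<circ> transpose i h = f"
    by (simp add: comp_assoc transpose_commute[of i h])
  have "weight h0 f0 (Suc n) i (f \<circ> transpose h i) > 0"
    unfolding weight_Suc_pos using assms(1) \<open>E h i\<close> eq by (intro exI[of _ h]) simp
  then have "weight h0 f0 (Suc (Suc n)) h f > 0" unfolding weight_Suc_pos[of _ _ "Suc n"] using i by blast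
  then show ?thesis by blast
qed

text \<open>For odd \<open>V\<close>, total spin 0 of \<open>V - 1\<close> electrons means
  \<open>(V - 1) / 2\<close> up spins; for even \<open>V\<close>, total spin 1/2 means
  \<open>V / 2\<close>.\<close>

lemma Sz_min_iff: "h \<in> {1..V} \<Longrightarrow> Sz_basis V h f = min_Sz V \<longleftrightarrow> ups V h f = V div 2"
proof -
  assume h: "h \<in> {1..V}"
  let ?u = "ups V h f"
  have "Sz_basis V h f = (real ?u - real (V - 1 - ?u)) / 2"
    using ups_complement[OF h, of f] by (simp add: Sz_basis_def ups_def)
  also have "\<dots> = real ?u - (real V - 1) / 2"
  proof -
    define d where "d = V - 1 - ?u"
    have "V = 1 + ?u + d" using ups_complement[OF h, of f] V3 unfolding d_def by linarith
    then have "real V = 1 + real ?u + real d" by (metis of_nat_1 of_nat_add)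
    then show ?thesis unfolding d_def[symmetric] by (simp add: field_simps)
  qed
  finally have *: "Sz_basis V h f = min_Sz V \<longleftrightarrow> 2 * real ?u = real V - 1 + 2 * min_Sz V" by (auto simp: field_simps)
  show ?thesis
  proof (cases "even V")
    case True
    then obtain k where k: "V = 2 * k" by blast
    then have "odd (V - 1)" using V3 by simp
    then show ?thesis unfolding * using k by (auto simp: min_Sz_def)
  next
    case False
    then obtain k where k: "V = 2 * k + 1" by (rule oddE)
    then show ?thesis unfolding * by (auto simp: min_Sz_def)
  qed
qed

theorem connectivity_iff_puzzle: "connectivity V t \<longleftrightarrow> puzzle_connected V E (V div 2)"
proof -
  have key: "(\<exists>n>0. fip V (basis_state V h' f') ((H_inf V t ^^ n) (basis_state V h f)) \<noteq> 0) \<longleftrightarrow>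
        (\<exists>g. slide E h f h' g \<and> (\<forall>i\<in>{1..V} - {h'}. g i = f' i))"
    if h: "h \<in> {1..V}" "h' \<in> {1..V}" for h h' f f'
  proof -
    have "(\<exists>n>0. fip V (basis_state V h' f') ((H_inf V t ^^ n) (basis_state V h f)) \<noteq> 0) \<longleftrightarrow>
          (\<exists>n>0. weight h f n h' f' > 0)"
    proof -
      have "fip V (basis_state V h' f') ((H_inf V t ^^ n) (basis_state V h f)) \<noteq> 0 \<longleftrightarrow> weight h f n h' f' > 0" for n
        using weight_nonneg[of h f n h' f'] unfolding fip_basis_state[OF h(2)] amp_power[OF h] by auto
      then show ?thesis by simp
    qed
    also have "\<dots> \<longleftrightarrow> (\<exists>n. weight h f n h' f' > 0)" using weight_pos_later[OF _ h(2)] by blast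
    also have "\<dots> \<longleftrightarrow> (\<exists>g. slide E h f h' g \<and> (\<forall>i\<in>{1..V} - {h'}. g i = f' i))"
    proof
      assume "\<exists>n. weight h f n h' f' > 0"
      \<comment> \<open>This walk runs backwards from \<open>h'\<close> to \<open>h\<close>. Reading
        it as a positive weight with the roles exchanged and applying
        \<open>weight_pos_slide\<close> again yields the forward walk.\<close>
      then obtain k where k: "slide E h' f' h k" "\<And>i. i \<in> {1..V} - {h} \<Longrightarrow> k i = f i"
        using weight_pos_slide by metis
      then obtain n where "weight h' f' n h k > 0" using slide_weight_pos by blast
      then have "weight h' f' n h f > 0" using weight_cong[OF k(2) h] by simp
      then show "\<exists>g. slide E h f h' g \<and> (\<forall>i\<in>{1..V} - {h'}. g i = f' i)" by (rule weight_pos_slide)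
    next
      assume "\<exists>g. slide E h f h' g \<and> (\<forall>i\<in>{1..V} - {h'}. g i = f' i)"
      then obtain g where g: "slide E h f h' g" "\<And>i. i \<in> {1..V} - {h'} \<Longrightarrow> g i = f' i" by blast
      then obtain n where "weight h f n h' g > 0" using slide_weight_pos by blast
      then show "\<exists>n. weight h f n h' f' > 0" using weight_cong[OF g(2) h(2,1)] by auto
    qed
    finally show ?thesis .
  qed
  show ?thesis
  proof
    assume c: "connectivity V t"
    show "puzzle_connected V E (V div 2)"
      unfolding puzzle_connected_def
    proof (intro ballI allI impI)
      fix h h' f f' assume h: "h \<in> {1..V}" "h' \<in> {1..V}" and u: "ups V h f = V div 2" "ups V h' f' = V div 2"
      show "\<exists>g. slide E h f h' g \<and> (\<forall>i\<in>{1..V} - {h'}. g i = f' i)"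
        unfolding key[OF h, symmetric]
        using c[unfolded connectivity_def, rule_format, OF h] u Sz_min_iff h by metis
    qed
  next
    assume p: "puzzle_connected V E (V div 2)"
    show "connectivity V t"
      unfolding connectivity_def
    proof (intro allI impI)
      fix h f h' f' assume h: "h \<in> {1..V}" "h' \<in> {1..V}"
        and u: "Sz_basis V h f = min_Sz V" "Sz_basis V h' f' = min_Sz V"
      show "\<exists>n>0. fip V (basis_state V h' f') ((H_inf V t ^^ n) (basis_state V h f)) \<noteq> 0"
        unfolding key[OF h]
        using p[unfolded puzzle_connected_def, rule_format, OF h] u Sz_min_iff h by metis
    qed
  qed
qed

theorem connectivity_iff:
  "connectivity V t \<longleftrightarrow> non_separable V E \<and> \<not> (is_polygon V E \<and> V \<ge> 5)"
proof
  assume "connectivity V t"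
  then have pc: "puzzle_connected V E (V div 2)" unfolding connectivity_iff_puzzle .
  have "1 \<le> V div 2" "V div 2 + 2 \<le> V" using V3 by presburger+
  then have "non_separable V E" by (rule puzzle_connected_non_separable[OF pc graph conn])
  moreover have "\<not> is_polygon V E" if "V \<ge> 5"
  proof -
    \<comment> \<open>From \<open>V = 5\<close> on, the minimal sector has at least two spins of
      each kind.\<close>
    have "2 \<le> V div 2" "V div 2 + 3 \<le> V" using that by presburger+
    then show ?thesis by (rule puzzle_connected_not_polygon[OF pc graph])
  qed
  ultimately show "non_separable V E \<and> \<not> (is_polygon V E \<and> V \<ge> 5)" by blast
next
  assume "non_separable V E \<and> \<not> (is_polygon V E \<and> V \<ge> 5)"
  then have "freely_permutable E {1..V}"
    using non_separable_freely_permutable[OF _ graph V3] by blast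
  then show "connectivity V t"
    unfolding connectivity_iff_puzzle by (rule freely_permutable_puzzle_connected[OF _ graph])
qed

end

section \<open>The Perron vector of the hopping matrix\<close>

text \<open>By Tychonoff: the sphere is a closed subset of a product of intervals
  \<open>{-1..1}\<close> over \<open>I\<close> and points \<open>{0}\<close> elsewhere.\<close>

lemma compact_unit_sphere_on:
  fixes I :: "'i set"
  assumes "finite I"
  shows "compact {x :: 'i \<Rightarrow> real. (\<forall>i. i \<notin> I \<longrightarrow> x i = 0) \<and> (\<Sum>i\<in>I. (x i)\<^sup>2) = 1}"
proof -
  define S where "S i = (if i \<in> I then {-1..1 :: real} else {0})" for i
  have "compactin (product_topology (\<lambda>i. euclidean) UNIV) (Pi\<^sub>E UNIV S)"
    unfolding compactin_PiE by (auto simp: S_def)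
  then have box: "compact (Pi\<^sub>E UNIV S)" by (simp add: euclidean_product_topology)
  have "closed {x :: 'i \<Rightarrow> real. (\<Sum>i\<in>I. (x i)\<^sup>2) = 1}"
    by (intro closed_Collect_eq continuous_intros)
       (auto intro: continuous_on_product_coordinates)
  then have "compact (Pi\<^sub>E UNIV S \<inter> {x. (\<Sum>i\<in>I. (x i)\<^sup>2) = 1})"
    using box by (rule compact_Int_closed[rotated])
  moreover have "{x. (\<forall>i. i \<notin> I \<longrightarrow> x i = 0) \<and> (\<Sum>i\<in>I. (x i)\<^sup>2) = 1} = Pi\<^sub>E UNIV S \<inter> {x. (\<Sum>i\<in>I. (x i)\<^sup>2) = 1}"
  proof (intro equalityI subsetI)
    fix x :: "'i \<Rightarrow> real" assume x: "x \<in> {x. (\<forall>i. i \<notin> I \<longrightarrow> x i = 0) \<and> (\<Sum>i\<in>I. (x i)\<^sup>2) = 1}"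
    have "x i \<in> {-1..1}" if "i \<in> I" for i
    proof -
      have "(x i)\<^sup>2 \<le> (\<Sum>i\<in>I. (x i)\<^sup>2)" using assms that by (intro member_le_sum) auto
      then have "\<bar>x i\<bar> \<le> 1" using x by (simp add: abs_square_le_1)
      then show ?thesis by auto
    qed
    then show "x \<in> Pi\<^sub>E UNIV S \<inter> {x. (\<Sum>i\<in>I. (x i)\<^sup>2) = 1}" using x by (auto simp: S_def)
  next
    fix x assume "x \<in> Pi\<^sub>E UNIV S \<inter> {x. (\<Sum>i\<in>I. (x i)\<^sup>2) = 1}"
    then show "x \<in> {x. (\<forall>i. i \<notin> I \<longrightarrow> x i = 0) \<and> (\<Sum>i\<in>I. (x i)\<^sup>2) = 1}"
      by (auto simp: S_def PiE_iff split: if_splits)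
  qed
  ultimately show ?thesis by simp
qed

text \<open>The first-order condition at a maximum: a linear term that is bounded by a quadratic one
  for both signs of \<open>e\<close> vanishes.\<close>

lemma linear_term_zero:
  fixes d l :: real
  assumes "\<And>e. 2 * e * d \<le> l * e\<^sup>2"
  shows "d = 0"
proof -
  define c where "c = \<bar>l\<bar> + 1"
  have c: "c > 0" "l \<le> c" by (auto simp: c_def)
  \<comment> \<open>Since \<open>c\<close> is positive and at least \<open>l\<close>, the bound at
    \<open>e = d / c\<close> fails unless \<open>d = 0\<close>.\<close>
  have "2 * (d / c) * d \<le> l * (d / c)\<^sup>2" by (rule assms)
  also have "\<dots> \<le> c * (d / c)\<^sup>2" using c by (intro mult_right_mono) auto
  also have "\<dots> = d\<^sup>2 / c" using c by (simp add: power2_eq_square)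
  finally have "2 * d\<^sup>2 / c \<le> d\<^sup>2 / c" by (simp add: power2_eq_square)
  then have "2 * d\<^sup>2 \<le> d\<^sup>2" using c by (simp add: divide_le_cancel)
  then show ?thesis by simp
qed

text \<open>A maximizer of the quadratic form \<open>Q\<close> on the unit sphere may be replaced by
  its absolute values because all \<open>t\<close> are nonnegative. The first variation is the
  eigenvalue equation, and a zero would spread to all neighbours and, by connectedness,
  everywhere.\<close>

lemma (in hubbard) perron:
  "\<exists>(\<phi> :: nat \<Rightarrow> real) l. (\<forall>h\<in>{1..V}. \<phi> h > 0) \<and> (\<forall>h\<in>{1..V}. (\<Sum>i\<in>{1..V}. t i h * \<phi> i) = l * \<phi> h) \<and> l > 0"
proof -
  let ?I = "{1..V}"
  define Q where "Q x = (\<Sum>i\<in>?I. \<Sum>j\<in>?I. t i j * x i * x j)" for x :: "nat \<Rightarrow> real"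
  define N where "N x = (\<Sum>i\<in>?I. (x i)\<^sup>2)" for x :: "nat \<Rightarrow> real"
  define K where "K = {x :: nat \<Rightarrow> real. (\<forall>i. i \<notin> ?I \<longrightarrow> x i = 0) \<and> N x = 1}"
  have "compact K" unfolding K_def N_def by (rule compact_unit_sphere_on) simp
  moreover have "K \<noteq> {}"
  proof -
    have "(\<lambda>i. if i = 1 then 1 else 0) \<in> K"
      using V3 by (auto simp: K_def N_def if_distrib[of "\<lambda>x. x\<^sup>2"] cong: if_cong)
    then show ?thesis by blast
  qed
  moreover have "continuous_on K Q"
    unfolding Q_def by (intro continuous_intros continuous_on_subset[OF continuous_on_product_coordinates]) auto
  ultimately obtain x where x: "x \<in> K" "\<And>y. y \<in> K \<Longrightarrow> Q y \<le> Q x"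
    using continuous_attains_sup by metis
  define l where "l = Q x"
  have N_nonneg: "N y \<ge> 0" for y unfolding N_def by (intro sum_nonneg) auto
  have scale: "Q (\<lambda>i. c * y i) = c\<^sup>2 * Q y" "N (\<lambda>i. c * y i) = c\<^sup>2 * N y" for c y
    unfolding Q_def N_def by (simp_all add: sum_distrib_left power2_eq_square mult_ac)
  \<comment> \<open>By homogeneity, the maximum on the sphere controls all vectors supported on the
    graph.\<close>
  have bound: "Q y \<le> l * N y" if y: "\<And>i. i \<notin> ?I \<Longrightarrow> y i = 0" for y
  proof (cases "N y = 0")
    case True
    then have "y i = 0" if "i \<in> ?I" for i
      using that unfolding N_def by (simp add: sum_nonneg_eq_0_iff)
    then have "Q y = 0" unfolding Q_def by (simp add: sum.neutral)
    then show ?thesis using True by simp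
  next
    case False
    then have pos: "N y > 0" using N_nonneg[of y] by simp
    define c where "c = 1 / sqrt (N y)"
    have c2: "c\<^sup>2 = 1 / N y" using pos by (simp add: c_def power_divide)
    have "(\<lambda>i. c * y i) \<in> K" using y pos by (simp add: K_def scale c2)
    then have "c\<^sup>2 * Q y \<le> l" using x(2) by (simp add: l_def scale[symmetric])
    then show ?thesis using pos by (simp add: c2 field_simps)
  qed
  define \<phi> where "\<phi> i = \<bar>x i\<bar>" for i
  have \<phi>0: "\<phi> i = 0" if "i \<notin> ?I" for i using x(1) that by (simp add: K_def \<phi>_def)
  have N\<phi>: "N \<phi> = 1" using x(1) by (simp add: K_def N_def \<phi>_def)
  have Q\<phi>: "Q \<phi> = l"
  proof (rule antisym)
    show "Q \<phi> \<le> l" using bound[of \<phi>] \<phi>0 N\<phi> by simp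
    have "t i j * x i * x j \<le> t i j * \<phi> i * \<phi> j" for i j
    proof -
      have "x i * x j \<le> \<phi> i * \<phi> j" unfolding \<phi>_def abs_mult[symmetric] by (rule abs_ge_self)
      then show ?thesis using t_nonneg[of i j] by (simp add: mult.assoc mult_left_mono)
    qed
    then show "l \<le> Q \<phi>" unfolding l_def Q_def by (intro sum_mono)
  qed
  have eig: "(\<Sum>i\<in>?I. t i h * \<phi> i) = l * \<phi> h" if h: "h \<in> ?I" for h
  proof -
    define s where "s = (\<Sum>i\<in>?I. t i h * \<phi> i)"
    define \<delta> where "\<delta> i = (if i = h then 1 else 0 :: real)" for i
    \<comment> \<open>Perturb \<open>\<phi>\<close> by \<open>e\<close> at the single vertex
      \<open>h\<close>. As \<open>t h h = 0\<close>, \<open>Q\<close> gains only the linear term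
      \<open>2 * e * s\<close>, while \<open>N\<close> gains \<open>2 * e * \<phi> h\<close> and the
      square of \<open>e\<close>.\<close>
    have "2 * e * (s - l * \<phi> h) \<le> l * e\<^sup>2" for e
    proof -
      define y where "y i = \<phi> i + e * \<delta> i" for i
      have c1: "(\<Sum>i\<in>?I. \<Sum>j\<in>?I. t i j * \<phi> i * \<delta> j) = s"
        using h by (simp add: s_def \<delta>_def sum.delta if_distrib[of "\<lambda>x. _ * x"] cong: if_cong)
      have c2: "(\<Sum>i\<in>?I. \<Sum>j\<in>?I. t i j * \<delta> i * \<phi> j) = s"
      proof -
        have "(\<Sum>i\<in>?I. \<Sum>j\<in>?I. t i j * \<delta> i * \<phi> j) = (\<Sum>j\<in>?I. \<Sum>i\<in>?I. t j i * \<phi> j * \<delta> i)"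
          by (subst sum.swap) (simp add: t_sym mult_ac)
        then show ?thesis using c1 by simp
      qed
      have c3: "(\<Sum>i\<in>?I. \<Sum>j\<in>?I. t i j * \<delta> i * \<delta> j) = 0"
        by (intro sum.neutral ballI) (auto simp: \<delta>_def t_diag)
      have "Q y = (\<Sum>i\<in>?I. \<Sum>j\<in>?I. t i j * \<phi> i * \<phi> j + e * (t i j * \<phi> i * \<delta> j) + e * (t i j * \<delta> i * \<phi> j) + e\<^sup>2 * (t i j * \<delta> i * \<delta> j))"
        unfolding Q_def y_def by (intro sum.cong refl) (simp add: algebra_simps power2_eq_square)
      also have "\<dots> = Q \<phi> + e * s + e * s + e\<^sup>2 * 0"
        unfolding sum.distrib sum_distrib_left[symmetric] c1 c2 c3 Q_def ..
      finally have Qy: "Q y = l + 2 * e * s" using Q\<phi> by simp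
      have d1: "(\<Sum>i\<in>?I. \<phi> i * \<delta> i) = \<phi> h" "(\<Sum>i\<in>?I. \<delta> i * \<delta> i) = 1"
        using h by (simp_all add: \<delta>_def sum.delta if_distrib[of "\<lambda>x. _ * x"] cong: if_cong)
      have "N y = (\<Sum>i\<in>?I. (\<phi> i)\<^sup>2 + 2 * e * (\<phi> i * \<delta> i) + e\<^sup>2 * (\<delta> i * \<delta> i))"
        unfolding N_def y_def by (intro sum.cong refl) (simp add: algebra_simps power2_eq_square)
      also have "\<dots> = N \<phi> + 2 * e * \<phi> h + e\<^sup>2 * 1"
        unfolding sum.distrib sum_distrib_left[symmetric] d1 N_def ..
      finally have Ny: "N y = 1 + 2 * e * \<phi> h + e\<^sup>2" using N\<phi> by simp
      have "Q y \<le> l * N y" using \<phi>0 h by (intro bound) (auto simp: y_def \<delta>_def)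
      then show ?thesis unfolding Qy Ny by (simp add: algebra_simps)
    qed
    then have "s - l * \<phi> h = 0" by (rule linear_term_zero)
    then show ?thesis by (simp add: s_def)
  qed
  have \<phi>_nonneg: "\<phi> i \<ge> 0" for i by (simp add: \<phi>_def)
  have zero_nbr: "\<phi> i = 0" if "\<phi> h = 0" "E h i" for h i
  proof -
    have hi: "h \<in> ?I" "i \<in> ?I" "E i h" using simple_graphD[OF graph] that(2) symE by (auto dest: sympD)
    have "(\<Sum>i\<in>?I. t i h * \<phi> i) = 0" using eig[OF hi(1)] that(1) by simp
    then have "t i h * \<phi> i = 0" using hi(2) by (simp add: sum_nonneg_eq_0_iff t_nonneg \<phi>_nonneg)
    then show ?thesis using t_pos[OF hi(3)] by simp
  qed
  have pos: "\<phi> h > 0" if h: "h \<in> ?I" for h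
  proof (rule ccontr)
    assume "\<not> \<phi> h > 0"
    then have h0: "\<phi> h = 0" using \<phi>_nonneg[of h] by simp
    have "\<phi> i = 0" if "i \<in> ?I" for i
    proof -
      have "(h, i) \<in> (induced ?I E)\<^sup>*"
        using conn h that unfolding graph_connected_def connected_on_induced by blast
      then show ?thesis
        by (induction rule: rtrancl_induct) (use h0 zero_nbr in \<open>auto simp: induced_def\<close>)
    qed
    then have "N \<phi> = 0" by (simp add: N_def)
    then show False using N\<phi> by simp
  qed
  have "l > 0"
  proof -
    have one: "1 \<in> ?I" using V3 by simp
    obtain i where i: "E i 1" using exists_neighbour[OF one] by blast
    have iI: "i \<in> ?I" using simple_graphD(2)[OF graph i] .
    have "0 < t i 1 * \<phi> i" using t_pos[OF i] pos[OF iI] by simp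
    also have "\<dots> \<le> (\<Sum>i\<in>?I. t i 1 * \<phi> i)" using iI by (intro member_le_sum) (auto simp: t_nonneg \<phi>_nonneg)
    finally have "0 < l * \<phi> 1" using eig[OF one] by simp
    then show ?thesis using pos[OF one] by (simp add: zero_less_mult_iff)
  qed
  then show ?thesis using pos eig by blast
qed

section \<open>Spin operators on states symmetric under permutations of the spins\<close>

lemma jw_sign_square: "jw_sign m S * jw_sign m S = 1"
  by (simp add: jw_sign_def power_add[symmetric])

text \<open>The two modes of site \<open>i\<close> are adjacent in the order and \<open>S\<close>
  contains neither, so the same modes of \<open>S\<close> precede both. Hence spin flips carry no
  sign.\<close>

lemma jw_sign_spin:
  assumes "(i, True) \<notin> S" "(i, False) \<notin> S"
  shows "jw_sign (i, s) S = jw_sign (i, s') S"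
proof -
  have "{m \<in> S. mode_less m (i, s)} = {m \<in> S. mode_less m (i, s')}"
  proof (intro Collect_cong conj_cong refl)
    fix m assume m: "m \<in> S"
    have "fst m \<noteq> i" using assms m by (cases m; cases "snd m") auto
    then show "mode_less m (i, s) = mode_less m (i, s')" by (simp add: mode_less_def)
  qed
  then show ?thesis by (simp add: jw_sign_def)
qed

lemma num_apply: "num m \<psi> S = (if m \<in> S then \<psi> S else 0)"
proof (cases "m \<in> S")
  case True
  then have "num m \<psi> S = (jw_sign m (S - {m}) * jw_sign m (S - {m})) * \<psi> S"
    by (simp add: num_def cdag_def cann_def insert_absorb)
  then show ?thesis using True by (simp add: jw_sign_square)
qed (simp add: num_def cdag_def)

lemma flip_apply:
  "cdag (i, s) (cann (i, \<not> s) \<psi>) S =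
     (if (i, s) \<in> S \<and> (i, \<not> s) \<notin> S then \<psi> (insert (i, \<not> s) (S - {(i, s)})) else 0)"
proof (cases "(i, s) \<in> S \<and> (i, \<not> s) \<notin> S")
  case True
  let ?T = "S - {(i, s)}"
  have "(i, True) \<notin> ?T" "(i, False) \<notin> ?T" using True by (cases s; auto)+
  then have "jw_sign (i, s) ?T * jw_sign (i, \<not> s) ?T = 1"
    using jw_sign_spin[of i ?T s "\<not> s"] jw_sign_square by metis
  then show ?thesis using True by (simp add: cdag_def cann_def mult.assoc[symmetric])
next
  case False
  then show ?thesis by (auto simp: cdag_def cann_def)
qed

text \<open>Here \<open>s\<close> is the spin after the flip, so that \<open>S_plus\<close> and
  \<open>S_minus\<close> are treated at once.\<close>

definition spin_flip :: "nat \<Rightarrow> bool \<Rightarrow> fvec \<Rightarrow> fvec" where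
  "spin_flip V s \<psi> = (\<lambda>S. \<Sum>i\<in>{1..V}. cdag (i, s) (cann (i, \<not> s) \<psi>) S)"

lemma S_plus_flip: "S_plus V = spin_flip V True"
  by (simp add: fun_eq_iff S_plus_def spin_flip_def)

lemma S_minus_flip: "S_minus V = spin_flip V False"
  by (simp add: fun_eq_iff S_minus_def spin_flip_def)

lemma flip_conf:
  assumes "i \<in> {1..V} - {h}"
  shows "insert (i, s) (conf V h f - {(i, f i)}) = conf V h (f(i := s))"
proof (rule set_eqI)
  fix m :: mode
  obtain j r where "m = (j, r)" by (cases m)
  then show "m \<in> insert (i, s) (conf V h f - {(i, f i)}) \<longleftrightarrow> m \<in> conf V h (f(i := s))"
    using assms by (cases "j = i"; cases r; cases "f i") (auto simp: mem_conf)
qed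

lemma spin_flip_H1:
  assumes "\<psi> \<in> H1 V" "V \<ge> 1"
  shows "spin_flip V s \<psi> \<in> H1 V"
proof -
  have "cdag (i, s) (cann (i, \<not> s) \<psi>) S = 0" if S: "S \<notin> configs1 V" for i S
  proof (cases "(i, s) \<in> S \<and> (i, \<not> s) \<notin> S")
    case True
    let ?T = "insert (i, \<not> s) (S - {(i, s)})"
    have "?T \<notin> configs1 V"
    proof
      assume "?T \<in> configs1 V"
      then obtain h f where h: "h \<in> {1..V}" and T: "?T = conf V h f" using configs1_conf assms(2) by blast
      have "(i, \<not> s) \<in> conf V h f" using T by blast
      then have i: "i \<in> {1..V} - {h}" and fi: "f i = (\<not> s)" by (auto simp: mem_conf)
      have "S = insert (i, s) (?T - {(i, \<not> s)})" using True by (cases s) auto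
      also have "\<dots> = conf V h (f(i := s))" unfolding T using flip_conf[OF i, of s f] fi by simp
      finally show False using S conf_in_configs1[OF h] by simp
    qed
    then show ?thesis using assms(1) by (simp add: flip_apply H1_def)
  qed (unfold flip_apply, auto)
  then show ?thesis by (simp add: H1_def spin_flip_def)
qed

lemma spin_flip_amp:
  assumes "h \<in> {1..V}"
  shows "amp V (spin_flip V s \<psi>) h f = (\<Sum>i\<in>{i \<in> {1..V} - {h}. f i = s}. amp V \<psi> h (f(i := \<not> s)))"
proof -
  have "cdag (i, s) (cann (i, \<not> s) \<psi>) (conf V h f) =
      (if i \<in> {i \<in> {1..V} - {h}. f i = s} then \<psi> (conf V h (f(i := \<not> s))) else 0)" for i
  proof (cases "i \<in> {i \<in> {1..V} - {h}. f i = s}")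
    case True
    then have i: "i \<in> {1..V} - {h}" "f i = s" by auto
    then have "(i, s) \<in> conf V h f" "(i, \<not> s) \<notin> conf V h f" by (auto simp: mem_conf)
    then show ?thesis using True flip_conf[OF i(1), of "\<not> s" f] i(2) by (simp add: flip_apply)
  next
    case False
    then have "(i, s) \<notin> conf V h f" by (auto simp: mem_conf)
    then show ?thesis using False by (auto simp: flip_apply)
  qed
  then have "spin_flip V s \<psi> (conf V h f) =
      (\<Sum>i\<in>{1..V}. if i \<in> {i \<in> {1..V} - {h}. f i = s} then \<psi> (conf V h (f(i := \<not> s))) else 0)"
    unfolding spin_flip_def by simp
  also have "\<dots> = (\<Sum>i\<in>{1..V} \<inter> {i \<in> {1..V} - {h}. f i = s}. \<psi> (conf V h (f(i := \<not> s))))"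
    by (rule sum.inter_restrict[symmetric]) simp
  also have "{1..V} \<inter> {i \<in> {1..V} - {h}. f i = s} = {i \<in> {1..V} - {h}. f i = s}" by blast
  finally show ?thesis unfolding amp_def sum_distrib_left[symmetric] by (simp only:)
qed

lemma S_z_amp:
  assumes "h \<in> {1..V}"
  shows "amp V (S_z V \<psi>) h f = (of_nat (ups V h f) - of_nat (V - 1 - ups V h f)) / 2 * amp V \<psi> h f"
proof -
  let ?A = "{i \<in> {1..V} - {h}. f i}" and ?B = "{i \<in> {1..V} - {h}. \<not> f i}"
  have cB: "card ?B = V - 1 - ups V h f" using ups_complement[OF assms, of f] by blast
  have "S_z V \<psi> (conf V h f) = (\<Sum>i\<in>{1..V}. ((if i \<in> ?A then 1 else 0) - (if i \<in> ?B then 1 else 0)) * (\<psi> (conf V h f) / 2))"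
    unfolding S_z_def by (intro sum.cong refl) (auto simp: num_apply mem_conf)
  also have "\<dots> = ((\<Sum>i\<in>{1..V}. if i \<in> ?A then 1 else 0) - (\<Sum>i\<in>{1..V}. if i \<in> ?B then 1 else 0)) * (\<psi> (conf V h f) / 2)"
    unfolding sum_distrib_right[symmetric] sum_subtractf ..
  also have "(\<Sum>i\<in>{1..V}. if i \<in> ?A then 1 else 0) = (\<Sum>i\<in>{1..V} \<inter> ?A. 1 :: complex)"
    by (rule sum.inter_restrict[symmetric]) simp
  also have "(\<Sum>i\<in>{1..V}. if i \<in> ?B then 1 else 0) = (\<Sum>i\<in>{1..V} \<inter> ?B. 1 :: complex)"
    by (rule sum.inter_restrict[symmetric]) simp
  also have "{1..V} \<inter> ?A = ?A" by blast
  also have "{1..V} \<inter> ?B = ?B" by blast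
  finally have "S_z V \<psi> (conf V h f) = (of_nat (ups V h f) - of_nat (V - 1 - ups V h f)) * (\<psi> (conf V h f) / 2)"
    unfolding sum_constant cB by (simp add: ups_def)
  then show ?thesis by (simp add: amp_def)
qed

lemma S_z_H1: "\<psi> \<in> H1 V \<Longrightarrow> S_z V \<psi> \<in> H1 V"
  by (auto simp: H1_def S_z_def num_apply intro!: sum.neutral)

section \<open>States symmetric in the spins\<close>

definition sym_state :: "nat \<Rightarrow> (nat \<Rightarrow> real) \<Rightarrow> (nat \<Rightarrow> complex) \<Rightarrow> fvec" where
  "sym_state V \<phi> g = (\<lambda>S. if S \<in> configs1 V then
     let h = (THE h. h \<in> {1..V} \<and> h \<notin> fst ` S)
     in (-1) ^ h * of_real (\<phi> h) * g (card {i. (i, True) \<in> S}) else 0)"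

lemma sym_state_H1: "sym_state V \<phi> g \<in> H1 V"
  by (simp add: H1_def sym_state_def)

text \<open>\<open>sym_state\<close> recovers the hole as the one site missing from
  \<open>S\<close>. Its amplitudes depend on the spins only through the number of up spins, so the
  spin operators act on the factor \<open>g\<close> alone.\<close>

lemma amp_sym_state:
  assumes "h \<in> {1..V}"
  shows "amp V (sym_state V \<phi> g) h f = of_real (\<phi> h) * g (ups V h f)"
proof -
  have "(THE h'. h' \<in> {1..V} \<and> h' \<notin> fst ` conf V h f) = h"
    unfolding fst_conf using assms by (intro the_equality) blast+
  moreover have "{i. (i, True) \<in> conf V h f} = {i \<in> {1..V} - {h}. f i}" by (auto simp: mem_conf)
  ultimately show ?thesis
    using conf_in_configs1[OF assms, of f] by (simp add: amp_def sym_state_def ups_def)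
qed

text \<open>Any of the \<open>k\<close> up spins may be the raised one, coming from
  \<open>k - 1\<close> up spins. At \<open>k = 0\<close> the truncated \<open>k - 1\<close> is
  multiplied by 0.\<close>

lemma S_plus_sym_state:
  assumes "V \<ge> 1"
  shows "S_plus V (sym_state V \<phi> g) = sym_state V \<phi> (\<lambda>k. of_nat k * g (k - 1))"
proof (rule H1_eqI[OF _ sym_state_H1 assms])
  show "S_plus V (sym_state V \<phi> g) \<in> H1 V" unfolding S_plus_flip by (rule spin_flip_H1[OF sym_state_H1 assms])
  fix h f assume h: "h \<in> {1..V}"
  let ?A = "{i \<in> {1..V} - {h}. f i}"
  have "ups V h (f(i := False)) = ups V h f - 1" if "i \<in> ?A" for i
  proof -
    have "{j \<in> {1..V} - {h}. (f(i := False)) j} = ?A - {i}" by auto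
    then show ?thesis unfolding ups_def using that by simp
  qed
  then have "amp V (S_plus V (sym_state V \<phi> g)) h f = (\<Sum>i\<in>?A. of_real (\<phi> h) * g (ups V h f - 1))"
    unfolding S_plus_flip spin_flip_amp[OF h] amp_sym_state[OF h] by (intro sum.cong) auto
  then show "amp V (S_plus V (sym_state V \<phi> g)) h f = amp V (sym_state V \<phi> (\<lambda>k. of_nat k * g (k - 1))) h f"
    unfolding amp_sym_state[OF h] by (simp add: ups_def)
qed

lemma S_minus_sym_state:
  assumes "V \<ge> 1"
  shows "S_minus V (sym_state V \<phi> g) = sym_state V \<phi> (\<lambda>k. of_nat (V - 1 - k) * g (k + 1))"
proof (rule H1_eqI[OF _ sym_state_H1 assms])
  show "S_minus V (sym_state V \<phi> g) \<in> H1 V" unfolding S_minus_flip by (rule spin_flip_H1[OF sym_state_H1 assms])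
  fix h f assume h: "h \<in> {1..V}"
  let ?A = "{i \<in> {1..V} - {h}. f i}" and ?B = "{i \<in> {1..V} - {h}. \<not> f i}"
  have cB: "card ?B = V - 1 - ups V h f" using ups_complement[OF h, of f] by blast
  have "ups V h (f(i := True)) = ups V h f + 1" if "i \<in> ?B" for i
  proof -
    have "{j \<in> {1..V} - {h}. (f(i := True)) j} = insert i ?A" using that by auto
    then show ?thesis unfolding ups_def using that by simp
  qed
  then have "amp V (S_minus V (sym_state V \<phi> g)) h f = (\<Sum>i\<in>?B. of_real (\<phi> h) * g (ups V h f + 1))"
    unfolding S_minus_flip spin_flip_amp[OF h] amp_sym_state[OF h] by (intro sum.cong) auto
  then show "amp V (S_minus V (sym_state V \<phi> g)) h f = amp V (sym_state V \<phi> (\<lambda>k. of_nat (V - 1 - k) * g (k + 1))) h f"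
    unfolding amp_sym_state[OF h] sum_constant cB by (simp add: mult_ac)
qed

lemma S_z_sym_state:
  assumes "V \<ge> 1"
  shows "S_z V (sym_state V \<phi> g) = sym_state V \<phi> (\<lambda>k. (of_nat k - of_nat (V - 1 - k)) / 2 * g k)"
proof (rule H1_eqI[OF _ sym_state_H1 assms])
  show "S_z V (sym_state V \<phi> g) \<in> H1 V" by (rule S_z_H1[OF sym_state_H1])
  show "amp V (S_z V (sym_state V \<phi> g)) h f = amp V (sym_state V \<phi> (\<lambda>k. (of_nat k - of_nat (V - 1 - k)) / 2 * g k)) h f"
    if h: "h \<in> {1..V}" for h f
    unfolding S_z_amp[OF h] amp_sym_state[OF h] by (simp add: mult_ac)
qed

lemma cscale_H1: "\<psi> \<in> H1 V \<Longrightarrow> cscale c \<psi> \<in> H1 V"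
  by (simp add: H1_def cscale_def)

lemma amp_cscale: "amp V (cscale c \<psi>) h f = c * amp V \<psi> h f"
  by (simp add: amp_def cscale_def)

text \<open>With \<open>k\<close> up and \<open>d\<close> down spins the terms are
  \<open>(k * (d + 1) + d * (k + 1)) / 2\<close> and the square of \<open>(k - d) / 2\<close>. Their
  sum is \<open>J * (J + 1)\<close> for \<open>J = (k + d) / 2 = (V - 1) / 2\<close>, whatever
  \<open>k\<close> is.\<close>

lemma S_tot_sq_sym_state:
  assumes "V \<ge> 1"
  shows "S_tot_sq V (sym_state V \<phi> g) =
    cscale (complex_of_real (((real V - 1) / 2) * ((real V - 1) / 2 + 1))) (sym_state V \<phi> g)"
proof (rule H1_eqI[OF _ cscale_H1[OF sym_state_H1] assms])
  let ?\<psi> = "sym_state V \<phi> g"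
  have amp_sum: "amp V (S_tot_sq V ?\<psi>) h f = (amp V (S_plus V (S_minus V ?\<psi>)) h f + amp V (S_minus V (S_plus V ?\<psi>)) h f) / 2
      + amp V (S_z V (S_z V ?\<psi>)) h f" for h f
    by (simp add: S_tot_sq_def amp_def algebra_simps)
  note ops = S_plus_sym_state[OF assms] S_minus_sym_state[OF assms] S_z_sym_state[OF assms]
  show "S_tot_sq V ?\<psi> \<in> H1 V"
    unfolding H1_def S_tot_sq_def ops by (simp add: sym_state_def)
  fix h f assume h: "h \<in> {1..V}"
  define k where "k = ups V h f"
  define d where "d = V - 1 - k"
  have V: "V = k + d + 1" using ups_complement[OF h, of f] assms unfolding k_def d_def by linarith
  have up: "V - 1 - (k - 1) = d + 1" if "k > 0" using that V by simp
  have p: "amp V (S_plus V (S_minus V ?\<psi>)) h f = of_real (\<phi> h) * (of_nat k * (of_nat (d + 1) * g k))"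
    unfolding ops amp_sym_state[OF h] k_def[symmetric] using up by (cases "k = 0") simp_all
  have m: "amp V (S_minus V (S_plus V ?\<psi>)) h f = of_real (\<phi> h) * (of_nat d * (of_nat (k + 1) * g k))"
    unfolding ops amp_sym_state[OF h] k_def[symmetric] d_def by simp
  have z: "amp V (S_z V (S_z V ?\<psi>)) h f = of_real (\<phi> h) * ((of_nat k - of_nat d) / 2 * ((of_nat k - of_nat d) / 2 * g k))"
    unfolding ops amp_sym_state[OF h] k_def[symmetric] d_def ..
  have "real V - 1 = real k + real d" using V by simp
  then have c: "complex_of_real (((real V - 1) / 2) * ((real V - 1) / 2 + 1)) =
      (of_nat k + of_nat d) / 2 * ((of_nat k + of_nat d) / 2 + 1)" by simp
  show "amp V (S_tot_sq V ?\<psi>) h f = amp V (cscale (complex_of_real (((real V - 1) / 2) * ((real V - 1) / 2 + 1))) ?\<psi>) h f"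
    unfolding amp_sum amp_cscale c p m z amp_sym_state[OF h] k_def[symmetric] by (simp add: field_simps)
qed

section \<open>The ground space\<close>

text \<open>There are infinitely many colourings, but only their values on the sites matter. The
  representatives \<open>r f\<close>, which are \<open>False\<close> elsewhere, leave finitely many
  candidates.\<close>

lemma exists_max_config:
  fixes F :: "nat \<Rightarrow> (nat \<Rightarrow> bool) \<Rightarrow> real"
  assumes F: "\<And>h f g. (\<And>i. i \<in> {1..V} - {h} \<Longrightarrow> f i = g i) \<Longrightarrow> F h f = F h g"
    and P: "\<And>h f g. (\<And>i. i \<in> {1..V} - {h} \<Longrightarrow> f i = g i) \<Longrightarrow> P h f = P h g"
    and ex: "h1 \<in> {1..V}" "P h1 f1"
  shows "\<exists>h0\<in>{1..V}. \<exists>f0. P h0 f0 \<and> (\<forall>h\<in>{1..V}. \<forall>f. P h f \<longrightarrow> F h f \<le> F h0 f0)"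
proof -
  define r where "r f i \<longleftrightarrow> i \<in> {i \<in> {1..V}. f i}" for f :: "nat \<Rightarrow> bool" and i
  have r: "F h (r f) = F h f" "P h (r f) = P h f" for h f
    by (rule F P; auto simp: r_def)+
  define X where "X = {(h, f) \<in> {1..V} \<times> range r. P h f}"
  have "range r \<subseteq> (\<lambda>A i. i \<in> A) ` Pow {1..V}"
  proof
    fix g assume "g \<in> range r"
    then obtain f where "g = r f" by blast
    then have "g = (\<lambda>i. i \<in> {i \<in> {1..V}. f i})" unfolding r_def by blast
    then show "g \<in> (\<lambda>A i. i \<in> A) ` Pow {1..V}" by blast
  qed
  then have "finite (range r)" by (rule finite_subset) simp
  then have "finite X" unfolding X_def by (rule_tac finite_subset[of _ "{1..V} \<times> range r"]) auto
  moreover have "(h1, r f1) \<in> X" using ex r by (simp add: X_def)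
  ultimately have "Max ((\<lambda>(h, f). F h f) ` X) \<in> (\<lambda>(h, f). F h f) ` X" by (intro Max_in) auto
  then obtain h0 f0 where 0: "(h0, f0) \<in> X" "F h0 f0 = Max ((\<lambda>(h, f). F h f) ` X)" by auto
  show ?thesis
  proof (intro bexI[of _ h0] exI[of _ f0] conjI ballI allI impI)
    show "h0 \<in> {1..V}" "P h0 f0" using 0(1) by (auto simp: X_def)
    fix h f assume "h \<in> {1..V}" "P h f"
    then have "(h, r f) \<in> X" using r by (simp add: X_def)
    then have "F h (r f) \<in> (\<lambda>(h, f). F h f) ` X" by force
    then have "F h (r f) \<le> F h0 f0" unfolding 0(2) using \<open>finite X\<close> by (intro Max_ge) auto
    then show "F h f \<le> F h0 f0" using r by simp
  qed
qed

interpretation fock: vector_space cscale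
  by unfold_locales (auto simp: cscale_def fun_eq_iff algebra_simps)

lemma sum_fvec_apply: "(\<Sum>x\<in>A. F x) S = (\<Sum>x\<in>A. (F x :: fvec) S)"
  by (induction A rule: infinite_finite_induct) auto

lemma amp_sum: "amp V (\<Sum>x\<in>A. F x) h f = (\<Sum>x\<in>A. amp V (F x) h f)"
  by (simp add: amp_def sum_fvec_apply sum_distrib_left)

section \<open>Comparison with the Perron vector: ground energy and ground states\<close>

locale perron_hubbard = hubbard +
  fixes \<phi> :: "nat \<Rightarrow> real" and l :: real
  assumes \<phi>_pos: "\<And>h. h \<in> {1..V} \<Longrightarrow> \<phi> h > 0"
    and \<phi>_eig: "\<And>h. h \<in> {1..V} \<Longrightarrow> (\<Sum>i\<in>{1..V}. t i h * \<phi> i) = l * \<phi> h"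
    and l_pos: "l > 0"
begin

lemma V1: "V \<ge> 1"
  using V3 by simp

lemma sym_state_ground: "sym_state V \<phi> g \<in> ground_space V t (- l)"
proof -
  have "H_inf V t (sym_state V \<phi> g) = cscale (complex_of_real (- l)) (sym_state V \<phi> g)"
  proof (rule H1_eqI[OF _ cscale_H1[OF sym_state_H1] V1])
    show "H_inf V t (sym_state V \<phi> g) \<in> H1 V" by (simp add: H1_def H_inf_outside)
    fix h f assume h: "h \<in> {1..V}"
    have "(\<Sum>i\<in>{1..V}. complex_of_real (t i h) * amp V (sym_state V \<phi> g) i (f \<circ> transpose h i)) =
        (\<Sum>i\<in>{1..V}. complex_of_real (t i h * \<phi> i) * g (ups V h f))"
      using h by (intro sum.cong refl) (simp add: amp_sym_state ups_transpose del: comp_apply)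
    also have "\<dots> = complex_of_real (l * \<phi> h) * g (ups V h f)"
      unfolding sum_distrib_right[symmetric] of_real_sum[symmetric] \<phi>_eig[OF h] ..
    finally show "amp V (H_inf V t (sym_state V \<phi> g)) h f = amp V (cscale (complex_of_real (- l)) (sym_state V \<phi> g)) h f"
      unfolding amp_H_inf[where t = t, OF h t_diag] amp_cscale amp_sym_state[OF h] by simp
  qed
  then show ?thesis by (simp add: ground_space_def sym_state_H1)
qed

text \<open>At a configuration where the ratio of the modulus of the amplitude to
  \<open>\<phi>\<close> is maximal, the triangle inequality in the eigenvalue equation, compared
  with \<open>\<phi>_eig\<close>, gives \<open>\<bar>e\<bar> \<le> l\<close>.\<close>

lemma eigenvalue_ge:
  assumes "eigvec_H1 V t e \<psi>"
  shows "- l \<le> e"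
proof -
  have \<psi>: "\<psi> \<in> H1 V" "\<psi> \<noteq> 0" "H_inf V t \<psi> = cscale (complex_of_real e) \<psi>"
    using assms by (auto simp: eigvec_H1_def)
  define F where "F h f = cmod (amp V \<psi> h f) / \<phi> h" for h f
  have F_cong: "F h f = F h g" if "\<And>i. i \<in> {1..V} - {h} \<Longrightarrow> f i = g i" for h f g
  proof -
    have "amp V \<psi> h f = amp V \<psi> h g" using that by (rule amp_cong)
    then show ?thesis by (simp add: F_def)
  qed
  have one: "1 \<in> {1..V}" using V1 by simp
  have "\<exists>h\<in>{1..V}. \<exists>f. True \<and> (\<forall>h'\<in>{1..V}. \<forall>f'. True \<longrightarrow> F h' f' \<le> F h f)"
  proof (rule exists_max_config)
    show "F h f = F h g" if "\<And>i. i \<in> {1..V} - {h} \<Longrightarrow> f i = g i" for h f g using that by (rule F_cong)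
  qed (rule refl one TrueI)+
  then obtain h f where h: "h \<in> {1..V}" and max: "\<And>h' f'. h' \<in> {1..V} \<Longrightarrow> F h' f' \<le> F h f"
    by blast
  have le: "cmod (amp V \<psi> i k) \<le> F h f * \<phi> i" if i: "i \<in> {1..V}" for i k
    using max[OF i, of k] \<phi>_pos[OF i] by (simp add: F_def field_simps)
  have eq: "cmod (amp V \<psi> h f) = F h f * \<phi> h" using \<phi>_pos[OF h] by (simp add: F_def)
  have F_pos: "F h f > 0"
  proof (rule ccontr)
    assume "\<not> F h f > 0"
    then have F0: "F h f \<le> 0" by simp
    have "amp V \<psi> i k = 0" if i: "i \<in> {1..V}" for i k
    proof -
      have "F h f * \<phi> i \<le> 0" using F0 \<phi>_pos[OF i] by (simp add: mult_nonpos_nonneg)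
      then show ?thesis using le[OF i, of k] by (metis norm_le_zero_iff order_trans)
    qed
    then have "\<psi> = 0" using \<psi>(1) V1 by (intro H1_eqI[of \<psi> V 0]) (auto simp: H1_def amp_def)
    then show False using \<psi>(2) by simp
  qed
  have "\<bar>e\<bar> * (F h f * \<phi> h) = cmod (amp V (H_inf V t \<psi>) h f)"
    unfolding \<psi>(3) amp_cscale norm_mult eq by simp
  also have "\<dots> = cmod (\<Sum>i\<in>{1..V}. complex_of_real (t i h) * amp V \<psi> i (f \<circ> transpose h i))"
    unfolding amp_H_inf[where t = t, OF h t_diag] by (rule norm_minus_cancel)
  also have "\<dots> \<le> (\<Sum>i\<in>{1..V}. cmod (complex_of_real (t i h) * amp V \<psi> i (f \<circ> transpose h i)))"
    by (rule norm_sum)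
  also have "\<dots> \<le> (\<Sum>i\<in>{1..V}. F h f * (t i h * \<phi> i))"
  proof (rule sum_mono)
    fix i assume i: "i \<in> {1..V}"
    have "cmod (complex_of_real (t i h) * amp V \<psi> i (f \<circ> transpose h i)) = t i h * cmod (amp V \<psi> i (f \<circ> transpose h i))"
      using t_nonneg[of i h] by (simp add: norm_mult)
    also have "\<dots> \<le> t i h * (F h f * \<phi> i)" using le[OF i] t_nonneg by (rule mult_left_mono)
    finally show "cmod (complex_of_real (t i h) * amp V \<psi> i (f \<circ> transpose h i)) \<le> F h f * (t i h * \<phi> i)"
      by (simp add: mult_ac)
  qed
  also have "\<dots> = l * (F h f * \<phi> h)"
    unfolding sum_distrib_left[symmetric] \<phi>_eig[OF h] by simp
  finally have "\<bar>e\<bar> \<le> l" using F_pos \<phi>_pos[OF h] by (simp add: mult_le_cancel_right)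
  then show ?thesis by simp
qed

text \<open>A ground state divided by the Perron vector is harmonic on each sector, hence constant there by
  the maximum principle.\<close>

lemma harmonic_constant:
  fixes b :: "nat \<Rightarrow> (nat \<Rightarrow> bool) \<Rightarrow> real"
  assumes pc: "puzzle_connected V E k"
    and b_cong: "\<And>h f g. (\<And>i. i \<in> {1..V} - {h} \<Longrightarrow> f i = g i) \<Longrightarrow> b h f = b h g"
    and harm: "\<And>h f. h \<in> {1..V} \<Longrightarrow> (\<Sum>i\<in>{1..V}. t i h * \<phi> i * b i (f \<circ> transpose h i)) = l * \<phi> h * b h f"
    and h: "h \<in> {1..V}" "ups V h f = k" and h': "h' \<in> {1..V}" "ups V h' f' = k"
  shows "b h f = b h' f'"
proof -
  have ups_cong': "(ups V h f = k) = (ups V h g = k)" if "\<And>i. i \<in> {1..V} - {h} \<Longrightarrow> f i = g i" for h f g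
  proof -
    have "ups V h f = ups V h g" using that by (rule ups_cong)
    then show ?thesis by simp
  qed
  have "\<exists>h0\<in>{1..V}. \<exists>f0. ups V h0 f0 = k \<and> (\<forall>h\<in>{1..V}. \<forall>f. ups V h f = k \<longrightarrow> b h f \<le> b h0 f0)"
  proof (rule exists_max_config)
    show "b h f = b h g" if "\<And>i. i \<in> {1..V} - {h} \<Longrightarrow> f i = g i" for h f g using that by (rule b_cong)
    show "(ups V h f = k) = (ups V h g = k)" if "\<And>i. i \<in> {1..V} - {h} \<Longrightarrow> f i = g i" for h f g
      using that by (rule ups_cong')
  qed (rule h)+
  then obtain h0 f0 where 0: "h0 \<in> {1..V}" "ups V h0 f0 = k"
    and max: "\<And>h f. h \<in> {1..V} \<Longrightarrow> ups V h f = k \<Longrightarrow> b h f \<le> b h0 f0"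
    by blast
  let ?M = "b h0 f0"
  have step: "b i (f \<circ> transpose h i) = ?M" if h: "h \<in> {1..V}" "ups V h f = k" "b h f = ?M" and e: "E h i" for h f i
  proof -
    have i: "i \<in> {1..V}" "E i h" using simple_graphD[OF graph] e by (auto dest: sympD)
    have nonneg: "t j h * \<phi> j * (?M - b j (f \<circ> transpose h j)) \<ge> 0" if j: "j \<in> {1..V}" for j
    proof -
      have "b j (f \<circ> transpose h j) \<le> ?M" using j h by (intro max) (simp_all add: ups_transpose)
      then show ?thesis using t_nonneg[of j h] \<phi>_pos[OF j] by simp
    qed
    \<comment> \<open>The nonnegative defects from the maximum add up to 0 by \<open>harm\<close>
      and \<open>\<phi>_eig\<close>, so every neighbour attains the maximum too.\<close>
    have "(\<Sum>j\<in>{1..V}. t j h * \<phi> j * (?M - b j (f \<circ> transpose h j))) =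
        (\<Sum>j\<in>{1..V}. t j h * \<phi> j) * ?M - (\<Sum>j\<in>{1..V}. t j h * \<phi> j * b j (f \<circ> transpose h j))"
      unfolding right_diff_distrib sum_subtractf sum_distrib_right ..
    also have "\<dots> = 0" unfolding \<phi>_eig[OF h(1)] harm[OF h(1)] using h(3) by simp
    finally have "t i h * \<phi> i * (?M - b i (f \<circ> transpose h i)) = 0"
      using nonneg i(1) by (subst (asm) sum_nonneg_eq_0_iff) auto
    then show ?thesis using t_pos[OF i(2)] \<phi>_pos[OF i(1)] by simp
  qed
  have along: "b v g = ?M" if "slide E h0 f0 v g" for v g
    using that
  proof (induction rule: slide.induct)
    case (slide_step v g w)
    have "v \<in> {1..V}" "ups V v g = k" using slide_ups[OF slide_step.hyps(1) graph 0(1)] 0(2) by auto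
    then show ?case using step slide_step by blast
  qed simp
  have "b v g = ?M" if v: "v \<in> {1..V}" "ups V v g = k" for v g
  proof -
    obtain g' where g': "slide E h0 f0 v g'" "\<And>i. i \<in> {1..V} - {v} \<Longrightarrow> g' i = g i"
      using pc 0 v unfolding puzzle_connected_def by blast
    have "b v g' = b v g" using g'(2) by (rule b_cong)
    then show ?thesis using along[OF g'(1)] by simp
  qed
  then show ?thesis using h h' by simp
qed

text \<open>A representative of the sector with \<open>k\<close> up spins for the hole at site 1,
  hence the start at 2.\<close>

definition ref_conf :: "nat \<Rightarrow> nat \<Rightarrow> bool" where
  "ref_conf k i \<longleftrightarrow> i \<in> {2..k + 1}"

lemma ups_ref_conf: "k < V \<Longrightarrow> ups V 1 (ref_conf k) = k"
proof -
  assume "k < V"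
  then have "{i \<in> {1..V} - {1}. ref_conf k i} = {2..k + 1}" by (auto simp: ref_conf_def)
  then show ?thesis by (simp add: ups_def)
qed

text \<open>\<open>harmonic_constant\<close> applies to the real and imaginary parts of the
  amplitudes divided by \<open>\<phi>\<close>. The constants of the sectors, read off at
  \<open>ref_conf\<close>, form \<open>g\<close>.\<close>

lemma ground_is_sym_state:
  assumes pc: "\<And>k. puzzle_connected V E k" and \<psi>: "\<psi> \<in> ground_space V t (- l)"
  shows "\<exists>g. \<psi> = sym_state V \<phi> g"
proof -
  have H: "\<psi> \<in> H1 V" "H_inf V t \<psi> = cscale (complex_of_real (- l)) \<psi>"
    using \<psi> by (auto simp: ground_space_def)
  have one: "1 \<in> {1..V}" using V1 by simp
  have harm: "(\<Sum>i\<in>{1..V}. complex_of_real (t i h) * amp V \<psi> i (f \<circ> transpose h i)) = complex_of_real l * amp V \<psi> h f"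
    if h: "h \<in> {1..V}" for h f
    using amp_H_inf[where t = t, OF h t_diag, of \<psi> f] unfolding H(2) amp_cscale by simp
  have const: "R (amp V \<psi> h f) / \<phi> h = R (amp V \<psi> h' f') / \<phi> h'"
    if R: "R = Re \<or> R = Im" and h: "h \<in> {1..V}" "h' \<in> {1..V}" "ups V h f = ups V h' f'" for R h h' f f'
  proof (rule harmonic_constant[OF pc, of "\<lambda>h f. R (amp V \<psi> h f) / \<phi> h"])
    show "R (amp V \<psi> h f) / \<phi> h = R (amp V \<psi> h g) / \<phi> h" if "\<And>i. i \<in> {1..V} - {h} \<Longrightarrow> f i = g i" for h f g
    proof -
      have "amp V \<psi> h f = amp V \<psi> h g" using that by (rule amp_cong)
      then show ?thesis by simp
    qed
    show "(\<Sum>i\<in>{1..V}. t i h * \<phi> i * (R (amp V \<psi> i (f \<circ> transpose h i)) / \<phi> i)) = l * \<phi> h * (R (amp V \<psi> h f) / \<phi> h)"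
      if h: "h \<in> {1..V}" for h f
    proof -
      have "(\<Sum>i\<in>{1..V}. t i h * \<phi> i * (R (amp V \<psi> i (f \<circ> transpose h i)) / \<phi> i)) =
          (\<Sum>i\<in>{1..V}. R (complex_of_real (t i h) * amp V \<psi> i (f \<circ> transpose h i)))"
      proof (rule sum.cong[OF refl])
        fix i assume i: "i \<in> {1..V}"
        show "t i h * \<phi> i * (R (amp V \<psi> i (f \<circ> transpose h i)) / \<phi> i) = R (complex_of_real (t i h) * amp V \<psi> i (f \<circ> transpose h i))"
          using R \<phi>_pos[OF i] by auto
      qed
      also have "\<dots> = R (\<Sum>i\<in>{1..V}. complex_of_real (t i h) * amp V \<psi> i (f \<circ> transpose h i))"
        using R by (auto simp only: Re_sum Im_sum)
      also have "\<dots> = l * R (amp V \<psi> h f)" unfolding harm[OF h] using R by auto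
      finally show ?thesis using \<phi>_pos[OF h] by simp
    qed
  qed (use h in auto)
  define g where "g k = amp V \<psi> 1 (ref_conf k) / complex_of_real (\<phi> 1)" for k
  have "\<psi> = sym_state V \<phi> g"
  proof (rule H1_eqI[OF H(1) sym_state_H1 V1])
    fix h f assume h: "h \<in> {1..V}"
    define k where "k = ups V h f"
    have "k < V" using ups_complement[OF h, of f] V1 unfolding k_def by linarith
    then have "ups V h f = ups V 1 (ref_conf k)" using ups_ref_conf[of k] by (simp only: k_def)
    then have "Re (amp V \<psi> h f) / \<phi> h = Re (amp V \<psi> 1 (ref_conf k)) / \<phi> 1"
      "Im (amp V \<psi> h f) / \<phi> h = Im (amp V \<psi> 1 (ref_conf k)) / \<phi> 1"
      using const[of _ h 1] h one by blast+
    then have "amp V \<psi> h f / complex_of_real (\<phi> h) = g k"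
      unfolding g_def by (intro complex_eqI) simp_all
    then show "amp V \<psi> h f = amp V (sym_state V \<phi> g) h f"
      unfolding amp_sym_state[OF h] k_def[symmetric] using \<phi>_pos[OF h] by (auto simp: field_simps)
  qed
  then show ?thesis by blast
qed

definition sector_state :: "nat \<Rightarrow> fvec" where
  "sector_state k = sym_state V \<phi> (\<lambda>j. if j = k then 1 else 0)"

lemma sym_state_expand: "sym_state V \<phi> g = (\<Sum>k<V. cscale (g k) (sector_state k))"
proof (rule H1_eqI[OF sym_state_H1 _ V1])
  show "(\<Sum>k<V. cscale (g k) (sector_state k)) \<in> H1 V"
    by (simp add: H1_def sum_fvec_apply cscale_def sector_state_def sym_state_def)
  fix h f assume h: "h \<in> {1..V}"
  have lt: "ups V h f < V" using ups_complement[OF h, of f] V1 by linarith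
  have "amp V (\<Sum>k<V. cscale (g k) (sector_state k)) h f = (\<Sum>k<V. g k * (of_real (\<phi> h) * (if ups V h f = k then 1 else 0)))"
    unfolding amp_sum amp_cscale sector_state_def amp_sym_state[OF h] ..
  also have "\<dots> = g (ups V h f) * (of_real (\<phi> h) * (if ups V h f = ups V h f then 1 else 0))"
    using lt by (intro sum_single) auto
  finally show "amp V (sym_state V \<phi> g) h f = amp V (\<Sum>k<V. cscale (g k) (sector_state k)) h f"
    unfolding amp_sym_state[OF h] by simp
qed

lemma amp_sector_state: "j < V \<Longrightarrow> amp V (sector_state k) 1 (ref_conf j) = of_real (\<phi> 1) * (if j = k then 1 else 0)"
  unfolding sector_state_def using amp_sym_state[of 1 V] V1 ups_ref_conf by simp

text \<open>The sector states, one for each number of up spins below \<open>V\<close>, form a basis: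
  evaluation at \<open>ref_conf j\<close> isolates the coefficient of
  \<open>sector_state j\<close>.\<close>

lemma cdim_ground_space:
  assumes pc: "\<And>k. puzzle_connected V E k"
  shows "cdim (ground_space V t (- l)) = V"
proof -
  have \<phi>1: "\<phi> 1 \<noteq> 0" using \<phi>_pos[of 1] V1 by simp
  let ?B = "sector_state ` {..<V}"
  have inj: "inj_on sector_state {..<V}"
  proof (rule inj_onI)
    fix j k assume jk: "j \<in> {..<V}" "k \<in> {..<V}" "sector_state j = sector_state k"
    then have "amp V (sector_state k) 1 (ref_conf j) = of_real (\<phi> 1)" using amp_sector_state[of j j] by simp
    then show "j = k" using amp_sector_state[of j k] jk \<phi>1 by (auto split: if_splits)
  qed
  have "fock.independent ?B"
  proof (rule fock.independent_if_scalars_zero)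
    fix c x assume sum0: "(\<Sum>x\<in>?B. cscale (c x) x) = 0" and "x \<in> ?B"
    then obtain j where j: "j < V" "x = sector_state j" by blast
    have "(\<Sum>k<V. cscale (c (sector_state k)) (sector_state k)) = 0"
      using sum0 by (simp add: sum.reindex[OF inj])
    then have "amp V (\<Sum>k<V. cscale (c (sector_state k)) (sector_state k)) 1 (ref_conf j) = 0"
      by (simp add: amp_def)
    then have "(\<Sum>k<V. c (sector_state k) * (of_real (\<phi> 1) * (if j = k then 1 else 0))) = 0"
      unfolding amp_sum amp_cscale amp_sector_state[OF j(1)] .
    moreover have "(\<Sum>k<V. c (sector_state k) * (of_real (\<phi> 1) * (if j = k then 1 else 0))) =
        c (sector_state j) * (of_real (\<phi> 1) * (if j = j then 1 else 0))"
      using j by (intro sum_single) auto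
    ultimately show "c x = 0" using \<phi>1 j by simp
  qed simp
  moreover have "fock.span ?B = fock.span (ground_space V t (- l))"
  proof
    have "?B \<subseteq> ground_space V t (- l)" using sym_state_ground by (auto simp: sector_state_def)
    then show "fock.span ?B \<subseteq> fock.span (ground_space V t (- l))" by (rule fock.span_mono)
    have "ground_space V t (- l) \<subseteq> fock.span ?B"
    proof
      fix \<psi> assume "\<psi> \<in> ground_space V t (- l)"
      then obtain g where "\<psi> = sym_state V \<phi> g" using ground_is_sym_state[OF pc] by blast
      then have "\<psi> = (\<Sum>k<V. cscale (g k) (sector_state k))" using sym_state_expand by simp
      moreover have "(\<Sum>k<V. cscale (g k) (sector_state k)) \<in> fock.span ?B"
        by (intro fock.span_sum fock.span_scale fock.span_base imageI)
      ultimately show "\<psi> \<in> fock.span ?B" by simp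
    qed
    then show "fock.span (ground_space V t (- l)) \<subseteq> fock.span ?B"
      by (simp add: fock.span_minimal)
  qed
  ultimately have "fock.dim (ground_space V t (- l)) = card ?B" by (intro fock.dim_eq_card)
  then show ?thesis unfolding cdim_def by (simp add: card_image[OF inj])
qed

lemma exists_ground_state: "\<exists>\<psi>. eigvec_H1 V t (- l) \<psi>"
proof -
  have "sector_state 0 \<in> ground_space V t (- l)" unfolding sector_state_def by (rule sym_state_ground)
  moreover have "sector_state 0 \<noteq> 0"
  proof
    assume "sector_state 0 = 0"
    then have "amp V (sector_state 0) 1 (ref_conf 0) = 0" by (simp add: amp_def)
    then show False using amp_sector_state[of 0 0] \<phi>_pos[of 1] V1 by simp
  qed
  ultimately show ?thesis unfolding eigvec_H1_def ground_space_def by blast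
qed

end

theorem theorem1:
  fixes V :: nat and E :: "nat \<Rightarrow> nat \<Rightarrow> bool" and t :: "nat \<Rightarrow> nat \<Rightarrow> real"
  assumes "V \<ge> 3"
    and "simple_graph V E"
    and "graph_connected V E"
    and "\<forall>i j. t i j = t j i"
    and "\<forall>i j. E i j \<longrightarrow> t i j > 0"
    and "\<forall>i j. \<not> E i j \<longrightarrow> t i j = 0"
  shows "(connectivity V t \<longleftrightarrow> non_separable V E \<and> \<not> (is_polygon V E \<and> V \<ge> 5))
    \<and> (non_separable V E \<and> \<not> (is_polygon V E \<and> V \<ge> 5) \<longrightarrow>
        (\<exists>E0::real.
           (\<exists>\<psi>. eigvec_H1 V t E0 \<psi>)
         \<and> (\<forall>E' \<psi>. eigvec_H1 V t E' \<psi> \<longrightarrow> E0 \<le> E')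
         \<and> cdim (ground_space V t E0) = V
         \<and> (\<forall>\<psi>\<in>ground_space V t E0.
              S_tot_sq V \<psi> = cscale (complex_of_real (((real V - 1) / 2) * ((real V - 1) / 2 + 1))) \<psi>)))"
proof -
  interpret hubbard V E t
    using assms by unfold_locales auto
  obtain \<phi> l where \<phi>: "\<forall>h\<in>{1..V}. \<phi> h > 0"
    "\<forall>h\<in>{1..V}. (\<Sum>i\<in>{1..V}. t i h * \<phi> i) = l * \<phi> h" "l > 0"
    using perron by blast
  interpret perron_hubbard V E t \<phi> l
    using \<phi> by unfold_locales blast+
  have "\<exists>E0::real. (\<exists>\<psi>. eigvec_H1 V t E0 \<psi>) \<and> (\<forall>E' \<psi>. eigvec_H1 V t E' \<psi> \<longrightarrow> E0 \<le> E')
      \<and> cdim (ground_space V t E0) = V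
      \<and> (\<forall>\<psi>\<in>ground_space V t E0.
           S_tot_sq V \<psi> = cscale (complex_of_real (((real V - 1) / 2) * ((real V - 1) / 2 + 1))) \<psi>)"
    if "non_separable V E" "\<not> (is_polygon V E \<and> V \<ge> 5)"
  proof -
    have "freely_permutable E {1..V}" using that graph V3 by (intro non_separable_freely_permutable)
    \<comment> \<open>All sectors are connected, not only the minimal one, which determines the
      ground state of each sector up to a factor.\<close>
    then have pc: "puzzle_connected V E k" for k
      by (rule freely_permutable_puzzle_connected[OF _ graph])
    have "S_tot_sq V \<psi> = cscale (complex_of_real (((real V - 1) / 2) * ((real V - 1) / 2 + 1))) \<psi>"
      if "\<psi> \<in> ground_space V t (- l)" for \<psi>
      using ground_is_sym_state[OF pc that] S_tot_sq_sym_state[OF V1] by blast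
    then show ?thesis
      using exists_ground_state eigenvalue_ge cdim_ground_space[OF pc] by blast
  qed
  then show ?thesis using connectivity_iff by blast
qed

end
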